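(* Let $(\mathbb{R}\times S,g)$ be a standard stationary spacetime with associated Fermat metric $F$ on $S$. A slice $S_{t_0}=\{t_0\}\times S$, $t_0\in\mathbb{R}$, is a Cauchy hypersurface if and only if the Fermat metric $F$ on $S$ is forward and backward complete.
   Context: Standard stationary spacetime: $S$ is a smooth connected (paracompact) manifold, $\pi:\mathbb{R}\times S\to S$ and $t:\mathbb{R}\times S\to\mathbb{R}$ are the projections, and $g=-(\beta\circ\pi)\,dt^2+\pi^*\omega\otimes dt+dt\otimes\pi^*\omega+\pi^*g_0$, where $g_0$ is a Riemannian metric, $\omega$ a smooth $1$-form and $\beta$ a smooth positive function on $S$; the time-orientation makes $\partial_t$ future-pointing. Fermat metric: the Finsler metric on $S$ given by $F(v)=\frac{1}{\beta}\omega(v)+\sqrt{\frac{1}{\beta}g_0(v,v)+\frac{1}{\beta^2}\omega(v)^2}$, $v\in TS$. A Finsler manifold is forward (resp. backward) complete if all its geodesics can be extended to domains of the form $(a,+\infty)$ (resp. $(-\infty,b)$); equivalently, if the generalized metric space $(S,d)$ is forward (resp. backward) complete, where $d(p,q)$ is the infimum of the $F$-lengths of piecewise smooth curves from $p$ to $q$, and forward (resp. backward) Cauchy sequences $\{x_i\}$ are those such that for all $\varepsilon>0$ there is $N$ with $d(x_i,x_j)<\varepsilon$ whenever $i,j>N$ and $i\le j$ (resp. $i\ge j$). A Cauchy hypersurface is a subset met exactly once by every inextensible timelike curve. *)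

theory Defs
  imports "HOL-Analysis.Analysis"
begin

subsection \<open>Smooth maps between Euclidean spaces\<close>

primrec higher_differentiable_on ::
  "nat \<Rightarrow> 'a::real_normed_vector set \<Rightarrow> ('a \<Rightarrow> 'b::real_normed_vector) \<Rightarrow> bool" where
  "higher_differentiable_on 0 U f \<longleftrightarrow> continuous_on U f"
| "higher_differentiable_on (Suc n) U f \<longleftrightarrow>
     (\<forall>x\<in>U. f differentiable at x) \<and>
     (\<forall>v. higher_differentiable_on n U (\<lambda>x. frechet_derivative f (at x) v))"

text \<open>\<open>C\<^sup>\<infinity>\<close> on a possibly non-open set (such as a compact interval): there is a \<open>C\<^sup>\<infinity>\<close> extension
  to an open neighbourhood. For open sets this is ordinary \<open>C\<^sup>\<infinity>\<close> smoothness.\<close>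

definition smooth_on :: "'a::real_normed_vector set \<Rightarrow> ('a \<Rightarrow> 'b::real_normed_vector) \<Rightarrow> bool" where
  "smooth_on K f \<longleftrightarrow>
     (\<exists>U g. open U \<and> K \<subseteq> U \<and> (\<forall>n. higher_differentiable_on n U g) \<and> (\<forall>x\<in>K. g x = f x))"


subsection \<open>Smooth manifolds\<close>

definition paracompact_space :: "'s::topological_space itself \<Rightarrow> bool" where
  "paracompact_space _ \<longleftrightarrow>
     (\<forall>\<U>::'s set set. (\<forall>U\<in>\<U>. open U) \<and> \<Union>\<U> = UNIV \<longrightarrow>
        (\<exists>\<V>. (\<forall>V\<in>\<V>. open V) \<and> \<Union>\<V> = UNIV \<and> (\<forall>V\<in>\<V>. \<exists>U\<in>\<U>. V \<subseteq> U) \<and>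
             locally_finite_in euclidean \<V>))"

text \<open>A chart is a pair of a domain and a coordinate map; the values of the coordinate map outside
  the domain are irrelevant.\<close>

type_synonym ('s, 'e) chart = "'s set \<times> ('s \<Rightarrow> 'e)"

definition chart_inv :: "('s, 'e) chart \<Rightarrow> 'e \<Rightarrow> 's" where
  "chart_inv c = inv_into (fst c) (snd c)"

definition is_chart :: "('s::topological_space, 'e::euclidean_space) chart \<Rightarrow> bool" where
  "is_chart c \<longleftrightarrow> open (fst c) \<and> open (snd c ` fst c) \<and>
     homeomorphism (fst c) (snd c ` fst c) (snd c) (chart_inv c)"

text \<open>The manifold is the whole (topological) type \<open>'s\<close>, with a smooth structure given by the
  atlas \<open>A\<close>.\<close>

locale smooth_manifold =
  fixes A :: "('s::t2_space, 'e::euclidean_space) chart set"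
  assumes paracompact: "paracompact_space TYPE('s)"
    and charts: "c \<in> A \<Longrightarrow> is_chart c"
    and covering: "(\<Union>c\<in>A. fst c) = UNIV"
    and compatible: "\<lbrakk>c \<in> A; c' \<in> A\<rbrakk> \<Longrightarrow>
      smooth_on (snd c ` (fst c \<inter> fst c')) (snd c' \<circ> chart_inv c)"

definition smooth_function :: "('s, 'e::euclidean_space) chart set \<Rightarrow> ('s \<Rightarrow> real) \<Rightarrow> bool" where
  "smooth_function A f \<longleftrightarrow> (\<forall>c\<in>A. smooth_on (snd c ` fst c) (f \<circ> chart_inv c))"


subsection \<open>Tangent vectors and tensor fields\<close>

text \<open>A tangent vector at \<open>p\<close> assigns to each chart of the atlas around \<open>p\<close> its coordinate vector,
  consistently with the chain rule for changes of charts; at all other pairs it is \<open>0\<close>, so that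
  distinct functions represent distinct vectors. The vector space operations are pointwise.\<close>

type_synonym ('s, 'e) tangent = "('s, 'e) chart \<Rightarrow> 'e"

definition change_of_coordinates ::
  "('s, 'e::euclidean_space) chart \<Rightarrow> ('s, 'e) chart \<Rightarrow> 's \<Rightarrow> 'e \<Rightarrow> 'e" where
  "change_of_coordinates c c' p = frechet_derivative (snd c' \<circ> chart_inv c) (at (snd c p))"

definition tangent_space ::
  "('s, 'e::euclidean_space) chart set \<Rightarrow> 's \<Rightarrow> ('s, 'e) tangent set" where
  "tangent_space A p = {\<xi>.
     (\<forall>c. \<not> (c \<in> A \<and> p \<in> fst c) \<longrightarrow> \<xi> c = 0) \<and>
     (\<forall>c\<in>A. \<forall>c'\<in>A. p \<in> fst c \<and> p \<in> fst c' \<longrightarrow> \<xi> c' = change_of_coordinates c c' p (\<xi> c))}"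

text \<open>The tangent vector at \<open>p\<close> with coordinate vector \<open>v\<close> in the chart \<open>c\<close>.\<close>

definition coord_vector ::
  "('s, 'e::euclidean_space) chart set \<Rightarrow> 's \<Rightarrow> ('s, 'e) chart \<Rightarrow> 'e \<Rightarrow> ('s, 'e) tangent" where
  "coord_vector A p c v =
     (\<lambda>c'. if c' \<in> A \<and> p \<in> fst c' then change_of_coordinates c c' p v else 0)"

definition linear_on_tangent ::
  "('s, 'e::euclidean_space) chart set \<Rightarrow> 's \<Rightarrow> (('s, 'e) tangent \<Rightarrow> real) \<Rightarrow> bool" where
  "linear_on_tangent A p \<alpha> \<longleftrightarrow>
     (\<forall>\<xi>\<in>tangent_space A p. \<forall>\<eta>\<in>tangent_space A p. \<alpha> (\<lambda>c. \<xi> c + \<eta> c) = \<alpha> \<xi> + \<alpha> \<eta>) \<and>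
     (\<forall>r. \<forall>\<xi>\<in>tangent_space A p. \<alpha> (\<lambda>c. r *\<^sub>R \<xi> c) = r * \<alpha> \<xi>)"

definition smooth_one_form ::
  "('s, 'e::euclidean_space) chart set \<Rightarrow> ('s \<Rightarrow> ('s, 'e) tangent \<Rightarrow> real) \<Rightarrow> bool" where
  "smooth_one_form A \<omega> \<longleftrightarrow>
     (\<forall>p. linear_on_tangent A p (\<omega> p)) \<and>
     (\<forall>c\<in>A. \<forall>v. smooth_on (snd c ` fst c)
        (\<lambda>x. \<omega> (chart_inv c x) (coord_vector A (chart_inv c x) c v)))"

definition riemannian_metric ::
  "('s, 'e::euclidean_space) chart set \<Rightarrow>
   ('s \<Rightarrow> ('s, 'e) tangent \<Rightarrow> ('s, 'e) tangent \<Rightarrow> real) \<Rightarrow> bool" where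
  "riemannian_metric A h \<longleftrightarrow>
     (\<forall>p. \<forall>\<xi>\<in>tangent_space A p. linear_on_tangent A p (h p \<xi>)) \<and>
     (\<forall>p. \<forall>\<xi>\<in>tangent_space A p. \<forall>\<eta>\<in>tangent_space A p. h p \<xi> \<eta> = h p \<eta> \<xi>) \<and>
     (\<forall>p. \<forall>\<xi>\<in>tangent_space A p. \<xi> \<noteq> (\<lambda>c. 0) \<longrightarrow> h p \<xi> \<xi> > 0) \<and>
     (\<forall>c\<in>A. \<forall>v w. smooth_on (snd c ` fst c)
        (\<lambda>x. h (chart_inv c x) (coord_vector A (chart_inv c x) c v)
                               (coord_vector A (chart_inv c x) c w)))"


subsection \<open>Curves\<close>

definition smooth_curve_on ::
  "('s, 'e::euclidean_space) chart set \<Rightarrow> (real \<Rightarrow> 's) \<Rightarrow> real set \<Rightarrow> bool" where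
  "smooth_curve_on A \<gamma> K \<longleftrightarrow>
     (\<forall>s\<in>K. \<exists>c\<in>A. \<exists>J. open J \<and> s \<in> J \<and> \<gamma> ` (J \<inter> K) \<subseteq> fst c \<and> smooth_on (J \<inter> K) (snd c \<circ> \<gamma>))"

text \<open>The velocity within \<open>K\<close>; at an end point of an interval \<open>K\<close> it is the one-sided velocity.\<close>

definition velocity ::
  "('s, 'e::euclidean_space) chart set \<Rightarrow> (real \<Rightarrow> 's) \<Rightarrow> real set \<Rightarrow> real \<Rightarrow> ('s, 'e) tangent" where
  "velocity A \<gamma> K s =
     (\<lambda>c. if c \<in> A \<and> \<gamma> s \<in> fst c then vector_derivative (snd c \<circ> \<gamma>) (at s within K) else 0)"

text \<open>\<open>Q\<close> holds on each piece (with its end points) of some finite partition of \<open>{a..b}\<close>.\<close>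

definition piecewise_on :: "(real set \<Rightarrow> bool) \<Rightarrow> real \<Rightarrow> real \<Rightarrow> bool" where
  "piecewise_on Q a b \<longleftrightarrow>
     (\<exists>P. finite P \<and> a \<in> P \<and> b \<in> P \<and> P \<subseteq> {a..b} \<and>
        (\<forall>u\<in>P. \<forall>v\<in>P. u < v \<and> P \<inter> {u<..<v} = {} \<longrightarrow> Q {u..v}))"

definition piecewise_smooth_curve ::
  "('s, 'e::euclidean_space) chart set \<Rightarrow> (real \<Rightarrow> 's) \<Rightarrow> real \<Rightarrow> real \<Rightarrow> bool" where
  "piecewise_smooth_curve A \<gamma> a b \<longleftrightarrow> piecewise_on (smooth_curve_on A \<gamma>) a b"


subsection \<open>Finsler distance and completeness\<close>

definition curve_length ::
  "('s, 'e::euclidean_space) chart set \<Rightarrow> ('s \<Rightarrow> ('s, 'e) tangent \<Rightarrow> real) \<Rightarrow>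
   (real \<Rightarrow> 's) \<Rightarrow> real \<Rightarrow> real \<Rightarrow> real" where
  "curve_length A F \<gamma> a b = integral {a..b} (\<lambda>s. F (\<gamma> s) (velocity A \<gamma> {a..b} s))"

definition finsler_dist ::
  "('s, 'e::euclidean_space) chart set \<Rightarrow> ('s \<Rightarrow> ('s, 'e) tangent \<Rightarrow> real) \<Rightarrow> 's \<Rightarrow> 's \<Rightarrow> real" where
  "finsler_dist A F p q =
     Inf {curve_length A F \<gamma> a b |\<gamma> a b.
            a < b \<and> piecewise_smooth_curve A \<gamma> a b \<and> \<gamma> a = p \<and> \<gamma> b = q}"

definition forward_Cauchy :: "('s \<Rightarrow> 's \<Rightarrow> real) \<Rightarrow> (nat \<Rightarrow> 's) \<Rightarrow> bool" where
  "forward_Cauchy d x \<longleftrightarrow>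
     (\<forall>\<epsilon>>0. \<exists>N. \<forall>i j. i > N \<and> j > N \<and> i \<le> j \<longrightarrow> d (x i) (x j) < \<epsilon>)"

definition backward_Cauchy :: "('s \<Rightarrow> 's \<Rightarrow> real) \<Rightarrow> (nat \<Rightarrow> 's) \<Rightarrow> bool" where
  "backward_Cauchy d x \<longleftrightarrow>
     (\<forall>\<epsilon>>0. \<exists>N. \<forall>i j. i > N \<and> j > N \<and> i \<ge> j \<longrightarrow> d (x i) (x j) < \<epsilon>)"

text \<open>Convergence is meant in the manifold topology, which is also the topology generated by the
  forward balls, and the one generated by the backward balls, of a Finsler metric.\<close>

definition forward_complete ::
  "('s::topological_space, 'e::euclidean_space) chart set \<Rightarrow> ('s \<Rightarrow> ('s, 'e) tangent \<Rightarrow> real) \<Rightarrow> bool"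
  where
  "forward_complete A F \<longleftrightarrow> (\<forall>x. forward_Cauchy (finsler_dist A F) x \<longrightarrow> convergent x)"

definition backward_complete ::
  "('s::topological_space, 'e::euclidean_space) chart set \<Rightarrow> ('s \<Rightarrow> ('s, 'e) tangent \<Rightarrow> real) \<Rightarrow> bool"
  where
  "backward_complete A F \<longleftrightarrow> (\<forall>x. backward_Cauchy (finsler_dist A F) x \<longrightarrow> convergent x)"


subsection \<open>Standard stationary spacetimes\<close>

locale standard_stationary = smooth_manifold A
  for A :: "('s::t2_space, 'e::euclidean_space) chart set" +
  fixes g0 :: "'s \<Rightarrow> ('s, 'e) tangent \<Rightarrow> ('s, 'e) tangent \<Rightarrow> real"
    and \<omega> :: "'s \<Rightarrow> ('s, 'e) tangent \<Rightarrow> real"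
    and \<beta> :: "'s \<Rightarrow> real"
  assumes connected_base: "connected (UNIV :: 's set)"
    and riemannian: "riemannian_metric A g0"
    and one_form: "smooth_one_form A \<omega>"
    and smooth_lapse: "smooth_function A \<beta>"
    and positive_lapse: "\<beta> p > 0"

text \<open>The tangent space of \<open>\<real> \<times> S\<close> at \<open>(t, p)\<close> is identified with \<open>\<real> \<times> T\<^sub>p S\<close> by \<open>(dt, d\<pi>)\<close>;
  in particular \<open>\<partial>\<^sub>t\<close> is \<open>(1, 0)\<close>.\<close>

definition stationary_metric ::
  "('s \<Rightarrow> ('s, 'e) tangent \<Rightarrow> ('s, 'e) tangent \<Rightarrow> real) \<Rightarrow> ('s \<Rightarrow> ('s, 'e) tangent \<Rightarrow> real) \<Rightarrow>
   ('s \<Rightarrow> real) \<Rightarrow> real \<times> 's \<Rightarrow> real \<times> ('s, 'e) tangent \<Rightarrow> real \<times> ('s, 'e) tangent \<Rightarrow> real" where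
  "stationary_metric g0 \<omega> \<beta> z X Y =
     - \<beta> (snd z) * fst X * fst Y + \<omega> (snd z) (snd X) * fst Y + fst X * \<omega> (snd z) (snd Y)
     + g0 (snd z) (snd X) (snd Y)"

definition partial_t :: "real \<times> ('s, 'e::euclidean_space) tangent" where
  "partial_t = (1, \<lambda>c. 0)"

definition fermat_metric ::
  "('s \<Rightarrow> ('s, 'e) tangent \<Rightarrow> ('s, 'e) tangent \<Rightarrow> real) \<Rightarrow> ('s \<Rightarrow> ('s, 'e) tangent \<Rightarrow> real) \<Rightarrow>
   ('s \<Rightarrow> real) \<Rightarrow> 's \<Rightarrow> ('s, 'e) tangent \<Rightarrow> real" where
  "fermat_metric g0 \<omega> \<beta> p \<xi> =
     1 / \<beta> p * \<omega> p \<xi> + sqrt (1 / \<beta> p * g0 p \<xi> \<xi> + 1 / (\<beta> p)\<^sup>2 * (\<omega> p \<xi>)\<^sup>2)"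


subsection \<open>Timelike curves and Cauchy hypersurfaces\<close>

text \<open>From here on \<open>g\<close> is a Lorentzian metric on \<open>\<real> \<times> S\<close>, time-oriented by \<open>\<partial>\<^sub>t\<close>.\<close>

type_synonym ('s, 'e) spacetime_metric =
  "real \<times> 's \<Rightarrow> real \<times> ('s, 'e) tangent \<Rightarrow> real \<times> ('s, 'e) tangent \<Rightarrow> real"

definition future_timelike ::
  "('s, 'e::euclidean_space) spacetime_metric \<Rightarrow> real \<times> 's \<Rightarrow> real \<times> ('s, 'e) tangent \<Rightarrow> bool" where
  "future_timelike g z X \<longleftrightarrow> g z X X < 0 \<and> g z X partial_t < 0"

definition past_timelike ::
  "('s, 'e::euclidean_space) spacetime_metric \<Rightarrow> real \<times> 's \<Rightarrow> real \<times> ('s, 'e) tangent \<Rightarrow> bool" where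
  "past_timelike g z X \<longleftrightarrow> g z X X < 0 \<and> g z X partial_t > 0"

definition smooth_spacetime_curve_on ::
  "('s, 'e::euclidean_space) chart set \<Rightarrow> (real \<Rightarrow> real \<times> 's) \<Rightarrow> real set \<Rightarrow> bool" where
  "smooth_spacetime_curve_on A \<Gamma> K \<longleftrightarrow>
     smooth_on K (fst \<circ> \<Gamma>) \<and> smooth_curve_on A (snd \<circ> \<Gamma>) K"

definition spacetime_velocity ::
  "('s, 'e::euclidean_space) chart set \<Rightarrow> (real \<Rightarrow> real \<times> 's) \<Rightarrow> real set \<Rightarrow> real \<Rightarrow>
   real \<times> ('s, 'e) tangent" where
  "spacetime_velocity A \<Gamma> K s =
     (vector_derivative (fst \<circ> \<Gamma>) (at s within K), velocity A (snd \<circ> \<Gamma>) K s)"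

text \<open>Timelike curves are piecewise smooth (with finitely many breaks in each compact subinterval),
  and at a break both one-sided velocities lie in the same timelike cone. Only open parameter
  intervals occur: a curve that includes an end point is never inextensible.\<close>

definition timelike_curve ::
  "('s, 'e::euclidean_space) chart set \<Rightarrow> ('s, 'e) spacetime_metric \<Rightarrow>
   (real \<Rightarrow> real \<times> 's) \<Rightarrow> real set \<Rightarrow> bool" where
  "timelike_curve A g \<Gamma> I \<longleftrightarrow>
     open I \<and> is_interval I \<and> I \<noteq> {} \<and>
     (\<exists>C\<in>{future_timelike g, past_timelike g}. \<forall>a\<in>I. \<forall>b\<in>I. a < b \<longrightarrow>
        piecewise_on (\<lambda>K. smooth_spacetime_curve_on A \<Gamma> K \<and>
                          (\<forall>s\<in>K. C (\<Gamma> s) (spacetime_velocity A \<Gamma> K s))) a b)"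

definition right_endpoint :: "(real \<Rightarrow> 'm::topological_space) \<Rightarrow> real set \<Rightarrow> 'm \<Rightarrow> bool" where
  "right_endpoint \<Gamma> I q \<longleftrightarrow> (\<forall>W. open W \<and> q \<in> W \<longrightarrow> (\<exists>s\<in>I. \<forall>r\<in>I. s \<le> r \<longrightarrow> \<Gamma> r \<in> W))"

definition left_endpoint :: "(real \<Rightarrow> 'm::topological_space) \<Rightarrow> real set \<Rightarrow> 'm \<Rightarrow> bool" where
  "left_endpoint \<Gamma> I q \<longleftrightarrow> (\<forall>W. open W \<and> q \<in> W \<longrightarrow> (\<exists>s\<in>I. \<forall>r\<in>I. r \<le> s \<longrightarrow> \<Gamma> r \<in> W))"

text \<open>Inextensible means not continuously extensible, in either direction.\<close>

definition inextensible :: "(real \<Rightarrow> 'm::topological_space) \<Rightarrow> real set \<Rightarrow> bool" where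
  "inextensible \<Gamma> I \<longleftrightarrow> \<not> (\<exists>q. right_endpoint \<Gamma> I q) \<and> \<not> (\<exists>q. left_endpoint \<Gamma> I q)"

definition cauchy_hypersurface ::
  "('s::topological_space, 'e::euclidean_space) chart set \<Rightarrow> ('s, 'e) spacetime_metric \<Rightarrow>
   (real \<times> 's) set \<Rightarrow> bool" where
  "cauchy_hypersurface A g \<Sigma> \<longleftrightarrow>
     (\<forall>\<Gamma> I. timelike_curve A g \<Gamma> I \<and> inextensible \<Gamma> I \<longrightarrow> (\<exists>!s. s \<in> I \<and> \<Gamma> s \<in> \<Sigma>))"

definition slice :: "real \<Rightarrow> (real \<times> 's) set" where
  "slice t0 = {t0} \<times> UNIV"

end

theory Submission
  imports Defs
begin

text \<open>Write \<open>F\<close> for the Fermat metric. A vector \<open>(\<tau>, \<xi>)\<close> is future timelike iff \<open>\<tau> > F \<xi>\<close>, and past timelike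
  iff \<open>- \<tau> > F (- \<xi>)\<close>. Hence along a future timelike curve \<open>(T, \<gamma>)\<close> the distance \<open>d (\<gamma> s) (\<gamma> s')\<close> is at
  most \<open>T s' - T s\<close>: if \<open>T\<close> is bounded above, then \<open>\<gamma>\<close> runs through forward Cauchy sequences, so
  forward completeness yields a right endpoint; backward completeness excludes a lower bound of \<open>T\<close>
  in the same way, and \<open>T\<close> takes every value exactly once. Conversely, a forward Cauchy
  sequence without limit has a subsequence whose consecutive points are joined by curves of
  summable length. Over their concatenation one can choose \<open>T\<close> bounded with \<open>T' > F \<gamma>'\<close>; preceded by
  a vertical half-line, this is an inextensible timelike curve below the slice. The backward
  statements are the forward ones for the reversed metric \<open>\<xi> \<mapsto> F (- \<xi>)\<close>, which is the Fermat metric of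
  \<open>- \<omega>\<close> and corresponds to the time reflection \<open>t \<mapsto> - t\<close>.\<close>

subsection \<open>Smooth functions of one variable\<close>

text \<open>Two features shape the proof. First, \<open>d\<close> is not symmetric. Every comparison
  with the manifold topology is therefore made for distances towards the limit point,
  \<open>d (x n) q\<close>; this direction fits both forward Cauchy sequences and curves running
  into a future endpoint. Second, timelikeness is a strict inequality, while T has to be smooth on
  each piece. The integral of the speed gives only equality and need not be smooth, since F is not
  smooth at zero vectors. So T is the antiderivative of a polynomial slightly above the speed. This
  costs an arbitrarily small excess over the length, which is absorbed because the k-th pair of
  consecutive points has distance strictly below (1/2)^k. These bounds add up to 2, so a curve that
  starts its ascent at time t0 - 2 stays below t0. At breaks T only has to be continuous, as
  timelike curves may have corners.\<close>

lemma higher_differentiable_on_cong: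
  assumes "open U" "\<And>x. x \<in> U \<Longrightarrow> f x = g x" "higher_differentiable_on n U f"
  shows "higher_differentiable_on n U g"
  using assms(2,3)
proof (induction n arbitrary: f g)
  case 0
  then show ?case
    by (metis continuous_on_cong higher_differentiable_on.simps(1))
next
  case (Suc n)
  have diff: "f differentiable at x" if "x \<in> U" for x
    using Suc.prems that by auto
  have eq: "frechet_derivative f (at x) = frechet_derivative g (at x)" if "x \<in> U" for x
    using frechet_derivative_transform_within_open[OF diff[OF that] assms(1) that] Suc.prems by auto
  have "g differentiable at x" if "x \<in> U" for x
    using diff[OF that] has_derivative_transform_within_open[OF _ assms(1) that] Suc.prems(1)
    unfolding differentiable_def by blast
  moreover have "higher_differentiable_on n U (\<lambda>x. frechet_derivative g (at x) v)" for v
    by (rule Suc.IH[of "\<lambda>x. frechet_derivative f (at x) v"]) (use eq Suc.prems in auto)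
  ultimately show ?case by simp
qed

lemma higher_differentiable_on_subset:
  "higher_differentiable_on n U f \<Longrightarrow> V \<subseteq> U \<Longrightarrow> higher_differentiable_on n V f"
  by (induction n arbitrary: f) (auto intro: continuous_on_subset)

lemma smooth_on_imp_higher_differentiable_on:
  assumes "smooth_on K f" "open K"
  shows "higher_differentiable_on n K f"
proof -
  obtain U g where *: "open U" "K \<subseteq> U" "\<forall>n. higher_differentiable_on n U g" "\<forall>x\<in>K. g x = f x"
    using assms(1) unfolding smooth_on_def by blast
  then show ?thesis
    using higher_differentiable_on_cong[OF assms(2), of g f n] higher_differentiable_on_subset by blast
qed

lemma smooth_on_imp_differentiable:
  "smooth_on K f \<Longrightarrow> open K \<Longrightarrow> x \<in> K \<Longrightarrow> f differentiable at x"
  using smooth_on_imp_higher_differentiable_on[of K f "Suc 0"] by auto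

lemma smooth_on_imp_continuous_on: "smooth_on K f \<Longrightarrow> continuous_on K f"
  unfolding smooth_on_def
  by (metis continuous_on_cong continuous_on_subset higher_differentiable_on.simps(1))

lemma smooth_on_subset: "smooth_on K f \<Longrightarrow> L \<subseteq> K \<Longrightarrow> smooth_on L f"
  unfolding smooth_on_def by (meson subset_eq)

lemma smooth_on_cong: "(\<And>x. x \<in> K \<Longrightarrow> f x = g x) \<Longrightarrow> smooth_on K f \<longleftrightarrow> smooth_on K g"
  unfolding smooth_on_def by simp

lemma smooth_on_UNIV_I: "(\<And>n. higher_differentiable_on n UNIV f) \<Longrightarrow> smooth_on K f"
  unfolding smooth_on_def by blast

text \<open>A smooth extension to an open neighbourhood has a continuous derivative, whose
  restriction to K is a derivative of f within K, one-sided at an end point of an interval. Only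
  existence is asserted, because derivatives within an arbitrary K need not be unique.\<close>

lemma smooth_on_vector_derivative:
  fixes f :: "real \<Rightarrow> 'b::real_normed_vector"
  assumes "smooth_on K f"
  obtains f' where "continuous_on K f'" "\<And>s. s \<in> K \<Longrightarrow> (f has_vector_derivative f' s) (at s within K)"
proof -
  obtain U g where *: "open U" "K \<subseteq> U" "\<forall>n. higher_differentiable_on n U g" "\<forall>x\<in>K. g x = f x"
    using assms unfolding smooth_on_def by blast
  have hd: "\<forall>x\<in>U. g differentiable at x" "continuous_on U (\<lambda>x. frechet_derivative g (at x) 1)"
    using *(3)[rule_format, of "Suc 0"] by auto
  define f' where "f' = (\<lambda>x. frechet_derivative g (at x) 1)"
  have "continuous_on K f'"
    unfolding f'_def using hd(2) *(2) continuous_on_subset by blast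
  moreover have "(f has_vector_derivative f' s) (at s within K)" if "s \<in> K" for s
  proof -
    have "g differentiable at s" using hd *(2) that by auto
    then have d: "(g has_vector_derivative vector_derivative g (at s)) (at s)"
      by (simp add: vector_derivative_works)
    then have "frechet_derivative g (at s) = (\<lambda>h. h *\<^sub>R vector_derivative g (at s))"
      using frechet_derivative_at unfolding has_vector_derivative_def by metis
    then have "f' s = vector_derivative g (at s)" by (simp add: f'_def)
    then have "(g has_vector_derivative f' s) (at s within K)"
      using d has_vector_derivative_at_within by metis
    then show ?thesis
      by (rule has_vector_derivative_transform[rotated 2]) (use that *(4) in auto)
  qed
  ultimately show ?thesis using that by blast
qed

lemma higher_differentiable_on_compose_affine:
  fixes f :: "real \<Rightarrow> 'b::real_normed_vector"
  assumes "open U" "higher_differentiable_on n U f"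
  shows "higher_differentiable_on n ((\<lambda>s. k * s + l) -` U) (\<lambda>s. f (k * s + l))"
  using assms(2)
proof (induction n arbitrary: f)
  case 0
  have "continuous_on ((\<lambda>s. k * s + l) -` U) (f \<circ> (\<lambda>s. k * s + l))"
    by (rule continuous_on_compose) (use 0 in \<open>auto intro!: continuous_intros intro: continuous_on_subset\<close>)
  then show ?case by (simp add: o_def)
next
  case (Suc n)
  let ?h = "\<lambda>s. k * s + l"
  have op: "open (?h -` U)"
    by (intro open_vimage assms(1) continuous_intros)
  have der: "((\<lambda>s. f (?h s)) has_derivative (\<lambda>t. frechet_derivative f (at (?h x)) (k * t))) (at x)"
    if "x \<in> ?h -` U" for x
  proof -
    have "(f has_derivative frechet_derivative f (at (?h x))) (at (?h x))"
      using Suc.prems that by (auto simp: frechet_derivative_works)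
    moreover have "(?h has_derivative (\<lambda>t. k * t)) (at x)"
      by (auto intro!: derivative_eq_intros)
    ultimately have "(f \<circ> ?h has_derivative frechet_derivative f (at (?h x)) \<circ> (\<lambda>t. k * t)) (at x)"
      by (metis diff_chain_at)
    then show ?thesis by (simp add: o_def)
  qed
  have "(\<lambda>s. f (?h s)) differentiable at x" if "x \<in> ?h -` U" for x
    using der[OF that] unfolding differentiable_def by blast
  \<comment> \<open>The derivative of the composite in direction v is the derivative of f in the
    fixed direction k * v, composed with the same affine map, so the induction hypothesis
    applies.\<close>
  moreover have "higher_differentiable_on n (?h -` U) (\<lambda>x. frechet_derivative (\<lambda>s. f (?h s)) (at x) v)" for v
  proof (rule higher_differentiable_on_cong[OF op])
    show "higher_differentiable_on n (?h -` U) (\<lambda>s. frechet_derivative f (at (?h s)) (k * v))"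
      using Suc.IH[of "\<lambda>y. frechet_derivative f (at y) (k * v)"] Suc.prems by auto
    show "frechet_derivative f (at (?h x)) (k * v) = frechet_derivative (\<lambda>s. f (?h s)) (at x) v"
      if "x \<in> ?h -` U" for x
      using frechet_derivative_at[OF der[OF that]] by metis
  qed
  ultimately show ?case by simp
qed

lemma smooth_on_compose_affine:
  fixes f :: "real \<Rightarrow> 'b::real_normed_vector"
  assumes "smooth_on K f"
  shows "smooth_on ((\<lambda>s. k * s + l) -` K) (\<lambda>s. f (k * s + l))"
proof -
  obtain U g where *: "open U" "K \<subseteq> U" "\<forall>n. higher_differentiable_on n U g" "\<forall>x\<in>K. g x = f x"
    using assms unfolding smooth_on_def by blast
  have "open ((\<lambda>s. k * s + l) -` U)"
    by (intro open_vimage * continuous_intros)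
  then show ?thesis
    unfolding smooth_on_def
    using * higher_differentiable_on_compose_affine[OF *(1), of _ g k l]
    by (intro exI[of _ "(\<lambda>s. k * s + l) -` U"] exI[of _ "\<lambda>s. g (k * s + l)"]) auto
qed

lemma higher_differentiable_on_const: "higher_differentiable_on n U (\<lambda>x. a)"
  by (induction n arbitrary: a) auto

lemma smooth_on_line: "smooth_on K (\<lambda>s::real. x + s *\<^sub>R w)"
proof (rule smooth_on_UNIV_I)
  fix n
  have d: "((\<lambda>s::real. x + s *\<^sub>R w) has_derivative (\<lambda>h. h *\<^sub>R w)) (at s)" for s
    by (auto intro!: derivative_eq_intros)
  then have "frechet_derivative (\<lambda>s::real. x + s *\<^sub>R w) (at s) = (\<lambda>h. h *\<^sub>R w)" for s
    using frechet_derivative_at by metis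
  then show "higher_differentiable_on n UNIV (\<lambda>s::real. x + s *\<^sub>R w)"
    using d by (cases n) (auto intro!: continuous_intros higher_differentiable_on_const simp: differentiable_def)
qed

section \<open>Polynomials just above a continuous function\<close>

lemma higher_differentiable_on_polynomial:
  "real_polynomial_function p \<Longrightarrow> higher_differentiable_on n U (p :: real \<Rightarrow> real)"
proof (induction n arbitrary: p)
  case 0
  then show ?case
    by (simp add: continuous_real_polymonial_function continuous_at_imp_continuous_on)
next
  case (Suc n)
  obtain p' where p': "real_polynomial_function p'" "\<And>x. (p has_real_derivative p' x) (at x)"
    using has_real_derivative_polynomial_function[OF Suc.prems] by metis
  then have d: "(p has_derivative (\<lambda>h. p' x * h)) (at x)" for x
    by (simp add: has_field_derivative_def)
  then have "frechet_derivative p (at x) = (\<lambda>h. p' x * h)" for x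
    using frechet_derivative_at by metis
  moreover have "real_polynomial_function (\<lambda>x. p' x * v)" for v
    using p'(1) by (intro real_polynomial_function.intros(2,4))
  ultimately show ?case
    using d Suc.IH by (auto simp: differentiable_def)
qed

lemma real_polynomial_antiderivative:
  assumes "real_polynomial_function (p :: real \<Rightarrow> real)"
  obtains T where "real_polynomial_function T" "\<And>x. (T has_real_derivative p x) (at x)"
proof -
  obtain a n where p: "p = (\<lambda>x. \<Sum>i\<le>n. a i * x ^ i)"
    using assms real_polynomial_function_iff_sum by auto
  define T where "T = (\<lambda>x. \<Sum>i\<le>n. (a i / real (Suc i)) * x ^ Suc i)"
  have "real_polynomial_function T"
    unfolding T_def
    by (intro real_polynomial_function_sum real_polynomial_function.intros real_polynomial_function_power) auto
  moreover have "(T has_real_derivative p x) (at x)" for x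
  proof -
    have "((\<lambda>x. (a i / real (Suc i)) * x ^ Suc i) has_real_derivative a i * x ^ i) (at x)" for i
      by (rule derivative_eq_intros refl | simp)+
    then show ?thesis unfolding T_def p by (intro DERIV_sum)
  qed
  ultimately show ?thesis using that by blast
qed

text \<open>With the speed of a curve as f, T becomes the time function over that curve. The
  approximating polynomial stays strictly above f, and its antiderivative is again a polynomial,
  hence smooth on every set.\<close>

lemma continuous_strict_upper_smooth:
  assumes "continuous_on {u..v} f" "u < v" "\<epsilon> > 0"
  obtains T where "\<And>K. smooth_on K T" "T u = 0" "T v < integral {u..v} f + \<epsilon>"
    "\<And>s. s \<in> {u..v} \<Longrightarrow> \<exists>y. (T has_real_derivative y) (at s) \<and> f s < y"
proof -
  \<comment> \<open>The polynomial is to lie between f + \<delta> and f + 3 \<delta>; the excess of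
    its integral is then at most 3 \<delta> (v - u) = 3/4 \<epsilon>.\<close>
  define \<delta> where "\<delta> = \<epsilon> / (4 * (v - u))"
  have \<delta>: "\<delta> > 0" using assms by (simp add: \<delta>_def)
  have "continuous_on {u..v} (\<lambda>x. f x + 2 * \<delta>)"
    using assms(1) by (intro continuous_on_add continuous_on_const)
  then obtain p where p: "real_polynomial_function p" "\<And>x. x \<in> {u..v} \<Longrightarrow> \<bar>(f x + 2 * \<delta>) - p x\<bar> < \<delta>"
    using Stone_Weierstrass_real_polynomial_function[OF compact_Icc _ \<delta>] by metis
  obtain T where T: "real_polynomial_function T" "\<And>x. (T has_real_derivative p x) (at x)"
    using real_polynomial_antiderivative[OF p(1)] by blast
  define T1 where "T1 = (\<lambda>x. T x + (- T u))"
  have T1: "real_polynomial_function T1"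
    unfolding T1_def by (intro real_polynomial_function.intros T)
  have T1d: "(T1 has_real_derivative p x) (at x)" for x
    unfolding T1_def using T(2) by (auto intro!: derivative_eq_intros)
  have I: "(p has_integral (T1 v - T1 u)) {u..v}"
    using assms(2) T1d
    by (intro fundamental_theorem_of_calculus)
       (auto simp: has_real_derivative_iff_has_vector_derivative[symmetric] intro: DERIV_subset)
  have fi: "f integrable_on {u..v}" using assms(1) by (rule integrable_continuous_real)
  have "((\<lambda>x. f x + 3 * \<delta>) has_integral (integral {u..v} f + 3 * \<delta> * (v - u))) {u..v}"
    using has_integral_add[OF integrable_integral[OF fi] has_integral_const_real[of "3 * \<delta>" u v]] assms(2)
    by (simp add: mult.commute)
  then have "T1 v - T1 u \<le> integral {u..v} f + 3 * \<delta> * (v - u)"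
    by (rule has_integral_le[OF I]) (use p(2) \<delta> in fastforce)
  also have "\<dots> < integral {u..v} f + \<epsilon>"
    using assms by (simp add: \<delta>_def field_simps)
  finally have "T1 v < integral {u..v} f + \<epsilon>" by (simp add: T1_def)
  moreover have "smooth_on K T1" for K
    using T1 by (intro smooth_on_UNIV_I higher_differentiable_on_polynomial)
  moreover have "f s < p s" if "s \<in> {u..v}" for s
    using p(2)[OF that] \<delta> by linarith
  ultimately show ?thesis
    using that[of T1] T1d by (metis T1_def add.right_inverse)
qed

subsection \<open>Partitions and charts\<close>

lemma piecewise_on_single: "Q {a..b} \<Longrightarrow> a < b \<Longrightarrow> piecewise_on Q a b"
  unfolding piecewise_on_def by (intro exI[of _ "{a, b}"]) auto

lemma piecewise_on_join:
  assumes "piecewise_on Q a b" "piecewise_on Q b c"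
  shows "piecewise_on Q a c"
proof -
  obtain P where P: "finite P" "a \<in> P" "b \<in> P" "P \<subseteq> {a..b}"
    "\<forall>u\<in>P. \<forall>v\<in>P. u < v \<and> P \<inter> {u<..<v} = {} \<longrightarrow> Q {u..v}"
    using assms(1) unfolding piecewise_on_def by blast
  obtain P' where P': "finite P'" "b \<in> P'" "c \<in> P'" "P' \<subseteq> {b..c}"
    "\<forall>u\<in>P'. \<forall>v\<in>P'. u < v \<and> P' \<inter> {u<..<v} = {} \<longrightarrow> Q {u..v}"
    using assms(2) unfolding piecewise_on_def by blast
  have "Q {u..v}" if "u \<in> P \<union> P'" "v \<in> P \<union> P'" "u < v" "(P \<union> P') \<inter> {u<..<v} = {}" for u v
  proof -
    \<comment> \<open>No gap of the joint partition contains b, as b is itself a partition point; so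
      each gap lies in one of the two intervals.\<close>
    have "\<not> (u < b \<and> b < v)" using that(4) P(3) by auto
    then consider "v \<le> b" | "b \<le> u" by linarith
    then show ?thesis
    proof cases
      case 1
      then have "u \<in> P" "v \<in> P" using that P(3,4) P'(2,4) by force+
      then show ?thesis using that P(5) by (simp add: Int_Un_distrib2)
    next
      case 2
      then have "u \<in> P'" "v \<in> P'" using that P(3,4) P'(2,4) by force+
      then show ?thesis using that P'(5) by (simp add: Int_Un_distrib2)
    qed
  qed
  moreover have "P \<union> P' \<subseteq> {a..c}" using P P' by fastforce
  ultimately show ?thesis
    unfolding piecewise_on_def using P P' by (intro exI[of _ "P \<union> P'"]) auto
qed

text \<open>The workhorse for piecewise curves: R is proved for single pieces and shown to be stable
  under joining at a break. The case \<open>join\<close> supplies R alone, so whatever else that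
  step needs, such as piecewise smoothness, is put into R as a conjunct. The proof inducts on the
  number of partition points and splits off the last piece.\<close>

lemma piecewise_on_induct [consumes 2, case_names piece join]:
  assumes "piecewise_on Q a b" "a < b"
    and piece: "\<And>u v. u < v \<Longrightarrow> Q {u..v} \<Longrightarrow> R u v"
    and join: "\<And>u v w. u < v \<Longrightarrow> v < w \<Longrightarrow> R u v \<Longrightarrow> R v w \<Longrightarrow> R u w"
  shows "R a b"
proof -
  obtain P where "finite P" "a \<in> P" "b \<in> P" "P \<subseteq> {a..b}"
    "\<forall>u\<in>P. \<forall>v\<in>P. u < v \<and> P \<inter> {u<..<v} = {} \<longrightarrow> Q {u..v}"
    using assms(1) unfolding piecewise_on_def by blast
  then show ?thesis
    using \<open>a < b\<close>
  proof (induction "card P" arbitrary: P b)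
    case 0
    then show ?case by simp
  next
    case (Suc n)
    define P' where "P' = P - {b}"
    define m where "m = Max P'"
    have fin: "finite P'" "P' \<noteq> {}" using Suc.prems by (auto simp: P'_def)
    then have m: "m \<in> P'" "\<And>x. x \<in> P' \<Longrightarrow> x \<le> m" by (auto simp: m_def)
    then have mb: "m < b" "m \<in> P" "a \<le> m" using Suc.prems(4) by (auto simp: P'_def subset_iff less_le)
    have "P \<inter> {m<..<b} = {}" using m(2) unfolding P'_def by fastforce
    then have R: "R m b" using piece mb Suc.prems by blast
    show ?case
    proof (cases "a = m")
      case True
      then show ?thesis using R by simp
    next
      case False
      have "card P' = n" using Suc.hyps(2) Suc.prems by (simp add: P'_def)
      moreover have "a \<in> P'" using Suc.prems by (simp add: P'_def)
      moreover have "P' \<subseteq> {a..m}" using m(2) Suc.prems(4) unfolding P'_def by fastforce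
      moreover have "\<forall>u\<in>P'. \<forall>v\<in>P'. u < v \<and> P' \<inter> {u<..<v} = {} \<longrightarrow> Q {u..v}"
      proof (intro ballI impI)
        fix u v assume uv: "u \<in> P'" "v \<in> P'" "u < v \<and> P' \<inter> {u<..<v} = {}"
        have "v \<le> m" using m(2) uv(2) .
        \<comment> \<open>A gap of P' is also a gap of P: the only removed point, b, lies to the
          right of m.\<close>
        have "x \<notin> {u<..<v}" if "x \<in> P" for x
        proof (cases "x = b")
          case True
          then show ?thesis using \<open>v \<le> m\<close> mb(1) by simp
        next
          case False
          then show ?thesis using uv(3) that unfolding P'_def by blast
        qed
        then have "P \<inter> {u<..<v} = {}" by blast
        moreover have "u \<in> P" "v \<in> P" using uv unfolding P'_def by blast+
        ultimately show "Q {u..v}" using Suc.prems(5) uv(3) by blast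
      qed
      ultimately have "R a m"
        using Suc.hyps(1)[of P' m] fin m(1) mb(3) False by simp
      then show ?thesis using join R mb False by (meson less_le)
    qed
  qed
qed

lemma piecewise_on_mono:
  assumes "piecewise_on Q a b"
    and "\<And>u v. a \<le> u \<Longrightarrow> u < v \<Longrightarrow> v \<le> b \<Longrightarrow> Q {u..v} \<Longrightarrow> Q' {u..v}"
  shows "piecewise_on Q' a b"
proof -
  obtain P where P: "finite P" "a \<in> P" "b \<in> P" "P \<subseteq> {a..b}"
    "\<forall>u\<in>P. \<forall>v\<in>P. u < v \<and> P \<inter> {u<..<v} = {} \<longrightarrow> Q {u..v}"
    using assms(1) unfolding piecewise_on_def by blast
  then have "\<forall>u\<in>P. \<forall>v\<in>P. u < v \<and> P \<inter> {u<..<v} = {} \<longrightarrow> Q' {u..v}"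
    using assms(2) by (meson atLeastAtMost_iff subsetD)
  then show ?thesis unfolding piecewise_on_def using P(1-4) by blast
qed

lemma piecewise_on_restrict:
  assumes "piecewise_on Q a b" "a < b" "a \<le> a'" "a' < b'" "b' \<le> b"
    and Q: "\<And>u v u' v'. Q {u..v} \<Longrightarrow> u \<le> u' \<Longrightarrow> u' < v' \<Longrightarrow> v' \<le> v \<Longrightarrow> Q {u'..v'}"
  shows "piecewise_on Q a' b'"
proof -
  have "\<forall>a' b'. a \<le> a' \<longrightarrow> a' < b' \<longrightarrow> b' \<le> b \<longrightarrow> piecewise_on Q a' b'"
    using assms(1,2)
  proof (induction rule: piecewise_on_induct)
    case (piece u v)
    then show ?case using Q[OF piece(2)] piecewise_on_single by blast
  next
    case (join u v w)
    show ?case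
    proof (intro allI impI)
      fix a' b' assume *: "u \<le> a'" "a' < b'" "b' \<le> w"
      show "piecewise_on Q a' b'"
      proof (cases "b' \<le> v \<or> v \<le> a'")
        case True
        then show ?thesis using join * by blast
      next
        case False
        then show ?thesis
          using join * piecewise_on_join[of Q a' v b'] by simp
      qed
    qed
  qed
  then show ?thesis using assms by blast
qed

text \<open>Prepares integration: a parameter outside the finite set is interior to a smooth piece,
  so the curve has a two-sided velocity there.\<close>

lemma piecewise_on_finite_exceptions:
  assumes "piecewise_on Q a b" "a < b"
  obtains P where "finite P" "P \<subseteq> {a..b}"
    "\<And>s. s \<in> {a..b} - P \<Longrightarrow> \<exists>u v. a \<le> u \<and> u < s \<and> s < v \<and> v \<le> b \<and> Q {u..v}"
proof -
  have "\<exists>P. finite P \<and> P \<subseteq> {a..b} \<and>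
    (\<forall>s\<in>{a..b} - P. \<exists>u v. a \<le> u \<and> u < s \<and> s < v \<and> v \<le> b \<and> Q {u..v})"
    using assms
  proof (induction rule: piecewise_on_induct)
    case (piece u v)
    have "\<exists>u' v'. u \<le> u' \<and> u' < s \<and> s < v' \<and> v' \<le> v \<and> Q {u'..v'}" if "s \<in> {u..v} - {u, v}" for s
      using that piece(2) by (intro exI[of _ u] exI[of _ v]) auto
    moreover have "{u, v} \<subseteq> {u..v}" using piece(1) by simp
    ultimately show ?case by (intro exI[of _ "{u, v}"] conjI ballI) simp_all
  next
    case (join u v w)
    then obtain P P' where "finite P" "P \<subseteq> {u..v}"
      "\<forall>s\<in>{u..v} - P. \<exists>u' v'. u \<le> u' \<and> u' < s \<and> s < v' \<and> v' \<le> v \<and> Q {u'..v'}"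
      "finite P'" "P' \<subseteq> {v..w}"
      "\<forall>s\<in>{v..w} - P'. \<exists>u' v'. v \<le> u' \<and> u' < s \<and> s < v' \<and> v' \<le> w \<and> Q {u'..v'}"
      by blast
    note PP = this
    have "\<exists>u' v'. u \<le> u' \<and> u' < s \<and> s < v' \<and> v' \<le> w \<and> Q {u'..v'}" if s: "s \<in> {u..w} - (P \<union> P')" for s
    proof (cases "s \<le> v")
      case True
      then have "s \<in> {u..v} - P" using s by simp
      then obtain u' v' where "u \<le> u' \<and> u' < s \<and> s < v' \<and> v' \<le> v \<and> Q {u'..v'}" using PP(3) by blast
      then show ?thesis using join(2) by (intro exI[of _ u'] exI[of _ v']) simp
    next
      case False
      then have "s \<in> {v..w} - P'" using s by simp
      then obtain u' v' where "v \<le> u' \<and> u' < s \<and> s < v' \<and> v' \<le> w \<and> Q {u'..v'}" using PP(6) by blast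
      then show ?thesis using join(1) by (intro exI[of _ u'] exI[of _ v']) simp
    qed
    moreover have "P \<union> P' \<subseteq> {u..w}" using PP(2,5) join(1,2) by fastforce
    moreover have "finite (P \<union> P')" using PP(1,4) by simp
    ultimately show ?case by blast
  qed
  then show ?thesis using that by blast
qed

section \<open>Coordinates, tangent vectors and velocities\<close>

context smooth_manifold
begin

lemma chart_homeomorphism:
  "c \<in> A \<Longrightarrow> homeomorphism (fst c) (snd c ` fst c) (snd c) (chart_inv c)"
  using charts unfolding is_chart_def by blast

lemma open_chart_domain: "c \<in> A \<Longrightarrow> open (fst c)"
  and open_chart_range: "c \<in> A \<Longrightarrow> open (snd c ` fst c)"
  using charts unfolding is_chart_def by blast+

lemma chart_inv_chart [simp]: "c \<in> A \<Longrightarrow> p \<in> fst c \<Longrightarrow> chart_inv c (snd c p) = p"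
  using chart_homeomorphism unfolding homeomorphism_def by blast

lemma chart_chart_inv [simp]: "c \<in> A \<Longrightarrow> x \<in> snd c ` fst c \<Longrightarrow> snd c (chart_inv c x) = x"
  using chart_homeomorphism unfolding homeomorphism_def by blast

lemma chart_inv_in_domain: "c \<in> A \<Longrightarrow> x \<in> snd c ` fst c \<Longrightarrow> chart_inv c x \<in> fst c"
  by auto

lemma continuous_on_chart: "c \<in> A \<Longrightarrow> continuous_on (fst c) (snd c)"
  and continuous_on_chart_inv: "c \<in> A \<Longrightarrow> continuous_on (snd c ` fst c) (chart_inv c)"
  using chart_homeomorphism unfolding homeomorphism_def by blast+

lemma open_chart_image:
  assumes "c \<in> A" "open U"
  shows "open (snd c ` (fst c \<inter> U))"
proof -
  have "snd c ` (fst c \<inter> U) = snd c ` fst c \<inter> chart_inv c -` U"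
    using assms(1) by auto
  then show ?thesis
    using continuous_open_preimage[OF continuous_on_chart_inv open_chart_range assms(2)] assms(1) by simp
qed

lemma chart_around: obtains c where "c \<in> A" "p \<in> fst c"
  using covering by blast

lemma transition_has_derivative:
  assumes "c \<in> A" "c' \<in> A" "p \<in> fst c" "p \<in> fst c'"
  shows "((snd c' \<circ> chart_inv c) has_derivative change_of_coordinates c c' p) (at (snd c p))"
proof -
  have "open (snd c ` (fst c \<inter> fst c'))"
    using assms open_chart_image open_chart_domain by blast
  then have "(snd c' \<circ> chart_inv c) differentiable at (snd c p)"
    using smooth_on_imp_differentiable[OF compatible[OF assms(1,2)]] assms by blast
  then show ?thesis
    unfolding change_of_coordinates_def by (simp add: frechet_derivative_works)
qed

lemma change_of_coordinates_compose:
  assumes "c \<in> A" "c' \<in> A" "c'' \<in> A" "p \<in> fst c" "p \<in> fst c'" "p \<in> fst c''"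
  shows "change_of_coordinates c' c'' p (change_of_coordinates c c' p v) = change_of_coordinates c c'' p v"
proof -
  have "(snd c'' \<circ> chart_inv c' has_derivative change_of_coordinates c' c'' p)
      (at ((snd c' \<circ> chart_inv c) (snd c p)))"
    using transition_has_derivative[of c' c'' p] assms by simp
  then have "((snd c'' \<circ> chart_inv c') \<circ> (snd c' \<circ> chart_inv c) has_derivative
      change_of_coordinates c' c'' p \<circ> change_of_coordinates c c' p) (at (snd c p))"
    using diff_chain_at[OF transition_has_derivative] assms by blast
  then have "(snd c'' \<circ> chart_inv c has_derivative
      change_of_coordinates c' c'' p \<circ> change_of_coordinates c c' p) (at (snd c p))"
    by (rule has_derivative_transform_within_open[where s = "snd c ` (fst c \<inter> fst c')"])
       (use assms open_chart_image open_chart_domain in auto)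
  then show ?thesis
    using has_derivative_unique[OF transition_has_derivative[of c c'' p]] assms
    by (metis comp_apply)
qed

lemma change_of_coordinates_self:
  assumes "c \<in> A" "p \<in> fst c"
  shows "change_of_coordinates c c p v = v"
proof -
  have "(id has_derivative id) (at (snd c p))" by (simp add: id_def)
  then have "(snd c \<circ> chart_inv c has_derivative id) (at (snd c p))"
    by (rule has_derivative_transform_within_open[where s = "snd c ` fst c"])
       (use assms open_chart_range in auto)
  then show ?thesis
    using has_derivative_unique[OF transition_has_derivative[of c c p]] assms by (metis id_apply)
qed

lemma linear_change_of_coordinates:
  "c \<in> A \<Longrightarrow> c' \<in> A \<Longrightarrow> p \<in> fst c \<Longrightarrow> p \<in> fst c' \<Longrightarrow> linear (change_of_coordinates c c' p)"
  using transition_has_derivative has_derivative_linear by blast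

lemma coord_vector_in_tangent_space:
  assumes "c \<in> A" "p \<in> fst c"
  shows "coord_vector A p c v \<in> tangent_space A p"
  unfolding coord_vector_def tangent_space_def
  using assms by (auto simp: change_of_coordinates_compose)

lemma coord_vector_apply: "c \<in> A \<Longrightarrow> p \<in> fst c \<Longrightarrow> coord_vector A p c v c = v"
  by (simp add: coord_vector_def change_of_coordinates_self)

text \<open>This reduces tangent vectors to coordinate vectors in a single chart, so that F can be
  treated as a function of a point and a vector in Euclidean space.\<close>

lemma tangent_eq_coord_vector:
  assumes "c \<in> A" "p \<in> fst c" "\<xi> \<in> tangent_space A p"
  shows "\<xi> = coord_vector A p c (\<xi> c)"
proof
  fix c'
  show "\<xi> c' = coord_vector A p c (\<xi> c) c'"
  proof (cases "c' \<in> A \<and> p \<in> fst c'")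
    case True
    then have "\<xi> c' = change_of_coordinates c c' p (\<xi> c)"
      using assms unfolding tangent_space_def by blast
    then show ?thesis using True by (simp only: coord_vector_def) simp
  next
    case False
    then have "\<xi> c' = 0" using assms(3) unfolding tangent_space_def by blast
    then show ?thesis using False by (simp only: coord_vector_def) simp
  qed
qed

lemma coord_vector_add:
  assumes "c \<in> A" "p \<in> fst c"
  shows "coord_vector A p c (v + w) = (\<lambda>c'. coord_vector A p c v c' + coord_vector A p c w c')"
  by (rule ext) (use assms in \<open>simp add: coord_vector_def linear_add[OF linear_change_of_coordinates]\<close>)

lemma coord_vector_scaleR:
  assumes "c \<in> A" "p \<in> fst c"
  shows "coord_vector A p c (r *\<^sub>R v) = (\<lambda>c'. r *\<^sub>R coord_vector A p c v c')"
  by (rule ext) (use assms in \<open>simp add: coord_vector_def linear_scale[OF linear_change_of_coordinates]\<close>)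

lemma tangent_space_scaleR:
  assumes "\<xi> \<in> tangent_space A p"
  shows "(\<lambda>c. r *\<^sub>R \<xi> c) \<in> tangent_space A p"
proof -
  obtain c where c: "c \<in> A" "p \<in> fst c" using chart_around by blast
  have "(\<lambda>c'. r *\<^sub>R \<xi> c') = (\<lambda>c'. r *\<^sub>R coord_vector A p c (\<xi> c) c')"
    by (rule arg_cong[OF tangent_eq_coord_vector[OF c assms]])
  also have "\<dots> = coord_vector A p c (r *\<^sub>R \<xi> c)"
    by (rule coord_vector_scaleR[OF c, symmetric])
  finally show ?thesis using coord_vector_in_tangent_space[OF c] by simp
qed

lemma zero_in_tangent_space: "(\<lambda>c. 0) \<in> tangent_space A p"
proof -
  obtain c where c: "c \<in> A" "p \<in> fst c" using chart_around by blast
  have "(\<lambda>c'. 0 *\<^sub>R coord_vector A p c 0 c') \<in> tangent_space A p"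
    by (rule tangent_space_scaleR[OF coord_vector_in_tangent_space[OF c]])
  then show ?thesis by simp
qed

lemma smooth_curve_on_subset:
  assumes "smooth_curve_on A \<gamma> K" "L \<subseteq> K"
  shows "smooth_curve_on A \<gamma> L"
  unfolding smooth_curve_on_def
proof
  fix s assume "s \<in> L"
  then obtain c J where c: "c \<in> A" "open J" "s \<in> J" "\<gamma> ` (J \<inter> K) \<subseteq> fst c" "smooth_on (J \<inter> K) (snd c \<circ> \<gamma>)"
    using assms unfolding smooth_curve_on_def by blast
  have "J \<inter> L \<subseteq> J \<inter> K" using assms(2) by blast
  then show "\<exists>c\<in>A. \<exists>J. open J \<and> s \<in> J \<and> \<gamma> ` (J \<inter> L) \<subseteq> fst c \<and> smooth_on (J \<inter> L) (snd c \<circ> \<gamma>)"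
    using c smooth_on_subset[OF c(5)] by blast
qed

lemma smooth_curve_on_cong:
  assumes "\<And>s. s \<in> K \<Longrightarrow> \<gamma> s = \<gamma>' s"
  shows "smooth_curve_on A \<gamma> K \<longleftrightarrow> smooth_curve_on A \<gamma>' K"
proof -
  have "smooth_on (J \<inter> K) (snd c \<circ> \<gamma>) = smooth_on (J \<inter> K) (snd c \<circ> \<gamma>')"
    and "\<gamma> ` (J \<inter> K) = \<gamma>' ` (J \<inter> K)" for J and c :: "('s, 'e) chart"
    using assms by (auto intro!: image_cong smooth_on_cong[of "J \<inter> K" "snd c \<circ> \<gamma>" "snd c \<circ> \<gamma>'", THEN iffD1]
        smooth_on_cong[of "J \<inter> K" "snd c \<circ> \<gamma>'" "snd c \<circ> \<gamma>", THEN iffD1])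
  then show ?thesis unfolding smooth_curve_on_def by simp
qed

text \<open>Since J is open, differentiation within \<open>J \<inter> K\<close> and within K agree,
  so the chart in which the curve is known to be smooth yields derivatives within K.\<close>

lemma smooth_curve_on_local:
  assumes "smooth_curve_on A \<gamma> K" "s \<in> K"
  obtains c J f' where "c \<in> A" "open J" "s \<in> J" "\<gamma> ` (J \<inter> K) \<subseteq> fst c" "continuous_on (J \<inter> K) (snd c \<circ> \<gamma>)"
    "continuous_on (J \<inter> K) f'"
    "\<And>r. r \<in> J \<inter> K \<Longrightarrow> (snd c \<circ> \<gamma> has_vector_derivative f' r) (at r within K)"
proof -
  obtain c J where c: "c \<in> A" "open J" "s \<in> J" "\<gamma> ` (J \<inter> K) \<subseteq> fst c"
    and sm: "smooth_on (J \<inter> K) (snd c \<circ> \<gamma>)"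
    using assms unfolding smooth_curve_on_def by blast
  obtain f' where f': "continuous_on (J \<inter> K) f'"
    "\<And>r. r \<in> J \<inter> K \<Longrightarrow> (snd c \<circ> \<gamma> has_vector_derivative f' r) (at r within (J \<inter> K))"
    using smooth_on_vector_derivative[OF sm] by blast
  have "at r within (J \<inter> K) = at r within K" if "r \<in> J" for r
    by (rule at_within_nhd[OF that c(2)]) auto
  then show ?thesis
    using that[OF c smooth_on_imp_continuous_on[OF sm] f'(1)] f'(2) by fastforce
qed

lemma smooth_curve_on_imp_continuous_on:
  assumes "smooth_curve_on A \<gamma> K"
  shows "continuous_on K \<gamma>"
proof -
  have "continuous (at s within K) \<gamma>" if "s \<in> K" for s
  proof -
    obtain c J f' where c: "c \<in> A" "open J" "s \<in> J" "\<gamma> ` (J \<inter> K) \<subseteq> fst c" "continuous_on (J \<inter> K) (snd c \<circ> \<gamma>)"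
      using smooth_curve_on_local[OF assms \<open>s \<in> K\<close>] by metis
    have "(snd c \<circ> \<gamma>) ` (J \<inter> K) \<subseteq> snd c ` fst c" using c(4) by auto
    then have "continuous_on (J \<inter> K) (chart_inv c \<circ> (snd c \<circ> \<gamma>))"
      using continuous_on_compose[OF c(5)] continuous_on_subset[OF continuous_on_chart_inv[OF c(1)]] by blast
    moreover have "(chart_inv c \<circ> (snd c \<circ> \<gamma>)) r = \<gamma> r" if "r \<in> J \<inter> K" for r
      using c that by auto
    ultimately have "continuous_on (J \<inter> K) \<gamma>"
      using continuous_on_cong by (metis (no_types, lifting))
    moreover have "at s within K = at s within (J \<inter> K)"
      by (rule at_within_nhd[OF c(3,2)]) auto
    ultimately show ?thesis
      using that c(3) by (simp add: continuous_on_eq_continuous_within)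
  qed
  then show ?thesis by (simp add: continuous_on_eq_continuous_within)
qed

text \<open>Smoothness provides one chart around each parameter, whereas \<open>velocity\<close>
  refers to all charts around the point. The chain rule carries the derivative from that chart to
  every other, and on a nondegenerate closed interval the one-sided derivative is unique, so
  \<open>velocity\<close> equals it. The second part is the consistency condition for a tangent
  vector.\<close>

lemma velocity_has_vector_derivative:
  assumes sm: "smooth_curve_on A \<gamma> {u..v}" and "u < v" "s \<in> {u..v}" "c \<in> A" "\<gamma> s \<in> fst c"
  shows "(snd c \<circ> \<gamma> has_vector_derivative velocity A \<gamma> {u..v} s c) (at s within {u..v})"
    and "c' \<in> A \<Longrightarrow> \<gamma> s \<in> fst c' \<Longrightarrow>
      velocity A \<gamma> {u..v} s c' = change_of_coordinates c c' (\<gamma> s) (velocity A \<gamma> {u..v} s c)"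
proof -
  have tr: "(snd c2 \<circ> \<gamma> has_vector_derivative change_of_coordinates c1 c2 (\<gamma> s) w) (at s within {u..v})"
    if "c1 \<in> A" "\<gamma> s \<in> fst c1" "c2 \<in> A" "\<gamma> s \<in> fst c2"
      and d: "(snd c1 \<circ> \<gamma> has_vector_derivative w) (at s within {u..v})" for c1 c2 w
  proof -
    have "((snd c2 \<circ> chart_inv c1) has_derivative change_of_coordinates c1 c2 (\<gamma> s))
        (at ((snd c1 \<circ> \<gamma>) s) within (snd c1 \<circ> \<gamma>) ` {u..v})"
      using transition_has_derivative[of c1 c2 "\<gamma> s"] that by (simp add: has_derivative_at_withinI)
    from vector_derivative_diff_chain_within[OF d this]
    have "((snd c2 \<circ> chart_inv c1) \<circ> (snd c1 \<circ> \<gamma>) has_vector_derivative change_of_coordinates c1 c2 (\<gamma> s) w)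
        (at s within {u..v})" .
    \<comment> \<open>The two coordinate expressions agree only where the curve lies in the first
      chart; continuity ensures this near s.\<close>
    moreover have "continuous (at s within {u..v}) \<gamma>"
      using smooth_curve_on_imp_continuous_on[OF sm] assms(3)
      by (simp add: continuous_on_eq_continuous_within)
    then have "\<forall>\<^sub>F r in at s within {u..v}. \<gamma> r \<in> fst c1"
      using open_chart_domain[OF that(1)] that(2)
      unfolding continuous_within tendsto_def by blast
    then have "\<forall>\<^sub>F r in at s within {u..v}. ((snd c2 \<circ> chart_inv c1) \<circ> (snd c1 \<circ> \<gamma>)) r = (snd c2 \<circ> \<gamma>) r"
      by eventually_elim (use that in auto)
    ultimately show ?thesis
      unfolding has_vector_derivative_def
      by (rule has_derivative_transform_eventually) (use that assms in auto)
  qed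
  have un: "vector_derivative f (at s within {u..v}) = w"
    if "(f has_vector_derivative w) (at s within {u..v})" for f :: "real \<Rightarrow> 'e" and w
    using vector_derivative_within_closed_interval[OF assms(2,3) that] .
  obtain c0 J f' where c0: "c0 \<in> A" "s \<in> J" "\<gamma> ` (J \<inter> {u..v}) \<subseteq> fst c0"
    "\<And>r. r \<in> J \<inter> {u..v} \<Longrightarrow> (snd c0 \<circ> \<gamma> has_vector_derivative f' r) (at r within {u..v})"
    using smooth_curve_on_local[OF sm assms(3)] by metis
  have *: "(snd c \<circ> \<gamma> has_vector_derivative velocity A \<gamma> {u..v} s c) (at s within {u..v})"
    if "c \<in> A" "\<gamma> s \<in> fst c" for c
  proof -
    have "s \<in> J \<inter> {u..v}" using c0(2) assms(3) by simp
    then have "(snd c \<circ> \<gamma> has_vector_derivative change_of_coordinates c0 c (\<gamma> s) (f' s)) (at s within {u..v})"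
      using tr[OF c0(1) _ that c0(4)] c0(3) by blast
    then show ?thesis using un that by (simp add: velocity_def)
  qed
  show "(snd c \<circ> \<gamma> has_vector_derivative velocity A \<gamma> {u..v} s c) (at s within {u..v})"
    using * assms by blast
  show "velocity A \<gamma> {u..v} s c' = change_of_coordinates c c' (\<gamma> s) (velocity A \<gamma> {u..v} s c)"
    if "c' \<in> A" "\<gamma> s \<in> fst c'"
    using un[OF tr[OF assms(4,5) that *[OF assms(4,5)]]] that by (simp add: velocity_def)
qed

end

subsection \<open>Curves and their length\<close>

lemma velocity_interior:
  assumes "u < s" "s < v" "a \<le> u" "v \<le> b"
  shows "velocity A \<gamma> {a..b} s = velocity A \<gamma> {u..v} s"
proof -
  have "at s within {a..b} = at s within {u..v}"
    by (rule at_within_nhd[of s "{u<..<v}"]) (use assms in auto)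
  then show ?thesis by (simp only: velocity_def)
qed

text \<open>\<open>curve_length\<close> takes velocities within the whole interval. Inside a piece
  they agree with those within the piece; at its end points they may differ, and at a break the
  value may be arbitrary, but two points do not affect the integral.\<close>

lemma has_integral_speed_subinterval:
  assumes "((\<lambda>s. F (\<gamma> s) (velocity A \<gamma> {u..v} s)) has_integral I) {u..v}" "a \<le> u" "v \<le> b"
  shows "((\<lambda>s. F (\<gamma> s) (velocity A \<gamma> {a..b} s)) has_integral (I::real)) {u..v}"
proof (rule has_integral_spike_finite[OF _ _ assms(1)])
  show "finite {u, v}" by simp
  show "F (\<gamma> s) (velocity A \<gamma> {a..b} s) = F (\<gamma> s) (velocity A \<gamma> {u..v} s)" if "s \<in> {u..v} - {u, v}" for s
    using that assms velocity_interior[of u s v a b A \<gamma>] by simp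
qed

lemma has_integral_speed_join:
  assumes "((\<lambda>s. F (\<gamma> s) (velocity A \<gamma> {a..b} s)) has_integral I) {a..b}"
    and "((\<lambda>s. F (\<gamma> s) (velocity A \<gamma> {b..c} s)) has_integral J) {b..c}" and "a \<le> b" "b \<le> c"
  shows "((\<lambda>s. F (\<gamma> s) (velocity A \<gamma> {a..c} s)) has_integral (I + J :: real)) {a..c}"
  by (rule has_integral_combine[OF assms(3,4)])
     (use assms in \<open>auto intro: has_integral_speed_subinterval[where F = F and \<gamma> = \<gamma> and A = A]\<close>)

lemma has_vector_derivative_cong_on:
  assumes "\<And>s. s \<in> K \<Longrightarrow> f s = g s" "s \<in> K"
  shows "(f has_vector_derivative D) (at s within K) \<longleftrightarrow> (g has_vector_derivative D) (at s within K)"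
  using assms has_vector_derivative_transform[of s K f g D] has_vector_derivative_transform[of s K g f D]
  by metis

lemma velocity_cong:
  fixes \<gamma> :: "real \<Rightarrow> 's" and A :: "('s, 'e::euclidean_space) chart set"
  assumes "\<And>s. s \<in> K \<Longrightarrow> \<gamma> s = \<gamma>' s" "s \<in> K"
  shows "velocity A \<gamma> K s = velocity A \<gamma>' K s"
proof
  fix c :: "('s, 'e) chart"
  have "(snd c \<circ> \<gamma> has_vector_derivative D) (at s within K) \<longleftrightarrow>
        (snd c \<circ> \<gamma>' has_vector_derivative D) (at s within K)" for D
    by (rule has_vector_derivative_cong_on[OF _ assms(2)]) (simp add: assms(1))
  \<comment> \<open>\<open>vector_derivative\<close> is a choice among the derivatives; the
    equivalence for every D makes the choices coincide even where no derivative exists.\<close>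
  then have "vector_derivative (snd c \<circ> \<gamma>) (at s within K) = vector_derivative (snd c \<circ> \<gamma>') (at s within K)"
    unfolding vector_derivative_def by presburger
  then show "velocity A \<gamma> K s c = velocity A \<gamma>' K s c"
    unfolding velocity_def using assms by simp
qed

lemma affine_vimage_Icc:
  fixes k l u v :: real
  shows "0 < k \<Longrightarrow> (\<lambda>s. k * s + l) -` {u..v} = {(u - l) / k..(v - l) / k}"
    and "k < 0 \<Longrightarrow> (\<lambda>s. k * s + l) -` {u..v} = {(v - l) / k..(u - l) / k}"
  by (auto simp: field_simps)

text \<open>Both signs of k are covered: positive ones serve reparametrisation, and -1 serves the
  reversal of curves.\<close>

lemma has_integral_compose_affine:
  fixes f :: "real \<Rightarrow> real"
  assumes "(f has_integral I) {u..v}" "k \<noteq> 0"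
  shows "((\<lambda>s. \<bar>k\<bar> * f (k * s + l)) has_integral I) ((\<lambda>s. k * s + l) -` {u..v})"
proof -
  have "(\<lambda>x. (1 / k) *\<^sub>R x + - ((1 / k) *\<^sub>R l)) ` cbox u v = (\<lambda>s. k * s + l) -` {u..v}"
  proof (intro equalityI subsetI)
    fix x assume "x \<in> (\<lambda>s. k * s + l) -` {u..v}"
    then show "x \<in> (\<lambda>x. (1 / k) *\<^sub>R x + - ((1 / k) *\<^sub>R l)) ` cbox u v"
      using assms(2) by (intro image_eqI[of _ _ "k * x + l"]) (auto simp: field_simps)
  qed (use assms(2) in \<open>auto simp: field_simps\<close>)
  then have "((\<lambda>s. f (k * s + l)) has_integral (1 / \<bar>k\<bar>) * I) ((\<lambda>s. k * s + l) -` {u..v})"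
    using has_integral_affinity[of f I u v k l] assms by simp
  then show ?thesis
    using has_integral_mult_right[of "\<lambda>s. f (k * s + l)" "(1 / \<bar>k\<bar>) * I" _ "\<bar>k\<bar>"] assms(2) by simp
qed

context smooth_manifold
begin

lemma velocity_in_tangent_space:
  assumes "smooth_curve_on A \<gamma> {u..v}" "u < v" "s \<in> {u..v}"
  shows "velocity A \<gamma> {u..v} s \<in> tangent_space A (\<gamma> s)"
  unfolding tangent_space_def
proof (intro CollectI conjI allI ballI impI)
  show "velocity A \<gamma> {u..v} s c = 0" if "\<not> (c \<in> A \<and> \<gamma> s \<in> fst c)" for c
    using that by (auto simp: velocity_def)
  show "velocity A \<gamma> {u..v} s c' = change_of_coordinates c c' (\<gamma> s) (velocity A \<gamma> {u..v} s c)"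
    if "c \<in> A" "c' \<in> A" "\<gamma> s \<in> fst c \<and> \<gamma> s \<in> fst c'" for c c'
    using velocity_has_vector_derivative(2)[OF assms] that by blast
qed

lemma velocity_unique:
  assumes "u < v" "s \<in> {u..v}" "c \<in> A" "\<gamma> s \<in> fst c"
    "(snd c \<circ> \<gamma> has_vector_derivative w) (at s within {u..v})"
  shows "velocity A \<gamma> {u..v} s c = w"
  using vector_derivative_within_closed_interval[OF assms(1,2,5)] assms(3,4) by (simp add: velocity_def)

lemma velocity_restrict:
  assumes "smooth_curve_on A \<gamma> {u..v}" "u \<le> u'" "u' < v'" "v' \<le> v" "s \<in> {u'..v'}"
  shows "velocity A \<gamma> {u'..v'} s = velocity A \<gamma> {u..v} s"
proof
  fix c
  show "velocity A \<gamma> {u'..v'} s c = velocity A \<gamma> {u..v} s c"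
  proof (cases "c \<in> A \<and> \<gamma> s \<in> fst c")
    case True
    then have "(snd c \<circ> \<gamma> has_vector_derivative velocity A \<gamma> {u..v} s c) (at s within {u..v})"
      using velocity_has_vector_derivative(1)[OF assms(1)] assms by auto
    then have "(snd c \<circ> \<gamma> has_vector_derivative velocity A \<gamma> {u..v} s c) (at s within {u'..v'})"
      by (rule has_vector_derivative_within_subset) (use assms in auto)
    then show ?thesis using velocity_unique assms(3,5) True by blast
  qed (auto simp: velocity_def)
qed

lemma smooth_curve_on_compose_affine:
  assumes "smooth_curve_on A \<gamma> K"
  shows "smooth_curve_on A (\<lambda>s. \<gamma> (k * s + l)) ((\<lambda>s. k * s + l) -` K)"
  unfolding smooth_curve_on_def
proof
  fix s assume "s \<in> (\<lambda>s. k * s + l) -` K"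
  then obtain c J where c: "c \<in> A" "open J" "k * s + l \<in> J" "\<gamma> ` (J \<inter> K) \<subseteq> fst c" "smooth_on (J \<inter> K) (snd c \<circ> \<gamma>)"
    using assms unfolding smooth_curve_on_def by auto
  have "open ((\<lambda>s. k * s + l) -` J)" by (intro open_vimage c continuous_intros)
  moreover have "smooth_on ((\<lambda>s. k * s + l) -` J \<inter> (\<lambda>s. k * s + l) -` K) (snd c \<circ> (\<lambda>s. \<gamma> (k * s + l)))"
    using smooth_on_compose_affine[OF c(5), of k l] by (simp add: o_def)
  moreover have "(\<lambda>s. \<gamma> (k * s + l)) ` ((\<lambda>s. k * s + l) -` J \<inter> (\<lambda>s. k * s + l) -` K) \<subseteq> fst c"
    using c(4) by auto
  ultimately show "\<exists>c\<in>A. \<exists>J. open J \<and> s \<in> J \<and>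
      (\<lambda>s. \<gamma> (k * s + l)) ` (J \<inter> (\<lambda>s. k * s + l) -` K) \<subseteq> fst c \<and>
      smooth_on (J \<inter> (\<lambda>s. k * s + l) -` K) (snd c \<circ> (\<lambda>s. \<gamma> (k * s + l)))"
    using c(1,3) by (intro bexI[of _ c] exI[of _ "(\<lambda>s. k * s + l) -` J"] conjI) simp_all
qed

lemma velocity_compose_affine:
  assumes "smooth_curve_on A \<gamma> {u..v}" "u < v"
    and vim: "(\<lambda>s. k * s + l) -` {u..v} = {u'..v'}" and "u' < v'" "s \<in> {u'..v'}"
  shows "velocity A (\<lambda>s. \<gamma> (k * s + l)) {u'..v'} s = (\<lambda>c. k *\<^sub>R velocity A \<gamma> {u..v} (k * s + l) c)"
proof
  fix c
  have s: "k * s + l \<in> {u..v}" using assms(5) vim by blast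
  show "velocity A (\<lambda>s. \<gamma> (k * s + l)) {u'..v'} s c = k *\<^sub>R velocity A \<gamma> {u..v} (k * s + l) c"
  proof (cases "c \<in> A \<and> \<gamma> (k * s + l) \<in> fst c")
    case True
    then have "(snd c \<circ> \<gamma> has_vector_derivative velocity A \<gamma> {u..v} (k * s + l) c)
        (at (k * s + l) within {u..v})"
      using velocity_has_vector_derivative(1)[OF assms(1,2) s] by simp
    then have "(snd c \<circ> \<gamma> has_vector_derivative velocity A \<gamma> {u..v} (k * s + l) c)
        (at (k * s + l) within (\<lambda>s. k * s + l) ` {u'..v'})"
      by (rule has_vector_derivative_within_subset) (use vim in auto)
    moreover have "((\<lambda>s. k * s + l) has_vector_derivative k) (at s within {u'..v'})"
      by (auto intro!: derivative_eq_intros)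
    ultimately have "((snd c \<circ> \<gamma>) \<circ> (\<lambda>s. k * s + l) has_vector_derivative
        k *\<^sub>R velocity A \<gamma> {u..v} (k * s + l) c) (at s within {u'..v'})"
      by (rule vector_diff_chain_within[rotated])
    then have "(snd c \<circ> (\<lambda>s. \<gamma> (k * s + l)) has_vector_derivative
        k *\<^sub>R velocity A \<gamma> {u..v} (k * s + l) c) (at s within {u'..v'})"
      by (simp add: o_def)
    from velocity_unique[OF assms(4,5) _ _ this] show ?thesis using True by simp
  qed (auto simp: velocity_def)
qed

lemma piecewise_smooth_imp_continuous_on:
  assumes "piecewise_smooth_curve A \<gamma> a b" "a < b"
  shows "continuous_on {a..b} \<gamma>"
  using assms unfolding piecewise_smooth_curve_def
proof (induction rule: piecewise_on_induct)
  case (piece u v)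
  then show ?case by (simp add: smooth_curve_on_imp_continuous_on)
next
  case (join u v w)
  then have "continuous_on ({u..v} \<union> {v..w}) \<gamma>"
    by (intro continuous_on_closed_Un) auto
  moreover have "{u..v} \<union> {v..w} = {u..w}" using join by auto
  ultimately show ?case by simp
qed

end

text \<open>Gathers what the metric arguments take from the Fermat metric: continuity and positivity
  give bounds on compact sets of unit vectors, and homogeneity extends them to all vectors.
  Homogeneity is restricted to r \<ge> 0 because the Fermat metric is not symmetric in general; both
  it and its reverse are instances.\<close>

locale finsler_manifold = smooth_manifold A
  for A :: "('s::t2_space, 'e::euclidean_space) chart set" +
  fixes F :: "'s \<Rightarrow> ('s, 'e) tangent \<Rightarrow> real"
  assumes connected_manifold: "connected (UNIV :: 's set)"
    and pos: "\<xi> \<in> tangent_space A p \<Longrightarrow> \<xi> \<noteq> (\<lambda>c. 0) \<Longrightarrow> F p \<xi> > 0"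
    and homogeneous: "\<xi> \<in> tangent_space A p \<Longrightarrow> r \<ge> 0 \<Longrightarrow> F p (\<lambda>c. r *\<^sub>R \<xi> c) = r * F p \<xi>"
    and continuous: "c \<in> A \<Longrightarrow> continuous_on (snd c ` fst c \<times> UNIV)
      (\<lambda>(x, v). F (chart_inv c x) (coord_vector A (chart_inv c x) c v))"
begin

abbreviation "len \<equiv> curve_length A F"
abbreviation "d \<equiv> finsler_dist A F"

lemma F_zero [simp]: "F p (\<lambda>c. 0) = 0"
  using homogeneous[OF zero_in_tangent_space, of 0 p] by simp

lemma F_nonneg: "\<xi> \<in> tangent_space A p \<Longrightarrow> F p \<xi> \<ge> 0"
  using pos[of \<xi> p] by (cases "\<xi> = (\<lambda>c. 0)") auto

text \<open>Brings the speed into the shape to which \<open>continuous\<close> and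
  \<open>local_bounds\<close> apply.\<close>

lemma speed_in_chart:
  assumes "smooth_curve_on A \<gamma> {u..v}" "u < v" "s \<in> {u..v}" "c \<in> A" "\<gamma> s \<in> fst c"
  shows "F (\<gamma> s) (velocity A \<gamma> {u..v} s) =
    F (chart_inv c (snd c (\<gamma> s))) (coord_vector A (chart_inv c (snd c (\<gamma> s))) c (velocity A \<gamma> {u..v} s c))"
  using tangent_eq_coord_vector[OF assms(4,5) velocity_in_tangent_space[OF assms(1-3)]] assms(4,5)
  by simp

lemma continuous_on_speed:
  assumes "smooth_curve_on A \<gamma> {u..v}" "u < v"
  shows "continuous_on {u..v} (\<lambda>s. F (\<gamma> s) (velocity A \<gamma> {u..v} s))"
proof -
  have "continuous (at s within {u..v}) (\<lambda>s. F (\<gamma> s) (velocity A \<gamma> {u..v} s))" if s: "s \<in> {u..v}" for s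
  proof -
    obtain c J f' where c: "c \<in> A" "open J" "s \<in> J" "\<gamma> ` (J \<inter> {u..v}) \<subseteq> fst c"
      and cont: "continuous_on (J \<inter> {u..v}) (snd c \<circ> \<gamma>)" "continuous_on (J \<inter> {u..v}) f'"
      and f': "\<And>r. r \<in> J \<inter> {u..v} \<Longrightarrow> (snd c \<circ> \<gamma> has_vector_derivative f' r) (at r within {u..v})"
      using smooth_curve_on_local[OF assms(1) s] by metis
    let ?G = "\<lambda>(x, v). F (chart_inv c x) (coord_vector A (chart_inv c x) c v)"
    have "continuous_on (J \<inter> {u..v}) (\<lambda>r. ((snd c \<circ> \<gamma>) r, f' r))"
      by (intro continuous_on_Pair cont)
    moreover have "(\<lambda>r. ((snd c \<circ> \<gamma>) r, f' r)) ` (J \<inter> {u..v}) \<subseteq> snd c ` fst c \<times> UNIV"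
      using c(4) by auto
    ultimately have "continuous_on (J \<inter> {u..v}) (?G \<circ> (\<lambda>r. ((snd c \<circ> \<gamma>) r, f' r)))"
      using continuous_on_compose continuous_on_subset[OF continuous[OF c(1)]] by blast
    moreover have "(?G \<circ> (\<lambda>r. ((snd c \<circ> \<gamma>) r, f' r))) r = F (\<gamma> r) (velocity A \<gamma> {u..v} r)"
      if r: "r \<in> J \<inter> {u..v}" for r
    proof -
      have g: "\<gamma> r \<in> fst c" using r c(4) by blast
      have "velocity A \<gamma> {u..v} r c = f' r"
        using velocity_unique[OF assms(2) _ c(1) g f'[OF r]] r by blast
      then show ?thesis
        using speed_in_chart[OF assms _ c(1) g] r by simp
    qed
    ultimately have "continuous_on (J \<inter> {u..v}) (\<lambda>s. F (\<gamma> s) (velocity A \<gamma> {u..v} s))"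
      using continuous_on_cong by (metis (no_types, lifting))
    moreover have "at s within {u..v} = at s within (J \<inter> {u..v})"
      by (rule at_within_nhd[OF c(3,2)]) auto
    ultimately show ?thesis
      using s c(3) by (simp add: continuous_on_eq_continuous_within)
  qed
  then show ?thesis by (simp add: continuous_on_eq_continuous_within)
qed

text \<open>Integrability is settled together with the sign, since \<open>integral\<close> returns 0
  for functions that are not integrable; \<open>curve_length\<close> is thus a genuine integral on
  piecewise smooth curves.\<close>

lemma speed_has_integral_nonneg:
  assumes "piecewise_smooth_curve A \<gamma> a b" "a < b"
  shows "((\<lambda>s. F (\<gamma> s) (velocity A \<gamma> {a..b} s)) has_integral len \<gamma> a b) {a..b} \<and> len \<gamma> a b \<ge> 0"
proof -
  have "\<exists>I\<ge>0. ((\<lambda>s. F (\<gamma> s) (velocity A \<gamma> {a..b} s)) has_integral I) {a..b}"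
    using assms unfolding piecewise_smooth_curve_def
  proof (induction rule: piecewise_on_induct)
    case (piece u v)
    let ?f = "\<lambda>s. F (\<gamma> s) (velocity A \<gamma> {u..v} s)"
    have "?f integrable_on {u..v}"
      by (rule integrable_continuous_real[OF continuous_on_speed[OF piece(2,1)]])
    moreover have "integral {u..v} ?f \<ge> 0"
      by (rule integral_nonneg[OF calculation]) (rule F_nonneg[OF velocity_in_tangent_space[OF piece(2,1)]])
    ultimately show ?case by (intro exI[of _ "integral {u..v} ?f"] conjI integrable_integral)
  next
    case (join u v w)
    then obtain I J where "I \<ge> 0" "J \<ge> 0"
      "((\<lambda>s. F (\<gamma> s) (velocity A \<gamma> {u..v} s)) has_integral I) {u..v}"
      "((\<lambda>s. F (\<gamma> s) (velocity A \<gamma> {v..w} s)) has_integral J) {v..w}" by blast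
    then show ?case
      using join(1,2)
      by (intro exI[of _ "I + J"] conjI has_integral_speed_join[where F = F and A = A and \<gamma> = \<gamma> and b = v]) auto
  qed
  then obtain I where "I \<ge> 0" "((\<lambda>s. F (\<gamma> s) (velocity A \<gamma> {a..b} s)) has_integral I) {a..b}"
    by blast
  then show ?thesis unfolding curve_length_def by (simp add: integral_unique)
qed

lemmas speed_has_integral = speed_has_integral_nonneg[THEN conjunct1]
lemmas len_nonneg = speed_has_integral_nonneg[THEN conjunct2]

lemma len_join:
  assumes "piecewise_smooth_curve A \<gamma> a b" "piecewise_smooth_curve A \<gamma> b c" "a < b" "b < c"
  shows "piecewise_smooth_curve A \<gamma> a c" "len \<gamma> a c = len \<gamma> a b + len \<gamma> b c"
proof -
  show "piecewise_smooth_curve A \<gamma> a c"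
    using assms piecewise_on_join unfolding piecewise_smooth_curve_def by blast
  show "len \<gamma> a c = len \<gamma> a b + len \<gamma> b c"
    unfolding curve_length_def[of _ _ _ a c]
    by (intro integral_unique has_integral_speed_join[where F = F and A = A and \<gamma> = \<gamma> and b = b] speed_has_integral assms less_imp_le)
qed

lemma piecewise_smooth_restrict:
  assumes "piecewise_smooth_curve A \<gamma> a b" "a \<le> u" "u < v" "v \<le> b"
  shows "piecewise_smooth_curve A \<gamma> u v"
  unfolding piecewise_smooth_curve_def
  by (rule piecewise_on_restrict[OF assms(1)[unfolded piecewise_smooth_curve_def]])
     (use assms in \<open>auto intro: smooth_curve_on_subset\<close>)

lemma len_restrict:
  assumes "piecewise_smooth_curve A \<gamma> a b" "a \<le> u" "u < v" "v \<le> b"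
  shows "len \<gamma> u v \<le> len \<gamma> a b"
proof -
  have r: "piecewise_smooth_curve A \<gamma> x y" if "a \<le> x" "x < y" "y \<le> b" for x y
    using piecewise_smooth_restrict[OF assms(1)] that by blast
  have "len \<gamma> u v \<le> len \<gamma> a v"
  proof (cases "a = u")
    case False
    then show ?thesis
      using len_join(2)[OF r r, of a u v] len_nonneg[OF r, of a u] assms by simp
  qed simp
  also have "\<dots> \<le> len \<gamma> a b"
  proof (cases "v = b")
    case False
    then show ?thesis
      using len_join(2)[OF r r, of a v b] len_nonneg[OF r, of v b] assms by simp
  qed simp
  finally show ?thesis .
qed

lemma piecewise_smooth_cong:
  assumes "piecewise_smooth_curve A \<gamma> a b" "\<And>s. s \<in> {a..b} \<Longrightarrow> \<gamma> s = \<gamma>' s"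
  shows "piecewise_smooth_curve A \<gamma>' a b" "len \<gamma>' a b = len \<gamma> a b"
proof -
  show "piecewise_smooth_curve A \<gamma>' a b"
    unfolding piecewise_smooth_curve_def
  proof (rule piecewise_on_mono[OF assms(1)[unfolded piecewise_smooth_curve_def]])
    fix u v assume "a \<le> u" "u < v" "v \<le> b" "smooth_curve_on A \<gamma> {u..v}"
    then show "smooth_curve_on A \<gamma>' {u..v}"
      using smooth_curve_on_cong[of "{u..v}" \<gamma> \<gamma>'] assms(2) by simp
  qed
  show "len \<gamma>' a b = len \<gamma> a b"
    unfolding curve_length_def
  proof (rule integral_cong)
    fix s assume "s \<in> {a..b}"
    then show "F (\<gamma>' s) (velocity A \<gamma>' {a..b} s) = F (\<gamma> s) (velocity A \<gamma> {a..b} s)"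
      using assms(2) velocity_cong[of "{a..b}" \<gamma> \<gamma>' s A] by simp
  qed
qed

text \<open>F' is kept separate from F so that one computation serves two cases: F' = F with k > 0,
  and the reversed metric with k = -1, where the velocity changes sign.\<close>

lemma len_compose_affine_piece:
  assumes "smooth_curve_on A \<gamma> {u..v}" "u < v" "k \<noteq> 0"
    and vim: "(\<lambda>s. k * s + l) -` {u..v} = {u'..v'}" "u' < v'"
    and F': "\<And>p \<xi>. \<xi> \<in> tangent_space A p \<Longrightarrow> F' p (\<lambda>c. k *\<^sub>R \<xi> c) = \<bar>k\<bar> * F p \<xi>"
  shows "((\<lambda>s. F' (\<gamma> (k * s + l)) (velocity A (\<lambda>s. \<gamma> (k * s + l)) {u'..v'} s)) has_integral len \<gamma> u v) {u'..v'}"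
proof -
  have I: "((\<lambda>s. \<bar>k\<bar> * F (\<gamma> (k * s + l)) (velocity A \<gamma> {u..v} (k * s + l))) has_integral len \<gamma> u v) {u'..v'}"
    using has_integral_compose_affine[OF speed_has_integral assms(3), of \<gamma> u v l] assms(1,2) vim(1)
    by (simp add: piecewise_smooth_curve_def piecewise_on_single)
  show ?thesis
  proof (rule has_integral_eq[OF _ I])
    fix s assume s: "s \<in> {u'..v'}"
    then have "k * s + l \<in> {u..v}" using vim(1) by blast
    then show "\<bar>k\<bar> * F (\<gamma> (k * s + l)) (velocity A \<gamma> {u..v} (k * s + l)) =
        F' (\<gamma> (k * s + l)) (velocity A (\<lambda>s. \<gamma> (k * s + l)) {u'..v'} s)"
      using F'[OF velocity_in_tangent_space[OF assms(1,2)]]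
      unfolding velocity_compose_affine[OF assms(1,2) vim s] by simp
  qed
qed

lemma len_compose_affine:
  fixes k l :: real
  assumes "piecewise_smooth_curve A \<gamma> a b" "a < b" "k > 0"
  defines "h \<equiv> \<lambda>x. (x - l) / (k :: real)"
  shows "piecewise_smooth_curve A (\<lambda>s. \<gamma> (k * s + l)) (h a) (h b)"
    and "len (\<lambda>s. \<gamma> (k * s + l)) (h a) (h b) = len \<gamma> a b"
proof -
  have "piecewise_smooth_curve A \<gamma> a b \<and> piecewise_smooth_curve A (\<lambda>s. \<gamma> (k * s + l)) (h a) (h b) \<and>
    len (\<lambda>s. \<gamma> (k * s + l)) (h a) (h b) = len \<gamma> a b"
    using assms(1)[unfolded piecewise_smooth_curve_def] assms(2)
  proof (induction rule: piecewise_on_induct)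
    case (piece u v)
    have h: "h u < h v" using piece(1) assms(3) by (simp add: h_def divide_strict_right_mono)
    have vim: "(\<lambda>s. k * s + l) -` {u..v} = {h u..h v}"
      using affine_vimage_Icc(1)[OF assms(3)] by (simp add: h_def)
    have "smooth_curve_on A (\<lambda>s. \<gamma> (k * s + l)) {h u..h v}"
      using smooth_curve_on_compose_affine[OF piece(2), of k l] vim by simp
    moreover have "((\<lambda>s. F (\<gamma> (k * s + l)) (velocity A (\<lambda>s. \<gamma> (k * s + l)) {h u..h v} s))
        has_integral len \<gamma> u v) {h u..h v}"
    proof (rule len_compose_affine_piece[OF piece(2,1) _ vim h, where F' = F])
      show "F p (\<lambda>c. k *\<^sub>R \<xi> c) = \<bar>k\<bar> * F p \<xi>" if "\<xi> \<in> tangent_space A p" for p \<xi>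
        using homogeneous[OF that, of k] assms(3) by simp
    qed (use assms(3) in simp)
    then have "len (\<lambda>s. \<gamma> (k * s + l)) (h u) (h v) = len \<gamma> u v"
      unfolding curve_length_def[of A F "\<lambda>s. \<gamma> (k * s + l)"] by (rule integral_unique)
    ultimately show ?case
      using h piece piecewise_on_single[of "smooth_curve_on A (\<lambda>s. \<gamma> (k * s + l))"]
        piecewise_on_single[of "smooth_curve_on A \<gamma>"]
      unfolding piecewise_smooth_curve_def by blast
  next
    case (join u v w)
    have "h u < h v" "h v < h w" using join assms(3) by (auto simp: h_def divide_strict_right_mono)
    then show ?case
      using join(1,2) len_join[of "\<lambda>s. \<gamma> (k * s + l)" "h u" "h v" "h w"] len_join[of \<gamma> u v w]
        join.IH by presburger
  qed
  then show "piecewise_smooth_curve A (\<lambda>s. \<gamma> (k * s + l)) (h a) (h b)"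
    and "len (\<lambda>s. \<gamma> (k * s + l)) (h a) (h b) = len \<gamma> a b" by auto
qed

end

subsection \<open>The distance and the manifold topology\<close>

context smooth_manifold
begin

definition chart_ball :: "('s, 'e) chart \<Rightarrow> 's \<Rightarrow> real \<Rightarrow> 's set" where
  "chart_ball c q \<rho> = fst c \<inter> snd c -` ball (snd c q) \<rho>"

lemma open_chart_ball: "c \<in> A \<Longrightarrow> open (chart_ball c q \<rho>)"
  unfolding chart_ball_def
  by (rule continuous_open_preimage[OF continuous_on_chart open_chart_domain]) auto

lemma centre_in_chart_ball: "q \<in> fst c \<Longrightarrow> 0 < \<rho> \<Longrightarrow> q \<in> chart_ball c q \<rho>"
  unfolding chart_ball_def by simp

lemma chart_ball_subset_open:
  assumes "c \<in> A" "q \<in> fst c" "open W" "q \<in> W"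
  obtains \<rho> where "\<rho> > 0" "chart_ball c q \<rho> \<subseteq> W"
proof -
  have "open (snd c ` (fst c \<inter> W))" "snd c q \<in> snd c ` (fst c \<inter> W)"
    using assms open_chart_image by auto
  then obtain \<rho> where \<rho>: "\<rho> > 0" "ball (snd c q) \<rho> \<subseteq> snd c ` (fst c \<inter> W)"
    using open_contains_ball by blast
  have "p \<in> W" if "p \<in> chart_ball c q \<rho>" for p
  proof -
    have p: "p \<in> fst c" "snd c p \<in> snd c ` (fst c \<inter> W)" using that \<rho>(2) unfolding chart_ball_def by auto
    then obtain p' where "p' \<in> fst c" "p' \<in> W" "snd c p = snd c p'" by blast
    then have "p = p'" using chart_inv_chart[OF assms(1)] p(1) by metis
    then show ?thesis using \<open>p' \<in> W\<close> by simp
  qed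
  then show ?thesis using that \<rho>(1) by blast
qed

lemma chart_segment:
  assumes c: "c \<in> A" and seg: "closed_segment x y \<subseteq> snd c ` fst c"
  defines "\<gamma> \<equiv> \<lambda>s. chart_inv c (x + s *\<^sub>R (y - x))"
  shows "smooth_curve_on A \<gamma> {0..1}"
    and "s \<in> {0..1} \<Longrightarrow> velocity A \<gamma> {0..1} s c = y - x"
    and "s \<in> {0..1} \<Longrightarrow> \<gamma> s \<in> fst c \<and> snd c (\<gamma> s) = x + s *\<^sub>R (y - x)"
proof -
  have im: "x + s *\<^sub>R (y - x) \<in> snd c ` fst c" if "s \<in> {0..1}" for s
  proof -
    have "x + s *\<^sub>R (y - x) = (1 - s) *\<^sub>R x + s *\<^sub>R y" by (simp add: algebra_simps)
    then show ?thesis using seg that unfolding closed_segment_def by auto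
  qed
  have g: "\<gamma> s \<in> fst c \<and> snd c (\<gamma> s) = x + s *\<^sub>R (y - x)" if "s \<in> {0..1}" for s
    using im[OF that] chart_inv_in_domain[OF c] chart_chart_inv[OF c] unfolding \<gamma>_def by blast
  then show "s \<in> {0..1} \<Longrightarrow> \<gamma> s \<in> fst c \<and> snd c (\<gamma> s) = x + s *\<^sub>R (y - x)" .
  show sm: "smooth_curve_on A \<gamma> {0..1}"
    unfolding smooth_curve_on_def
  proof
    fix s :: real assume "s \<in> {0..1}"
    have "smooth_on (UNIV \<inter> {0..1}) (snd c \<circ> \<gamma>)"
      using smooth_on_cong[of "{0..1}" "snd c \<circ> \<gamma>" "\<lambda>s. x + s *\<^sub>R (y - x)"] g smooth_on_line[of "{0..1}"]
      by simp
    moreover have "\<gamma> ` (UNIV \<inter> {0..1}) \<subseteq> fst c" using g by blast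
    ultimately show "\<exists>c\<in>A. \<exists>J. open J \<and> s \<in> J \<and> \<gamma> ` (J \<inter> {0..1}) \<subseteq> fst c \<and> smooth_on (J \<inter> {0..1}) (snd c \<circ> \<gamma>)"
      using c open_UNIV by blast
  qed
  show "velocity A \<gamma> {0..1} s c = y - x" if s: "s \<in> {0..1}"
  proof (rule velocity_unique[OF _ s c])
    have "((\<lambda>s. x + s *\<^sub>R (y - x)) has_vector_derivative (y - x)) (at s within {0..1})"
      by (auto intro!: derivative_eq_intros)
    then show "(snd c \<circ> \<gamma> has_vector_derivative (y - x)) (at s within {0..1})"
      by (rule has_vector_derivative_transform[OF s, rotated]) (use g in simp)
  qed (use g s in auto)
qed

end

section \<open>Lengths of curves against Euclidean distances in a chart\<close>

context finsler_manifold
begin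

lemma speed_chart_scaleR:
  assumes "c \<in> A" "x \<in> snd c ` fst c" "r \<ge> 0"
  shows "F (chart_inv c x) (coord_vector A (chart_inv c x) c (r *\<^sub>R v)) =
    r * F (chart_inv c x) (coord_vector A (chart_inv c x) c v)"
  using assms homogeneous[OF coord_vector_in_tangent_space] chart_inv_in_domain
  by (simp add: coord_vector_scaleR)

text \<open>On the compact product of a closed coordinate ball with the unit sphere, F is continuous
  and positive, so it has a positive minimum m and a maximum M there; homogeneity spreads both
  bounds to all vectors. Every comparison of \<open>d\<close> with the manifold topology comes from
  m and M.\<close>

lemma local_bounds:
  assumes c: "c \<in> A" "q \<in> fst c"
  obtains r m M where "r > 0" "m > 0" "M > 0" "cball (snd c q) r \<subseteq> snd c ` fst c"
    "\<And>x v. x \<in> cball (snd c q) r \<Longrightarrow>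
       m * norm v \<le> F (chart_inv c x) (coord_vector A (chart_inv c x) c v)"
    "\<And>x v. x \<in> cball (snd c q) r \<Longrightarrow>
       F (chart_inv c x) (coord_vector A (chart_inv c x) c v) \<le> M * norm v"
proof -
  let ?G = "\<lambda>x v. F (chart_inv c x) (coord_vector A (chart_inv c x) c v)"
  obtain r where r: "r > 0" "cball (snd c q) r \<subseteq> snd c ` fst c"
    using open_chart_range[OF c(1)] c(2) open_contains_cball by blast
  let ?K = "cball (snd c q) r \<times> sphere (0::'e) 1"
  have K: "compact ?K" by (intro compact_Times) auto
  have ne: "?K \<noteq> {}" using r(1) by auto
  have cont: "continuous_on ?K (\<lambda>(x, v). ?G x v)"
    by (rule continuous_on_subset[OF continuous[OF c(1)]]) (use r(2) in auto)
  have posG: "?G x v > 0" if "x \<in> snd c ` fst c" "v \<noteq> 0" for x v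
  proof (rule pos)
    have p: "chart_inv c x \<in> fst c" using chart_inv_in_domain[OF c(1) that(1)] .
    then show "coord_vector A (chart_inv c x) c v \<in> tangent_space A (chart_inv c x)"
      by (rule coord_vector_in_tangent_space[OF c(1)])
    show "coord_vector A (chart_inv c x) c v \<noteq> (\<lambda>c. 0)"
      using coord_vector_apply[OF c(1) p, of v] that(2) by (metis (full_types))
  qed
  obtain z where z: "z \<in> ?K" "\<And>y. y \<in> ?K \<Longrightarrow> (\<lambda>(x, v). ?G x v) z \<le> (\<lambda>(x, v). ?G x v) y"
    using continuous_attains_inf[OF K ne cont] by blast
  obtain w where w: "w \<in> ?K" "\<And>y. y \<in> ?K \<Longrightarrow> (\<lambda>(x, v). ?G x v) y \<le> (\<lambda>(x, v). ?G x v) w"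
    using continuous_attains_sup[OF K ne cont] by blast
  have on_K: "0 < (\<lambda>(x, v). ?G x v) y" if "y \<in> ?K" for y
  proof -
    obtain x v where y: "y = (x, v)" by fastforce
    have "v \<noteq> 0" using that y by auto
    then show ?thesis using posG[of x v] that y r(2) by auto
  qed
  have bd: "(\<lambda>(x, v). ?G x v) z * norm v \<le> ?G x v \<and> ?G x v \<le> (\<lambda>(x, v). ?G x v) w * norm v"
    if x: "x \<in> cball (snd c q) r" for x v
  proof (cases "v = 0")
    case True
    then show ?thesis using speed_chart_scaleR[OF c(1), of x 0 0] x r(2) by auto
  next
    case False
    let ?u = "v /\<^sub>R norm v"
    have "?G x v = norm v * ?G x ?u"
      using speed_chart_scaleR[OF c(1), of x "norm v" ?u] x r(2) False by auto
    moreover have "(x, ?u) \<in> ?K" using x False by simp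
    ultimately show ?thesis
      using z(2)[of "(x, ?u)"] w(2)[of "(x, ?u)"] mult_left_mono[OF _ norm_ge_zero[of v]]
      by (metis (no_types, lifting) case_prod_conv mult.commute)
  qed
  show ?thesis
    by (rule that[OF r(1) on_K[OF z(1)] on_K[OF w(1)] r(2)]) (use bd in blast)+
qed

text \<open>The infimum in \<open>finsler_dist\<close> runs over the L of this relation. It hides
  the parameter intervals, so that concatenation of curves becomes addition of lengths.\<close>

definition curve_between :: "'s \<Rightarrow> 's \<Rightarrow> real \<Rightarrow> bool" where
  "curve_between p q L \<longleftrightarrow>
    (\<exists>\<gamma> a b. a < b \<and> piecewise_smooth_curve A \<gamma> a b \<and> \<gamma> a = p \<and> \<gamma> b = q \<and> len \<gamma> a b = L)"

lemma finsler_dist_eq: "d p q = Inf {L. curve_between p q L}"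
  unfolding finsler_dist_def curve_between_def by (rule arg_cong[where f = Inf]) blast

lemma curve_between_nonneg: "curve_between p q L \<Longrightarrow> L \<ge> 0"
  unfolding curve_between_def using len_nonneg by blast

lemma curve_between_trans:
  assumes "curve_between p q L" "curve_between q r L'"
  shows "curve_between p r (L + L')"
proof -
  obtain \<gamma> a b where \<gamma>: "a < b" "piecewise_smooth_curve A \<gamma> a b" "\<gamma> a = p" "\<gamma> b = q" "len \<gamma> a b = L"
    using assms(1) unfolding curve_between_def by blast
  obtain \<delta> a' b' where \<delta>: "a' < b'" "piecewise_smooth_curve A \<delta> a' b'" "\<delta> a' = q" "\<delta> b' = r" "len \<delta> a' b' = L'"
    using assms(2) unfolding curve_between_def by blast
  define c where "c = b + (b' - a')"
  \<comment> \<open>The second curve is shifted to start at b; the shift is written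
    \<open>1 * s + (a' - b)\<close> to match \<open>len_compose_affine\<close>.\<close>
  define \<eta> where "\<eta> = (\<lambda>s. if s \<le> b then \<gamma> s else \<delta> (1 * s + (a' - b)))"
  have bc: "b < c" using \<delta>(1) by (simp add: c_def)
  have tr: "piecewise_smooth_curve A (\<lambda>s. \<delta> (1 * s + (a' - b))) b c"
    "len (\<lambda>s. \<delta> (1 * s + (a' - b))) b c = L'"
    using len_compose_affine[OF \<delta>(2,1), of 1 "a' - b"] \<delta>(5) by (simp_all add: c_def algebra_simps)
  have 1: "piecewise_smooth_curve A \<eta> a b" "len \<eta> a b = L"
    using piecewise_smooth_cong[OF \<gamma>(2), of \<eta>] \<gamma>(5) by (auto simp: \<eta>_def)
  have "\<delta> (1 * s + (a' - b)) = \<eta> s" if "s \<in> {b..c}" for s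
    using that \<gamma>(4) \<delta>(3) by (cases "s = b") (auto simp: \<eta>_def)
  then have 2: "piecewise_smooth_curve A \<eta> b c" "len \<eta> b c = L'"
    using piecewise_smooth_cong[OF tr(1), of \<eta>] tr(2) by auto
  have "\<eta> a = p" "\<eta> c = r" using \<gamma> \<delta> bc by (auto simp: \<eta>_def c_def)
  then show ?thesis
    unfolding curve_between_def
    using len_join[OF 1(1) 2(1) \<gamma>(1) bc] 1(2) 2(2) \<gamma>(1) bc by (intro exI[of _ \<eta>] exI[of _ a] exI[of _ c]) auto
qed

lemma chart_segment_len:
  assumes c: "c \<in> A" and seg: "closed_segment x y \<subseteq> snd c ` fst c"
    and M: "\<And>z v. z \<in> closed_segment x y \<Longrightarrow>
       F (chart_inv c z) (coord_vector A (chart_inv c z) c v) \<le> M * norm v"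
  shows "\<exists>L \<le> M * norm (y - x). curve_between (chart_inv c x) (chart_inv c y) L"
proof -
  define \<gamma> where "\<gamma> = (\<lambda>s. chart_inv c (x + s *\<^sub>R (y - x)))"
  note cs = chart_segment[OF c seg, folded \<gamma>_def]
  have ps: "piecewise_smooth_curve A \<gamma> 0 1"
    using cs(1) by (simp add: piecewise_smooth_curve_def piecewise_on_single)
  have "len \<gamma> 0 1 \<le> M * norm (y - x)"
  proof (rule has_integral_le[OF speed_has_integral[OF ps]])
    show "((\<lambda>s. M * norm (y - x)) has_integral M * norm (y - x)) {0..1::real}"
      using has_integral_const_real[of "M * norm (y - x)" 0 1] by simp
    fix s :: real assume s: "s \<in> {0..1}"
    have "x + s *\<^sub>R (y - x) = (1 - s) *\<^sub>R x + s *\<^sub>R y" by (simp add: algebra_simps)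
    then have "x + s *\<^sub>R (y - x) \<in> closed_segment x y"
      using s unfolding closed_segment_def by auto
    moreover have "\<gamma> s \<in> fst c" "snd c (\<gamma> s) = x + s *\<^sub>R (y - x)" using cs(3)[OF s] by (auto simp: \<gamma>_def)
    ultimately show "F (\<gamma> s) (velocity A \<gamma> {0..1} s) \<le> M * norm (y - x)"
      unfolding speed_in_chart[OF cs(1) zero_less_one s c \<open>\<gamma> s \<in> fst c\<close>] cs(2)[OF s] using M by simp
  qed simp
  then show ?thesis
    unfolding curve_between_def using ps
    by (intro exI[of _ "len \<gamma> 0 1"] conjI exI[of _ \<gamma>] exI[of _ 0] exI[of _ 1]) (auto simp: \<gamma>_def)
qed

text \<open>Coordinate segments to and from the centre stay in the convex closed ball, where M
  bounds the speed. Both directions are recorded, since F may weigh them differently.\<close>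

lemma local_curves:
  obtains c r M where "c \<in> A" "q \<in> fst c" "r > 0" "M > 0"
    "\<And>p. p \<in> chart_ball c q r \<Longrightarrow> \<exists>L \<le> M * dist (snd c p) (snd c q). curve_between p q L"
    "\<And>p. p \<in> chart_ball c q r \<Longrightarrow> \<exists>L \<le> M * dist (snd c p) (snd c q). curve_between q p L"
proof -
  obtain c where c: "c \<in> A" "q \<in> fst c" using chart_around by blast
  obtain r m M where r: "r > 0" "m > 0" "M > 0" "cball (snd c q) r \<subseteq> snd c ` fst c"
    "\<And>x v. x \<in> cball (snd c q) r \<Longrightarrow>
       m * norm v \<le> F (chart_inv c x) (coord_vector A (chart_inv c x) c v)"
    "\<And>x v. x \<in> cball (snd c q) r \<Longrightarrow>
       F (chart_inv c x) (coord_vector A (chart_inv c x) c v) \<le> M * norm v"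
    using local_bounds[OF c] by metis
  have *: "\<exists>L \<le> M * norm (y - x). curve_between (chart_inv c x) (chart_inv c y) L"
    if "x \<in> cball (snd c q) r" "y \<in> cball (snd c q) r" for x y
  proof (rule chart_segment_len[OF c(1)])
    have "closed_segment x y \<subseteq> cball (snd c q) r"
      using that by (intro closed_segment_subset convex_cball)
    then show "closed_segment x y \<subseteq> snd c ` fst c"
      and "\<And>z v. z \<in> closed_segment x y \<Longrightarrow>
       F (chart_inv c z) (coord_vector A (chart_inv c z) c v) \<le> M * norm v"
      using r(4,6) by blast+
  qed
  have p: "p \<in> fst c \<and> snd c p \<in> cball (snd c q) r" if "p \<in> chart_ball c q r" for p
    using that unfolding chart_ball_def by auto
  show ?thesis
  proof (rule that[OF c r(1,3)])
    fix p assume "p \<in> chart_ball c q r"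
    note p = p[OF this]
    have q: "snd c q \<in> cball (snd c q) r" using r(1) by simp
    show "\<exists>L \<le> M * dist (snd c p) (snd c q). curve_between p q L"
      using *[of "snd c p" "snd c q"] p q c by (simp add: dist_norm norm_minus_commute)
    show "\<exists>L \<le> M * dist (snd c p) (snd c q). curve_between q p L"
      using *[of "snd c q" "snd c p"] p q c by (simp add: dist_norm)
  qed
qed

text \<open>Without a curve from p to q, the \<open>Inf\<close> in \<open>d p q\<close> would be
  taken over the empty set and carry no information. By \<open>local_curves\<close>, every point can
  be joined in both directions with all points near it, and connectedness spreads this over the
  manifold. Asking for both directions makes the relation symmetric at once.\<close>

lemma curve_exists: "\<exists>L. curve_between p q L"
proof -
  define R where "R p q \<longleftrightarrow> (\<exists>L. curve_between p q L) \<and> (\<exists>L. curve_between q p L)" for p q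
  have "R p q"
  proof (rule connected_equivalence_relation[OF connected_manifold])
    show "R y x" if "R x y" for x y using that unfolding R_def by blast
    show "R x z" if "R x y" "R y z" for x y z
      using that curve_between_trans unfolding R_def by blast
    show "\<exists>T. openin (top_of_set UNIV) T \<and> x \<in> T \<and> (\<forall>y\<in>T. R x y)" for x
    proof -
      obtain c r M where c: "c \<in> A" "x \<in> fst c" "r > 0" "M > 0"
        "\<And>p. p \<in> chart_ball c x r \<Longrightarrow> \<exists>L \<le> M * dist (snd c p) (snd c x). curve_between p x L"
        "\<And>p. p \<in> chart_ball c x r \<Longrightarrow> \<exists>L \<le> M * dist (snd c p) (snd c x). curve_between x p L"
        using local_curves[of x] by metis
      show ?thesis
        using open_chart_ball[OF c(1)] centre_in_chart_ball[OF c(2,3)] c(5,6)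
        unfolding R_def by (intro exI[of _ "chart_ball c x r"]) (auto, blast+)
    qed
  qed auto
  then show ?thesis unfolding R_def by blast
qed

lemma dist_le_curve: "curve_between p q L \<Longrightarrow> d p q \<le> L"
  unfolding finsler_dist_eq
  by (rule cInf_lower) (auto intro!: bdd_belowI[of _ 0] curve_between_nonneg)

lemma curve_of_dist_less: "d p q < \<epsilon> \<Longrightarrow> \<exists>L<\<epsilon>. curve_between p q L"
  unfolding finsler_dist_eq using cInf_lessD[of "{L. curve_between p q L}" \<epsilon>] curve_exists by auto

lemma finsler_dist_nonneg: "d p q \<ge> 0"
  using curve_of_dist_less[of p q 0] curve_between_nonneg by force

lemma finsler_dist_triangle: "d p r \<le> d p q + d q r"
proof (rule field_le_epsilon)
  fix \<epsilon> :: real assume "\<epsilon> > 0"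
  then obtain L L' where "L < d p q + \<epsilon> / 2" "curve_between p q L" "L' < d q r + \<epsilon> / 2" "curve_between q r L'"
    using curve_of_dist_less[of p q "d p q + \<epsilon> / 2"] curve_of_dist_less[of q r "d q r + \<epsilon> / 2"] by auto
  then show "d p r \<le> d p q + d q r + \<epsilon>"
    using dist_le_curve[OF curve_between_trans] by fastforce
qed

text \<open>Near q a coordinate segment has length at most M times the Euclidean distance. Applied
  to a constant sequence, the lemma also yields \<open>d q q = 0\<close>.\<close>

lemma tendsto_finsler_dist:
  assumes "(x \<longlongrightarrow> q) G"
  shows "((\<lambda>n. d (x n) q) \<longlongrightarrow> 0) G"
proof (rule order_tendstoI)
  fix \<epsilon> :: real assume "0 < \<epsilon>"
  obtain c r M where c: "c \<in> A" "q \<in> fst c" "r > 0" "M > 0"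
    "\<And>p. p \<in> chart_ball c q r \<Longrightarrow> \<exists>L \<le> M * dist (snd c p) (snd c q). curve_between p q L"
    using local_curves[of q] by metis
  define \<rho> where "\<rho> = min r (\<epsilon> / M)"
  have "\<rho> > 0" using c \<open>0 < \<epsilon>\<close> by (simp add: \<rho>_def)
  then have "\<forall>\<^sub>F n in G. x n \<in> chart_ball c q \<rho>"
    using assms open_chart_ball[OF c(1)] centre_in_chart_ball[OF c(2)] unfolding tendsto_def by blast
  then show "\<forall>\<^sub>F n in G. d (x n) q < \<epsilon>"
  proof eventually_elim
    case (elim n)
    then have "dist (snd c (x n)) (snd c q) < \<epsilon> / M" "x n \<in> chart_ball c q r"
      unfolding chart_ball_def \<rho>_def by (auto simp: dist_commute)
    then show ?case
      using c(5)[of "x n"] dist_le_curve[of "x n" q] c(4) by (fastforce simp: field_simps)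
  qed
next
  fix \<epsilon> :: real assume "\<epsilon> < 0"
  then have "\<epsilon> < d (x n) q" for n using finsler_dist_nonneg[of "x n" q] by linarith
  then show "\<forall>\<^sub>F n in G. \<epsilon> < d (x n) q" by simp
qed

text \<open>A curve from outside the coordinate ball to its centre has to cover the coordinate
  distance \<rho>, and F is at least m times the Euclidean speed. The estimate is made after the
  last parameter s0 outside the ball, where the curve lies in the domain of c.\<close>

lemma exit_length:
  assumes c: "c \<in> A" "q \<in> fst c" and \<rho>: "\<rho> > 0" "cball (snd c q) \<rho> \<subseteq> snd c ` fst c"
    and m: "m > 0" "\<And>x v. x \<in> cball (snd c q) \<rho> \<Longrightarrow>
       m * norm v \<le> F (chart_inv c x) (coord_vector A (chart_inv c x) c v)"
    and \<gamma>: "piecewise_smooth_curve A \<gamma> a b" "a < b" "\<gamma> b = q" "\<gamma> a \<notin> chart_ball c q \<rho>"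
  shows "m * \<rho> \<le> len \<gamma> a b"
proof -
  \<comment> \<open>The closed coordinate ball, moved to the manifold. Being compact, it is closed
    in the Hausdorff space, while the chart domain need not be.\<close>
  define K where "K = chart_inv c ` cball (snd c q) \<rho>"
  have "compact K"
    unfolding K_def
    by (intro compact_continuous_image continuous_on_subset[OF continuous_on_chart_inv[OF c(1)]] \<rho>) auto
  then have "closed K" by (rule compact_imp_closed)
  have BK: "chart_ball c q \<rho> \<subseteq> K"
  proof
    fix p assume "p \<in> chart_ball c q \<rho>"
    then have "p \<in> fst c" "snd c p \<in> cball (snd c q) \<rho>" unfolding chart_ball_def by auto
    then show "p \<in> K" unfolding K_def using chart_inv_chart[OF c(1)] by (metis imageI)
  qed
  have K: "p \<in> fst c \<and> snd c p \<in> cball (snd c q) \<rho>" if "p \<in> K" for p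
    using that \<rho>(2) chart_inv_in_domain[OF c(1)] chart_chart_inv[OF c(1)] unfolding K_def by auto
  have cont: "continuous_on {a..b} \<gamma>" by (rule piecewise_smooth_imp_continuous_on[OF \<gamma>(1,2)])
  define N where "N = {a..b} \<inter> \<gamma> -` (- chart_ball c q \<rho>)"
  have "closed N"
    unfolding N_def by (intro continuous_closed_preimage[OF cont] closed_Compl open_chart_ball c) simp
  moreover have "a \<in> N" using \<gamma>(2,4) unfolding N_def by simp
  ultimately have N: "closed N" "N \<noteq> {}" "bdd_above N"
    unfolding N_def by auto
  define s0 where "s0 = Sup N"
  have "s0 \<in> N" unfolding s0_def using N by (intro closed_contains_Sup)
  then have s0: "a \<le> s0" "s0 \<le> b" "\<gamma> s0 \<notin> chart_ball c q \<rho>" unfolding N_def by auto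
  have "s0 \<noteq> b" using s0(3) \<gamma>(3) centre_in_chart_ball[OF c(2) \<rho>(1)] by auto
  then have sb: "s0 < b" using s0 by simp
  have after: "\<gamma> s \<in> K" if "s0 < s" "s \<le> b" for s
  proof -
    have "s \<notin> N" using that cSup_upper[OF _ N(3)] unfolding s0_def by fastforce
    then show ?thesis using BK that s0 unfolding N_def by auto
  qed
  have "closed ({s0..b} \<inter> \<gamma> -` K)"
    by (rule continuous_closed_preimage[OF continuous_on_subset[OF cont] _ \<open>closed K\<close>]) (use s0 in auto)
  \<comment> \<open>\<open>\<gamma> s0\<close> lies outside the open ball, but as a limit of later
    points it still lies in the closed set K, so coordinates are available on all of
    \<open>{s0..b}\<close>.\<close>
  then have "closure {s0<..b} \<subseteq> {s0..b} \<inter> \<gamma> -` K"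
    using after by (intro closure_minimal) auto
  then have inK: "\<gamma> s \<in> K" if "s \<in> {s0..b}" for s using sb that by auto
  define \<psi> where "\<psi> = snd c \<circ> \<gamma>"
  have cont\<psi>: "continuous_on {s0..b} \<psi>"
    unfolding \<psi>_def
  proof (rule continuous_on_compose)
    show "continuous_on {s0..b} \<gamma>" by (rule continuous_on_subset[OF cont]) (use s0 in auto)
    show "continuous_on (\<gamma> ` {s0..b}) (snd c)"
      by (rule continuous_on_subset[OF continuous_on_chart[OF c(1)]]) (use inK K in blast)
  qed
  have ps: "piecewise_smooth_curve A \<gamma> s0 b"
    using piecewise_smooth_restrict[OF \<gamma>(1)] s0 sb by blast
  obtain P where P: "finite P" "P \<subseteq> {s0..b}"
    "\<And>s. s \<in> {s0..b} - P \<Longrightarrow> \<exists>u v. s0 \<le> u \<and> u < s \<and> s < v \<and> v \<le> b \<and> smooth_curve_on A \<gamma> {u..v}"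
    using piecewise_on_finite_exceptions[OF ps[unfolded piecewise_smooth_curve_def] sb] by metis
  \<comment> \<open>At the finitely many exceptional parameters f' and g are set to 0, so that the
    pointwise bound holds everywhere while the integrals are unchanged.\<close>
  define f' where "f' s = (if s \<in> P then 0 else velocity A \<gamma> {s0..b} s c)" for s
  define g where "g s = (if s \<in> P then 0 else F (\<gamma> s) (velocity A \<gamma> {s0..b} s))" for s
  have key: "(\<psi> has_vector_derivative f' s) (at s) \<and> m * norm (f' s) \<le> g s" if s: "s \<in> {s0..b} - P" for s
  proof -
    obtain u v where uv: "s0 \<le> u" "u < s" "s < v" "v \<le> b" "smooth_curve_on A \<gamma> {u..v}"
      using P(3)[OF s] by blast
    have vel: "velocity A \<gamma> {s0..b} s = velocity A \<gamma> {u..v} s"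
      by (rule velocity_interior[OF uv(2,3,1,4)])
    have gs: "\<gamma> s \<in> fst c" "snd c (\<gamma> s) \<in> cball (snd c q) \<rho>" using K inK s by blast+
    have uv': "u < v" "s \<in> {u..v}" using uv by auto
    have "(\<psi> has_vector_derivative velocity A \<gamma> {u..v} s c) (at s within {u..v})"
      unfolding \<psi>_def using velocity_has_vector_derivative(1)[OF uv(5) uv' c(1) gs(1)] .
    moreover have "at s within {u..v} = at s" by (rule at_within_interior) (use uv in auto)
    moreover have "m * norm (velocity A \<gamma> {u..v} s c) \<le> F (\<gamma> s) (velocity A \<gamma> {u..v} s)"
      using m(2)[OF gs(2)] speed_in_chart[OF uv(5) uv' c(1) gs(1)] by simp
    ultimately show ?thesis using vel s unfolding f'_def g_def by simp
  qed
  have If: "(f' has_integral (\<psi> b - \<psi> s0)) {s0..b}"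
    by (rule fundamental_theorem_of_calculus_interior_strong[OF P(1)]) (use key cont\<psi> sb in auto)
  have Ig: "(g has_integral len \<gamma> s0 b) {s0..b}"
    by (rule has_integral_spike_finite[OF P(1) _ speed_has_integral[OF ps sb]]) (simp add: g_def)
  have "norm (integral {s0..b} (\<lambda>s. m *\<^sub>R f' s)) \<le> integral {s0..b} g"
  proof (rule integral_norm_bound_integral)
    show "(\<lambda>s. m *\<^sub>R f' s) integrable_on {s0..b}" using If by (intro integrable_cmul) blast
    show "g integrable_on {s0..b}" using Ig by blast
    show "norm (m *\<^sub>R f' s) \<le> g s" if "s \<in> {s0..b}" for s
      using key[of s] that m(1) by (cases "s \<in> P") (auto simp: f'_def g_def)
  qed
  then have "m * norm (\<psi> b - \<psi> s0) \<le> len \<gamma> s0 b"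
    using If Ig m(1) by (simp add: integral_unique)
  moreover have "\<rho> \<le> norm (\<psi> b - \<psi> s0)"
    using s0(3) K[OF inK, of s0] sb \<gamma>(3) unfolding chart_ball_def \<psi>_def by (auto simp: dist_norm)
  then have "m * \<rho> \<le> m * norm (\<psi> b - \<psi> s0)" using m(1) by simp
  ultimately show ?thesis using len_restrict[OF \<gamma>(1), of s0 b] s0 sb by simp
qed

text \<open>By \<open>exit_length\<close>, a curve of length below m \<rho> that ends at q must
  start in the coordinate ball of radius \<rho>. Hence a small distance towards q forces a point
  into any given neighbourhood of q.\<close>

lemma finsler_dist_neighbourhood:
  assumes "open W" "q \<in> W"
  obtains \<delta> where "\<delta> > 0" "\<And>p. d p q < \<delta> \<Longrightarrow> p \<in> W"
proof -
  obtain c where c: "c \<in> A" "q \<in> fst c" using chart_around by blast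
  obtain r m where r: "r > 0" "m > 0" "cball (snd c q) r \<subseteq> snd c ` fst c"
    "\<And>x v. x \<in> cball (snd c q) r \<Longrightarrow>
       m * norm v \<le> F (chart_inv c x) (coord_vector A (chart_inv c x) c v)"
    by (rule local_bounds[OF c]) (rule that, assumption+)
  obtain \<rho>' where \<rho>': "\<rho>' > 0" "chart_ball c q \<rho>' \<subseteq> W"
    using chart_ball_subset_open[OF c assms] by blast
  define \<rho> where "\<rho> = min r \<rho>'"
  have \<rho>: "\<rho> > 0" "cball (snd c q) \<rho> \<subseteq> cball (snd c q) r" using r(1) \<rho>'(1) by (auto simp: \<rho>_def)
  have "p \<in> W" if near: "d p q < m * \<rho>" for p
  proof -
    obtain L where "L < m * \<rho>" "curve_between p q L" using curve_of_dist_less[OF near] by blast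
    then obtain \<gamma> a b where g: "a < b" "piecewise_smooth_curve A \<gamma> a b" "\<gamma> a = p" "\<gamma> b = q" "len \<gamma> a b < m * \<rho>"
      unfolding curve_between_def by blast
    have "p \<in> chart_ball c q \<rho>"
    proof (rule ccontr)
      assume "p \<notin> chart_ball c q \<rho>"
      then have "m * \<rho> \<le> len \<gamma> a b"
        using \<rho>(2) r(3) by (intro exit_length[OF c \<rho>(1) _ r(2) r(4) g(2,1,4)]) (auto simp: g(3))
      then show False using g(5) by simp
    qed
    then show ?thesis using \<rho>'(2) unfolding chart_ball_def \<rho>_def by auto
  qed
  then show ?thesis using that[of "m * \<rho>"] r(2) \<rho>(1) by simp
qed

lemma tendsto_of_finsler_dist:
  assumes "((\<lambda>n. d (x n) q) \<longlongrightarrow> 0) G"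
  shows "(x \<longlongrightarrow> q) G"
proof (rule topological_tendstoI)
  fix W assume "open W" "q \<in> W"
  then obtain \<delta> where \<delta>: "\<delta> > 0" "\<And>p. d p q < \<delta> \<Longrightarrow> p \<in> W"
    using finsler_dist_neighbourhood by blast
  have "\<forall>\<^sub>F n in G. d (x n) q < \<delta>" using order_tendstoD(2)[OF assms \<delta>(1)] .
  then show "\<forall>\<^sub>F n in G. x n \<in> W" by eventually_elim (rule \<delta>(2))
qed

end

subsection \<open>Curves faster than their length\<close>

lemma higher_differentiable_on_affine_image:
  fixes f :: "'a::real_normed_vector \<Rightarrow> real"
  shows "higher_differentiable_on n U f \<Longrightarrow> open U \<Longrightarrow> higher_differentiable_on n U (\<lambda>x. a * f x + e)"
proof (induction n arbitrary: f e)
  case 0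
  then show ?case by (auto intro!: continuous_intros)
next
  case (Suc n)
  have der: "((\<lambda>x. a * f x + e) has_derivative (\<lambda>v. a * frechet_derivative f (at x) v)) (at x)" if "x \<in> U" for x
  proof -
    have "(f has_derivative frechet_derivative f (at x)) (at x)"
      using Suc.prems that by (auto simp: frechet_derivative_works)
    then show ?thesis by (auto intro!: derivative_eq_intros)
  qed
  have "higher_differentiable_on n U (\<lambda>x. frechet_derivative (\<lambda>x. a * f x + e) (at x) v)" for v
  proof (rule higher_differentiable_on_cong[OF Suc.prems(2)])
    \<comment> \<open>The summand 0 brings the derivative into the form of the induction hypothesis
      with e = 0.\<close>
    show "higher_differentiable_on n U (\<lambda>x. a * frechet_derivative f (at x) v + 0)"
      using Suc.prems by (intro Suc.IH) auto
    show "a * frechet_derivative f (at x) v + 0 = frechet_derivative (\<lambda>x. a * f x + e) (at x) v" if "x \<in> U" for x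
      using frechet_derivative_at[OF der[OF that]] by (metis add.right_neutral)
  qed
  then show ?case using der by (auto simp: differentiable_def)
qed

lemma smooth_on_affine_image:
  fixes f :: "'a::real_normed_vector \<Rightarrow> real"
  assumes "smooth_on K f"
  shows "smooth_on K (\<lambda>x. a * f x + e)"
proof -
  obtain U g where *: "open U" "K \<subseteq> U" "\<forall>n. higher_differentiable_on n U g" "\<forall>x\<in>K. g x = f x"
    using assms unfolding smooth_on_def by blast
  then show ?thesis
    unfolding smooth_on_def
    by (intro exI[of _ U] exI[of _ "\<lambda>x. a * g x + e"]) (auto intro: higher_differentiable_on_affine_image)
qed

lemma smooth_on_vector_derivative_within:
  fixes T :: "real \<Rightarrow> real"
  assumes "smooth_on {u..v} T" "u < v" "s \<in> {u..v}"
  shows "(T has_vector_derivative vector_derivative T (at s within {u..v})) (at s within {u..v})"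
proof -
  obtain T' where "\<And>s. s \<in> {u..v} \<Longrightarrow> (T has_vector_derivative T' s) (at s within {u..v})"
    using smooth_on_vector_derivative[OF assms(1)] by metis
  then show ?thesis
    using vector_derivative_within_closed_interval[OF assms(2,3)] assms(3) by metis
qed

text \<open>For the Fermat metric, this is the projection to \<open>\<real>\<close> and \<open>S\<close> of a smooth future-directed
  timelike curve.\<close>

definition faster_than ::
  "('s, 'e::euclidean_space) chart set \<Rightarrow> ('s \<Rightarrow> ('s, 'e) tangent \<Rightarrow> real) \<Rightarrow>
   (real \<Rightarrow> real) \<Rightarrow> (real \<Rightarrow> 's) \<Rightarrow> real set \<Rightarrow> bool" where
  "faster_than A F T \<gamma> K \<longleftrightarrow> smooth_on K T \<and> smooth_curve_on A \<gamma> K \<and>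
     (\<forall>s\<in>K. F (\<gamma> s) (velocity A \<gamma> K s) < vector_derivative T (at s within K))"

context finsler_manifold
begin

abbreviation "rises \<equiv> faster_than A F"

lemma rises_restrict:
  assumes "rises T \<gamma> {u..v}" "u \<le> u'" "u' < v'" "v' \<le> v"
  shows "rises T \<gamma> {u'..v'}"
  unfolding faster_than_def
proof (intro conjI ballI)
  note T = assms(1)[unfolded faster_than_def]
  have sub: "{u'..v'} \<subseteq> {u..v}" using assms by auto
  then show "smooth_on {u'..v'} T" "smooth_curve_on A \<gamma> {u'..v'}"
    using T smooth_on_subset smooth_curve_on_subset by blast+
  fix s assume s: "s \<in> {u'..v'}"
  have uv: "u < v" "s \<in> {u..v}" using assms s by auto
  have "(T has_vector_derivative vector_derivative T (at s within {u..v})) (at s within {u'..v'})"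
    using smooth_on_vector_derivative_within[OF _ uv] T has_vector_derivative_within_subset[OF _ sub] by blast
  then have "vector_derivative T (at s within {u'..v'}) = vector_derivative T (at s within {u..v})"
    using vector_derivative_within_closed_interval[OF assms(3) s] by blast
  then show "F (\<gamma> s) (velocity A \<gamma> {u'..v'} s) < vector_derivative T (at s within {u'..v'})"
    using T uv velocity_restrict[of \<gamma> u v u' v' s] assms s by simp
qed

lemma rises_cong:
  assumes "rises T \<gamma> {u..v}" "u < v" "\<And>s. s \<in> {u..v} \<Longrightarrow> T s = T' s" "\<And>s. s \<in> {u..v} \<Longrightarrow> \<gamma> s = \<gamma>' s"
  shows "rises T' \<gamma>' {u..v}"
  unfolding faster_than_def
proof (intro conjI ballI)
  note T = assms(1)[unfolded faster_than_def]
  show "smooth_on {u..v} T'" using T smooth_on_cong[of "{u..v}" T T'] assms(3) by blast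
  show "smooth_curve_on A \<gamma>' {u..v}" using T smooth_curve_on_cong[of "{u..v}" \<gamma> \<gamma>'] assms(4) by blast
  fix s assume s: "s \<in> {u..v}"
  have "(T has_vector_derivative vector_derivative T (at s within {u..v})) (at s within {u..v})"
    using smooth_on_vector_derivative_within T assms(2) s by blast
  then have "(T' has_vector_derivative vector_derivative T (at s within {u..v})) (at s within {u..v})"
    using has_vector_derivative_cong_on[of "{u..v}" T T'] assms(3) s by blast
  then have "vector_derivative T' (at s within {u..v}) = vector_derivative T (at s within {u..v})"
    using vector_derivative_within_closed_interval[OF assms(2) s] by blast
  moreover have "velocity A \<gamma>' {u..v} s = velocity A \<gamma> {u..v} s" "\<gamma>' s = \<gamma> s"
    using velocity_cong[of "{u..v}" \<gamma> \<gamma>' s A] assms(4) s by simp_all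
  ultimately show "F (\<gamma>' s) (velocity A \<gamma>' {u..v} s) < vector_derivative T' (at s within {u..v})"
    using T s by simp
qed

text \<open>Speed and time derivative are both multiplied by k > 0, so the strict inequality is
  kept; a shift e of time leaves the derivative unchanged.\<close>

lemma rises_compose_affine:
  assumes "rises T \<gamma> {u..v}" "u < v" "k > 0"
  shows "rises (\<lambda>s. T (k * s + l) + e) (\<lambda>s. \<gamma> (k * s + l)) {(u - l) / k..(v - l) / k}"
  unfolding faster_than_def
proof (intro conjI ballI)
  let ?K = "{(u - l) / k..(v - l) / k}"
  note T = assms(1)[unfolded faster_than_def]
  have vim: "(\<lambda>s. k * s + l) -` {u..v} = ?K" by (rule affine_vimage_Icc(1)[OF assms(3)])
  have lt: "(u - l) / k < (v - l) / k" using assms by (simp add: divide_strict_right_mono)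
  show "smooth_on ?K (\<lambda>s. T (k * s + l) + e)"
    using smooth_on_affine_image[OF smooth_on_compose_affine[of "{u..v}" T k l], of 1 e] T vim by simp
  show "smooth_curve_on A (\<lambda>s. \<gamma> (k * s + l)) ?K"
    using smooth_curve_on_compose_affine[of \<gamma> "{u..v}" k l] T vim by simp
  fix s assume s: "s \<in> ?K"
  then have hs: "k * s + l \<in> {u..v}" using vim by blast
  let ?T' = "vector_derivative T (at (k * s + l) within {u..v})"
  have "(T has_vector_derivative ?T') (at (k * s + l) within {u..v})"
    using smooth_on_vector_derivative_within T assms(2) hs by blast
  then have "(T has_vector_derivative ?T') (at (k * s + l) within (\<lambda>s. k * s + l) ` ?K)"
    by (rule has_vector_derivative_within_subset) (use vim in auto)
  moreover have "((\<lambda>s. k * s + l) has_vector_derivative k) (at s within ?K)"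
    by (auto intro!: derivative_eq_intros)
  ultimately have "(T \<circ> (\<lambda>s. k * s + l) has_vector_derivative k *\<^sub>R ?T') (at s within ?K)"
    by (rule vector_diff_chain_within[rotated])
  then have "((\<lambda>s. T (k * s + l) + e) has_vector_derivative k *\<^sub>R ?T' + 0) (at s within ?K)"
    unfolding o_def by (intro has_vector_derivative_add has_vector_derivative_const)
  then have T': "vector_derivative (\<lambda>s. T (k * s + l) + e) (at s within ?K) = k * ?T'"
    using vector_derivative_within_closed_interval[OF lt s] by simp
  have "F (\<gamma> (k * s + l)) (velocity A (\<lambda>s. \<gamma> (k * s + l)) ?K s)
      = k * F (\<gamma> (k * s + l)) (velocity A \<gamma> {u..v} (k * s + l))"
    unfolding velocity_compose_affine[OF conjunct1[OF conjunct2[OF T]] assms(2) vim lt s]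
    using homogeneous[OF velocity_in_tangent_space[OF _ assms(2) hs], of \<gamma> k] T assms(3) by simp
  also have "\<dots> < k * ?T'" using T hs assms(3) by simp
  finally show "F (\<gamma> (k * s + l)) (velocity A (\<lambda>s. \<gamma> (k * s + l)) ?K s)
      < vector_derivative (\<lambda>s. T (k * s + l) + e) (at s within ?K)"
    unfolding T' .
qed

lemma piecewise_rises_compose_affine:
  assumes "piecewise_on (rises T \<gamma>) a b" "a < b" "k > 0"
  shows "piecewise_on (rises (\<lambda>s. T (k * s + l) + e) (\<lambda>s. \<gamma> (k * s + l))) ((a - l) / k) ((b - l) / k)"
  using assms(1,2)
proof (induction rule: piecewise_on_induct)
  case (piece u v)
  then show ?case
    using rises_compose_affine[of T \<gamma> u v k l e] assms(3)
    by (intro piecewise_on_single) (auto simp: divide_strict_right_mono)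
next
  case (join u v w)
  show ?case by (rule piecewise_on_join[OF join(3,4)])
qed

lemma piecewise_rises_cong:
  assumes "piecewise_on (rises T \<gamma>) a b" "\<And>s. s \<in> {a..b} \<Longrightarrow> T s = T' s" "\<And>s. s \<in> {a..b} \<Longrightarrow> \<gamma> s = \<gamma>' s"
  shows "piecewise_on (rises T' \<gamma>') a b"
proof (rule piecewise_on_mono[OF assms(1)])
  fix u v assume "a \<le> u" "u < v" "v \<le> b" "rises T \<gamma> {u..v}"
  then show "rises T' \<gamma>' {u..v}"
    using rises_cong[of T \<gamma> u v T' \<gamma>'] assms(2,3) by simp
qed

lemma piecewise_rises_restrict:
  assumes "piecewise_on (rises T \<gamma>) a b" "a \<le> u" "u < v" "v \<le> b"
  shows "piecewise_on (rises T \<gamma>) u v"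
  by (rule piecewise_on_restrict[OF assms(1)]) (use assms rises_restrict in auto)

text \<open>Integrating the inequality between speed and T' bounds the length by the gain of T; T
  increases strictly because its derivative exceeds a nonnegative speed.\<close>

lemma rises_dist:
  assumes "rises T \<gamma> {u..v}" "u < v"
  shows "d (\<gamma> u) (\<gamma> v) \<le> T v - T u" "T u < T v" "continuous_on {u..v} T"
proof -
  note T = assms(1)[unfolded faster_than_def]
  let ?T' = "\<lambda>s. vector_derivative T (at s within {u..v})"
  have T': "(T has_vector_derivative ?T' s) (at s within {u..v})" if "s \<in> {u..v}" for s
    using smooth_on_vector_derivative_within T assms(2) that by blast
  have ps: "piecewise_smooth_curve A \<gamma> u v"
    using T assms(2) by (simp add: piecewise_smooth_curve_def piecewise_on_single)
  show cont: "continuous_on {u..v} T" using T smooth_on_imp_continuous_on by blast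
  have "(?T' has_integral (T v - T u)) {u..v}"
    by (rule fundamental_theorem_of_calculus) (use T' assms in auto)
  then have "len \<gamma> u v \<le> T v - T u"
    by (rule has_integral_le[OF speed_has_integral[OF ps assms(2)]]) (use T in \<open>auto intro: less_imp_le\<close>)
  moreover have "d (\<gamma> u) (\<gamma> v) \<le> len \<gamma> u v"
    using ps assms(2) by (intro dist_le_curve) (auto simp: curve_between_def)
  ultimately show "d (\<gamma> u) (\<gamma> v) \<le> T v - T u" by simp
  show "T u < T v"
  proof (rule DERIV_pos_imp_increasing_open[OF assms(2) _ cont])
    fix s assume s: "u < s" "s < v"
    then have "at s within {u..v} = at s" by (intro at_within_interior) auto
    then have "(T has_real_derivative ?T' s) (at s)"
      using T'[of s] s by (simp add: has_real_derivative_iff_has_vector_derivative)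
    moreover have nonneg: "0 \<le> F (\<gamma> s) (velocity A \<gamma> {u..v} s)"
      using F_nonneg[OF velocity_in_tangent_space[of \<gamma> u v s]] T s by simp
    have "0 < ?T' s"
      by (rule le_less_trans[OF nonneg]) (use T s in simp)
    ultimately show "\<exists>y. (T has_real_derivative y) (at s) \<and> 0 < y" by blast
  qed
qed

lemma piecewise_rises_dist:
  assumes "piecewise_on (rises T \<gamma>) a b" "a < b"
  shows "d (\<gamma> a) (\<gamma> b) \<le> T b - T a" "T a < T b" "continuous_on {a..b} T"
proof -
  have "d (\<gamma> a) (\<gamma> b) \<le> T b - T a \<and> T a < T b \<and> continuous_on {a..b} T"
    using assms
  proof (induction rule: piecewise_on_induct)
    case (piece u v)
    then show ?case using rises_dist by blast
  next
    case (join u v w)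
    then have "continuous_on ({u..v} \<union> {v..w}) T"
      by (intro continuous_on_closed_Un) auto
    moreover have "{u..v} \<union> {v..w} = {u..w}" using join by auto
    ultimately show ?case
      using join finsler_dist_triangle[of "\<gamma> u" "\<gamma> w" "\<gamma> v"] by simp
  qed
  then show "d (\<gamma> a) (\<gamma> b) \<le> T b - T a" "T a < T b" "continuous_on {a..b} T" by auto
qed

lemma smooth_curve_rises:
  assumes "smooth_curve_on A \<gamma> {u..v}" "u < v" "len \<gamma> u v < \<epsilon>"
  obtains T where "rises T \<gamma> {u..v}" "T u = 0" "T v < \<epsilon>"
proof -
  obtain T where T: "\<And>K. smooth_on K T" "T u = 0"
    "T v < integral {u..v} (\<lambda>s. F (\<gamma> s) (velocity A \<gamma> {u..v} s)) + (\<epsilon> - len \<gamma> u v)"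
    "\<And>s. s \<in> {u..v} \<Longrightarrow> \<exists>y. (T has_real_derivative y) (at s) \<and> F (\<gamma> s) (velocity A \<gamma> {u..v} s) < y"
    by (rule continuous_strict_upper_smooth[OF continuous_on_speed[OF assms(1,2)] assms(2), of "\<epsilon> - len \<gamma> u v"])
       (use assms(3) in simp, rule that, assumption+)
  have "F (\<gamma> s) (velocity A \<gamma> {u..v} s) < vector_derivative T (at s within {u..v})" if s: "s \<in> {u..v}" for s
  proof -
    obtain y where y: "(T has_real_derivative y) (at s)" "F (\<gamma> s) (velocity A \<gamma> {u..v} s) < y" using T(4)[OF s] by blast
    then have "(T has_vector_derivative y) (at s within {u..v})"
      by (simp add: has_real_derivative_iff_has_vector_derivative has_vector_derivative_at_within)
    then have "vector_derivative T (at s within {u..v}) = y"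
      by (rule vector_derivative_within_closed_interval[OF assms(2) s])
    then show ?thesis using y(2) by metis
  qed
  then show ?thesis
    using that[of T] T(1-3) assms(1) unfolding faster_than_def curve_length_def by simp
qed

text \<open>The bound \<epsilon> is quantified inside the induction, so that the surplus over the
  total length can be shared equally between the two parts at each join.\<close>

lemma piecewise_smooth_rises:
  assumes "piecewise_smooth_curve A \<gamma> a b" "a < b" "len \<gamma> a b < \<epsilon>"
  obtains T where "piecewise_on (rises T \<gamma>) a b" "T a = 0" "T b < \<epsilon>"
proof -
  have "piecewise_smooth_curve A \<gamma> a b \<and>
      (\<forall>\<epsilon>>len \<gamma> a b. \<exists>T. piecewise_on (rises T \<gamma>) a b \<and> T a = 0 \<and> T b < \<epsilon>)"
    using assms(1)[unfolded piecewise_smooth_curve_def] assms(2)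
  proof (induction rule: piecewise_on_induct)
    case (piece u v)
    then show ?case
      using smooth_curve_rises piecewise_on_single unfolding piecewise_smooth_curve_def by metis
  next
    case (join u v w)
    have ps: "piecewise_smooth_curve A \<gamma> u w" "len \<gamma> u w = len \<gamma> u v + len \<gamma> v w"
      using len_join[of \<gamma> u v w] join by auto
    moreover have "\<exists>T. piecewise_on (rises T \<gamma>) u w \<and> T u = 0 \<and> T w < \<epsilon>" if \<epsilon>: "len \<gamma> u w < \<epsilon>" for \<epsilon>
    proof -
      define \<delta> where "\<delta> = (\<epsilon> - len \<gamma> u w) / 2"
      have \<delta>: "\<delta> > 0" "len \<gamma> u v + len \<gamma> v w + 2 * \<delta> = \<epsilon>" using \<epsilon> ps(2) by (auto simp: \<delta>_def field_simps)
      obtain T1 where T1: "piecewise_on (rises T1 \<gamma>) u v" "T1 u = 0" "T1 v < len \<gamma> u v + \<delta>"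
        using join.IH(1) \<delta>(1) by (metis less_add_same_cancel1)
      obtain T2 where T2: "piecewise_on (rises T2 \<gamma>) v w" "T2 v = 0" "T2 w < len \<gamma> v w + \<delta>"
        using join.IH(2) \<delta>(1) by (metis less_add_same_cancel1)
      \<comment> \<open>Raising the second time function by T1 v makes the two agree at v, where a
        corner is allowed. The form \<open>1 * s + 0\<close> matches
        \<open>piecewise_rises_compose_affine\<close>.\<close>
      define T where "T s = (if s \<le> v then T1 s else T2 (1 * s + 0) + T1 v)" for s
      have "piecewise_on (rises T \<gamma>) u v"
        by (rule piecewise_rises_cong[OF T1(1)]) (auto simp: T_def)
      moreover have "piecewise_on (rises (\<lambda>s. T2 (1 * s + 0) + T1 v) (\<lambda>s. \<gamma> (1 * s + 0))) v w"
        using piecewise_rises_compose_affine[OF T2(1) join(2), of 1 0 "T1 v"] by simp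
      then have "piecewise_on (rises T \<gamma>) v w"
        by (rule piecewise_rises_cong) (auto simp: T_def T2(2))
      ultimately have "piecewise_on (rises T \<gamma>) u w" by (rule piecewise_on_join)
      moreover have "T u = 0" "T w < \<epsilon>" using join(1,2) T1 T2 \<delta> by (auto simp: T_def)
      ultimately show ?thesis by blast
    qed
    ultimately show ?case by blast
  qed
  then show ?thesis using that assms(3) by blast
qed

lemma rising_segment:
  assumes "d p q < \<epsilon>"
  obtains T \<gamma> where "piecewise_on (rises T \<gamma>) 0 1" "T 0 = 0" "T 1 < \<epsilon>" "\<gamma> 0 = p" "\<gamma> 1 = q"
proof -
  obtain \<gamma> a b where \<gamma>: "a < b" "piecewise_smooth_curve A \<gamma> a b" "\<gamma> a = p" "\<gamma> b = q" "len \<gamma> a b < \<epsilon>"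
    using curve_of_dist_less[OF assms] unfolding curve_between_def by blast
  obtain T where T: "piecewise_on (rises T \<gamma>) a b" "T a = 0" "T b < \<epsilon>"
    using piecewise_smooth_rises[OF \<gamma>(2,1,5)] by blast
  have "piecewise_on (rises (\<lambda>s. T ((b - a) * s + a) + 0) (\<lambda>s. \<gamma> ((b - a) * s + a))) 0 1"
    using piecewise_rises_compose_affine[OF T(1) \<gamma>(1), of "b - a" a 0] \<gamma>(1) by simp
  then show ?thesis by (rule that) (use T \<gamma> in auto)
qed

end

subsection \<open>Completeness and endpoints\<close>

lemma right_endpoint_continuous_image:
  assumes "right_endpoint \<Gamma> I q" "continuous_on UNIV f"
  shows "right_endpoint (\<lambda>s. f (\<Gamma> s)) I (f q)"
  unfolding right_endpoint_def
proof (intro allI impI)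
  fix W assume "open W \<and> f q \<in> W"
  then have "open (f -` W)" "q \<in> f -` W" using assms(2) by (auto intro: open_vimage)
  then show "\<exists>s\<in>I. \<forall>r\<in>I. s \<le> r \<longrightarrow> f (\<Gamma> r) \<in> W"
    using assms(1) unfolding right_endpoint_def by blast
qed

lemma left_endpoint_continuous_image:
  assumes "left_endpoint \<Gamma> I q" "continuous_on UNIV f"
  shows "left_endpoint (\<lambda>s. f (\<Gamma> s)) I (f q)"
  unfolding left_endpoint_def
proof (intro allI impI)
  fix W assume "open W \<and> f q \<in> W"
  then have "open (f -` W)" "q \<in> f -` W" using assms(2) by (auto intro: open_vimage)
  then show "\<exists>s\<in>I. \<forall>r\<in>I. r \<le> s \<longrightarrow> f (\<Gamma> r) \<in> W"
    using assms(1) unfolding left_endpoint_def by blast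
qed

lemma left_endpoint_reflect:
  assumes "right_endpoint (\<lambda>s. \<Gamma> (- s)) (uminus ` I) q"
  shows "left_endpoint \<Gamma> (I :: real set) q"
  unfolding left_endpoint_def
proof (intro allI impI)
  fix W assume "open W \<and> q \<in> W"
  then obtain s where s: "s \<in> I" "\<forall>r\<in>uminus ` I. - s \<le> r \<longrightarrow> \<Gamma> (- r) \<in> W"
    using assms unfolding right_endpoint_def by blast
  have "\<Gamma> r \<in> W" if "r \<in> I" "r \<le> s" for r
    using s(2)[rule_format, of "- r"] that by simp
  then show "\<exists>s\<in>I. \<forall>r\<in>I. r \<le> s \<longrightarrow> \<Gamma> r \<in> W" using s(1) by blast
qed

lemma open_real_greater:
  fixes s :: real
  assumes "open I" "s \<in> I"
  obtains r where "r \<in> I" "s < r"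
proof -
  obtain e where e: "e > 0" "ball s e \<subseteq> I" using assms open_contains_ball by blast
  have "s + e / 2 \<in> I" using e by (auto simp: dist_real_def)
  then show ?thesis using that e(1) by simp
qed

context finsler_manifold
begin

text \<open>Completeness only yields a limit x of a sequence of points on the curve. The estimate
  \<open>d (\<gamma> s) x \<le> \<tau> - T s\<close>, valid for all s, turns it into a limit of the
  whole curve. The hypothesis on T speaks of distances instead of \<open>rises\<close>, so that for
  a reflected curve it can be read off from the equality of the distances of the two
  metrics.\<close>

lemma forward_complete_right_endpoint:
  assumes complete: "forward_complete A F" and I: "open I" "I \<noteq> {}"
    and T: "\<And>s s'. s \<in> I \<Longrightarrow> s' \<in> I \<Longrightarrow> s < s' \<Longrightarrow> d (\<gamma> s) (\<gamma> s') \<le> T s' - T s \<and> T s < T s'"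
    and bound: "\<And>s. s \<in> I \<Longrightarrow> T s \<le> B"
  shows "\<exists>q. right_endpoint (\<lambda>s. (T s, \<gamma> s)) I q"
proof -
  define \<tau> where "\<tau> = Sup (T ` I)"
  have bdd: "bdd_above (T ` I)" using bound by (intro bdd_aboveI[of _ B]) auto
  \<comment> \<open>I is open and T increases strictly, so the supremum is not attained.\<close>
  have lt: "T s < \<tau>" if s: "s \<in> I" for s
  proof -
    obtain r where "r \<in> I" "s < r" using open_real_greater[OF I(1) s] by blast
    then show ?thesis using T[OF s] cSup_upper[OF _ bdd, of "T r"] unfolding \<tau>_def by force
  qed
  have near: "\<exists>r\<in>I. s < r \<and> \<tau> - \<epsilon> < T r" if s: "s \<in> I" and "\<epsilon> > 0" for s \<epsilon>
  proof -
    obtain s1 where s1: "s1 \<in> I" "s < s1" using open_real_greater[OF I(1) s] by blast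
    obtain y where "y \<in> T ` I" "\<tau> - \<epsilon> < y"
      using less_cSupD[of "T ` I" "\<tau> - \<epsilon>"] I(2) \<open>\<epsilon> > 0\<close> unfolding \<tau>_def by auto
    then obtain r where r: "r \<in> I" "\<tau> - \<epsilon> < T r" by blast
    show ?thesis
    proof (cases "r \<le> s1")
      case True
      then have "T r \<le> T s1" using T[OF r(1) s1(1)] by (cases "r = s1") auto
      then show ?thesis using s1 r by force
    next
      case False
      then have "s < r" using s1(2) by simp
      then show ?thesis using r by blast
    qed
  qed
  \<comment> \<open>The parameters increase, so that distances are estimated from earlier to later
    points; the times approach \<tau> at a known rate, which makes the points forward
    Cauchy.\<close>
  have "\<exists>f. \<forall>n::nat. (f n \<in> I \<and> \<tau> - 1 / (real n + 1) < T (f n)) \<and> f n < f (Suc n)"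
  proof (rule dependent_nat_choice)
    obtain s where "s \<in> I" using I(2) by blast
    then show "\<exists>x. x \<in> I \<and> \<tau> - 1 / (real 0 + 1) < T x" using near[of s 1] by auto
    show "\<exists>y. (y \<in> I \<and> \<tau> - 1 / (real (Suc n) + 1) < T y) \<and> x < y"
      if "x \<in> I \<and> \<tau> - 1 / (real n + 1) < T x" for x n
      using near[of x "1 / (real (Suc n) + 1)"] that by auto
  qed
  then obtain f where f: "\<And>n::nat. f n \<in> I" "\<And>n. \<tau> - 1 / (real n + 1) < T (f n)" "\<And>n. f n < f (Suc n)"
    by blast
  have inc: "f i < f j" if "i < j" for i j using lift_Suc_mono_less[of f, OF f(3) that] .
  have "forward_Cauchy d (\<gamma> \<circ> f)"
    unfolding forward_Cauchy_def
  proof (intro allI impI)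
    fix \<epsilon> :: real assume "\<epsilon> > 0"
    then obtain N where N: "inverse (real (Suc N)) < \<epsilon>" using reals_Archimedean by blast
    have "d ((\<gamma> \<circ> f) i) ((\<gamma> \<circ> f) j) < \<epsilon>" if "i > N" "i \<le> j" for i j
    proof (cases "i = j")
      case True
      \<comment> \<open>The Cauchy condition includes the case i = j, which requires that a point
        has distance 0 from itself.\<close>
      have "d (\<gamma> (f i)) (\<gamma> (f i)) = 0"
        using tendsto_finsler_dist[OF tendsto_const[of "\<gamma> (f i)" sequentially]]
        by (simp add: tendsto_const_iff)
      then show ?thesis using True \<open>\<epsilon> > 0\<close> by simp
    next
      case False
      then have "d (\<gamma> (f i)) (\<gamma> (f j)) \<le> T (f j) - T (f i)" using T[OF f(1,1) inc] that by simp
      also have "\<dots> < 1 / (real i + 1)" using lt[OF f(1), of j] f(2)[of i] by simp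
      also have "\<dots> \<le> inverse (real (Suc N))" using that by (simp add: field_simps)
      finally show ?thesis using N by simp
    qed
    then show "\<exists>N. \<forall>i j. i > N \<and> j > N \<and> i \<le> j \<longrightarrow> d ((\<gamma> \<circ> f) i) ((\<gamma> \<circ> f) j) < \<epsilon>" by blast
  qed
  then obtain x where x: "(\<gamma> \<circ> f) \<longlonglongrightarrow> x"
    using complete unfolding forward_complete_def convergent_def by blast
  \<comment> \<open>Triangle inequality through \<open>\<gamma> (f n)\<close> with
    \<open>f n\<close> beyond s; the distance from there to x tends to 0.\<close>
  have dist: "d (\<gamma> s) x \<le> \<tau> - T s" if s: "s \<in> I" for s
  proof (rule tendsto_lowerbound[of "\<lambda>n. (\<tau> - T s) + d ((\<gamma> \<circ> f) n) x" _ sequentially])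
    show "(\<lambda>n. (\<tau> - T s) + d ((\<gamma> \<circ> f) n) x) \<longlonglongrightarrow> \<tau> - T s"
      using tendsto_add[OF tendsto_const tendsto_finsler_dist[OF x]] by simp
    obtain N where N: "inverse (real (Suc N)) < \<tau> - T s" using reals_Archimedean lt[OF s] by (metis diff_gt_0_iff_gt)
    have "d (\<gamma> s) x \<le> (\<tau> - T s) + d ((\<gamma> \<circ> f) n) x" if "n \<ge> N" for n
    proof -
      have "1 / (real n + 1) \<le> inverse (real (Suc N))" using that by (simp add: field_simps)
      then have "T s < T (f n)" using f(2)[of n] N by linarith
      then have "s < f n" using T[OF f(1)[of n] s] by (metis less_asym linorder_neqE)
      then have "d (\<gamma> s) (\<gamma> (f n)) \<le> \<tau> - T s" using T[OF s f(1)] lt[OF f(1), of n] by force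
      then show ?thesis using finsler_dist_triangle[of "\<gamma> s" x "\<gamma> (f n)"] by simp
    qed
    then show "\<forall>\<^sub>F n in sequentially. d (\<gamma> s) x \<le> (\<tau> - T s) + d ((\<gamma> \<circ> f) n) x"
      unfolding eventually_sequentially by blast
  qed simp
  have "right_endpoint (\<lambda>s. (T s, \<gamma> s)) I (\<tau>, x)"
    unfolding right_endpoint_def
  proof (intro allI impI)
    fix W assume W: "open W \<and> (\<tau>, x) \<in> W"
    then obtain U V where UV: "open U" "open V" "\<tau> \<in> U" "x \<in> V" "U \<times> V \<subseteq> W"
      unfolding open_prod_def by blast
    obtain \<delta> where \<delta>: "\<delta> > 0" "\<And>p. d p x < \<delta> \<Longrightarrow> p \<in> V" using finsler_dist_neighbourhood[OF UV(2,4)] by blast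
    obtain \<eta> where \<eta>: "\<eta> > 0" "ball \<tau> \<eta> \<subseteq> U" using UV(1,3) open_contains_ball by blast
    obtain s0 where "s0 \<in> I" using I(2) by blast
    then obtain s where s: "s \<in> I" "\<tau> - min \<delta> \<eta> < T s"
      using near[of s0 "min \<delta> \<eta>"] \<delta>(1) \<eta>(1) by auto
    have "(T r, \<gamma> r) \<in> W" if r: "r \<in> I" "s \<le> r" for r
    proof -
      have "T s \<le> T r" using T[OF s(1) r(1)] r(2) by (cases "s = r") auto
      then have "\<tau> - T r < \<delta>" "\<tau> - T r < \<eta>" using s(2) by auto
      then have "\<gamma> r \<in> V" "T r \<in> ball \<tau> \<eta>"
        using \<delta>(2) dist[OF r(1)] lt[OF r(1)] by (auto simp: dist_real_def)
      then show ?thesis using UV(5) \<eta>(2) by blast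
    qed
    then show "\<exists>s\<in>I. \<forall>r\<in>I. s \<le> r \<longrightarrow> (T r, \<gamma> r) \<in> W" using s(1) by blast
  qed
  then show ?thesis by blast
qed

section \<open>Rising curves through forward Cauchy sequences\<close>

lemma rises_const:
  assumes "u < v"
  shows "rises (\<lambda>s. t + s) (\<lambda>s. p) {u..v}"
  unfolding faster_than_def
proof (intro conjI ballI)
  show "smooth_on {u..v} (\<lambda>s. t + s)" using smooth_on_line[of "{u..v}" t 1] by simp
  obtain c where c: "c \<in> A" "p \<in> fst c" using chart_around by blast
  have "smooth_on (UNIV \<inter> {u..v}) (snd c \<circ> (\<lambda>s. p))"
    using smooth_on_line[of "{u..v}" "snd c p" 0] by (simp add: o_def)
  then show "smooth_curve_on A (\<lambda>s. p) {u..v}"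
    unfolding smooth_curve_on_def using c
    by (intro ballI bexI[of _ c] exI[of _ UNIV]) auto
  fix s assume s: "s \<in> {u..v}"
  have "vector_derivative (snd c \<circ> (\<lambda>s. p)) (at s within {u..v}) = 0" for c :: "('s, 'e) chart"
    by (rule vector_derivative_within_closed_interval[OF assms s]) (simp add: o_def)
  then have "velocity A (\<lambda>s. p) {u..v} s = (\<lambda>c. 0)" by (auto simp: velocity_def)
  moreover have "((\<lambda>s. t + s) has_vector_derivative 1) (at s within {u..v})"
    by (auto intro!: derivative_eq_intros)
  then have "vector_derivative (\<lambda>s. t + s) (at s within {u..v}) = 1"
    by (rule vector_derivative_within_closed_interval[OF assms s])
  ultimately show "F p (velocity A (\<lambda>s. p) {u..v} s) < vector_derivative (\<lambda>s. t + s) (at s within {u..v})"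
    by simp
qed

lemma forward_Cauchy_fast_subsequence:
  assumes "forward_Cauchy d x"
  obtains r :: "nat \<Rightarrow> nat" where "strict_mono r"
    "\<And>k i j. r k \<le> i \<Longrightarrow> i \<le> j \<Longrightarrow> d (x i) (x j) < (1 / 2) ^ k"
proof -
  have C: "\<exists>N. \<forall>i j. N < i \<and> i \<le> j \<longrightarrow> d (x i) (x j) < (1 / 2) ^ k" for k :: nat
    using assms[unfolded forward_Cauchy_def, rule_format, of "(1 / 2) ^ k"] by (meson le_less_trans not_le zero_less_power half_gt_zero zero_less_one)
  have "\<exists>r. \<forall>k. (\<forall>i j. r k \<le> i \<and> i \<le> j \<longrightarrow> d (x i) (x j) < (1 / 2) ^ k) \<and> r k < r (Suc k)"
  proof (rule dependent_nat_choice)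
    show "\<exists>m. \<forall>i j. m \<le> i \<and> i \<le> j \<longrightarrow> d (x i) (x j) < (1 / 2) ^ 0"
      using C[of 0] by (meson Suc_le_lessD)
    fix m k
    obtain N where N: "\<forall>i j. N < i \<and> i \<le> j \<longrightarrow> d (x i) (x j) < (1 / 2) ^ Suc k" using C by blast
    then show "\<exists>y. (\<forall>i j. y \<le> i \<and> i \<le> j \<longrightarrow> d (x i) (x j) < (1 / 2) ^ Suc k) \<and> m < y"
      by (intro exI[of _ "Suc (max N m)"]) auto
  qed
  then obtain r where r: "\<And>k. \<forall>i j. r k \<le> i \<and> i \<le> j \<longrightarrow> d (x i) (x j) < (1 / 2) ^ k" "\<And>k. r k < r (Suc k)"
    by blast
  show ?thesis by (rule that[of r]) (use r in \<open>auto simp: strict_mono_Suc_iff\<close>)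
qed

text \<open>The triangle inequality goes through a point \<open>x (r k)\<close> with r k \<ge> i, so
  that \<open>d (x i) (x (r k))\<close> runs forward and is small by the Cauchy property. Taking k
  \<ge> i guarantees r k \<ge> i.\<close>

lemma forward_Cauchy_subsequence_limit:
  assumes C: "forward_Cauchy d x" and r: "strict_mono (r :: nat \<Rightarrow> nat)" and lim: "(x \<circ> r) \<longlonglongrightarrow> q"
  shows "x \<longlonglongrightarrow> q"
proof (rule tendsto_of_finsler_dist, rule LIMSEQ_I)
  fix \<epsilon> :: real assume "0 < \<epsilon>"
  then obtain N where N: "\<And>i j. i > N \<Longrightarrow> j > N \<Longrightarrow> i \<le> j \<Longrightarrow> d (x i) (x j) < \<epsilon> / 2"
    using C unfolding forward_Cauchy_def by (metis half_gt_zero)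
  have "\<forall>\<^sub>F k in sequentially. d ((x \<circ> r) k) q < \<epsilon> / 2"
    by (rule order_tendstoD(2)[OF tendsto_finsler_dist[OF lim]]) (use \<open>0 < \<epsilon>\<close> in simp)
  then obtain K where K: "\<And>k. k \<ge> K \<Longrightarrow> d (x (r k)) q < \<epsilon> / 2" by (auto simp: eventually_sequentially)
  have "norm (d (x i) q - 0) < \<epsilon>" if "i \<ge> Suc N" for i
  proof -
    define k where "k = max K i"
    have "i \<le> r k" using seq_suble[OF r, of k] by (simp add: k_def)
    then have "d (x i) (x (r k)) < \<epsilon> / 2" using N[of i "r k"] that by simp
    moreover have "d (x (r k)) q < \<epsilon> / 2" using K[of k] by (simp add: k_def)
    ultimately show ?thesis
      using finsler_dist_triangle[of "x i" q "x (r k)"] finsler_dist_nonneg[of "x i" q] by simp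
  qed
  then show "\<exists>no. \<forall>n\<ge>no. norm (d (x n) q - 0) < \<epsilon>" by blast
qed

text \<open>The curve is vertical for negative times. For positive times it lies above a concatenation
  of curves of summable length through a subsequence of the given Cauchy sequence.\<close>

lemma not_forward_complete_curve:
  assumes "\<not> forward_complete A F"
  obtains T \<gamma> where "\<And>a b. a < b \<Longrightarrow> piecewise_on (rises T \<gamma>) a b" "\<And>s. T s < \<tau>"
    "\<And>s. s \<le> 0 \<Longrightarrow> T s = \<tau> - 2 + s" "\<not> (\<exists>q. right_endpoint \<gamma> UNIV q)"
proof -
  obtain x where C: "forward_Cauchy d x" and nc: "\<not> convergent x"
    using assms unfolding forward_complete_def by blast
  obtain r :: "nat \<Rightarrow> nat" where r: "strict_mono r"
    "\<And>k i j. r k \<le> i \<Longrightarrow> i \<le> j \<Longrightarrow> d (x i) (x j) < (1 / 2) ^ k"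
    using forward_Cauchy_fast_subsequence[OF C] by blast
  define y where "y k = x (r k)" for k
  have "\<exists>T \<gamma>. piecewise_on (rises T \<gamma>) 0 1 \<and> T 0 = 0 \<and> T 1 < (1 / 2) ^ k \<and> \<gamma> 0 = y k \<and> \<gamma> 1 = y (Suc k)" for k
  proof -
    have "d (y k) (y (Suc k)) < (1 / 2) ^ k"
      unfolding y_def using r(2)[of k "r k" "r (Suc k)"] r(1) by (simp add: strict_mono_less_eq)
    then show ?thesis by (rule rising_segment) blast
  qed
  then obtain Ts \<gamma>s where seg: "\<And>k::nat. piecewise_on (rises (Ts k) (\<gamma>s k)) 0 1" "\<And>k. Ts k 0 = 0"
    "\<And>k. Ts k 1 < (1 / 2) ^ k" "\<And>k. \<gamma>s k 0 = y k" "\<And>k. \<gamma>s k 1 = y (Suc k)"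
    by metis
  \<comment> \<open>S n is the time reached at parameter n. The rises of all segments together
    cannot exceed 2, the sum of all (1/2)^j; hence the start at \<tau> - 2.\<close>
  define S where "S n = \<tau> - 2 + (\<Sum>j<n. Ts j 1)" for n
  \<comment> \<open>Segment n occupies the parameters from n to n + 1; at an integer the formula
    uses the segment that begins there.\<close>
  define fl where "fl s = nat \<lfloor>s\<rfloor>" for s :: real
  define T where "T s = (if s < 0 then \<tau> - 2 + s else S (fl s) + Ts (fl s) (s - real (fl s)))" for s
  define \<gamma> where "\<gamma> s = (if s < 0 then y 0 else \<gamma>s (fl s) (s - real (fl s)))" for s
  have fl: "fl s = n" if "real n \<le> s" "s < real n + 1" for s n
    using that unfolding fl_def by (simp add: floor_eq_iff nat_eq_iff)
  have at_nat: "T (real n) = S n" "\<gamma> (real n) = y n" for n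
    using fl[of n "real n"] seg(2,4) by (auto simp: T_def \<gamma>_def)
  have piece: "piecewise_on (rises T \<gamma>) (real n) (real (Suc n))" for n
  proof (rule piecewise_rises_cong)
    show "piecewise_on (rises (\<lambda>s. Ts n (1 * s + (- real n)) + S n) (\<lambda>s. \<gamma>s n (1 * s + (- real n)))) (real n) (real (Suc n))"
      using piecewise_rises_compose_affine[OF seg(1)[of n], where k = 1 and l = "- real n" and e = "S n"] by (simp add: add.commute)
    fix s assume s: "s \<in> {real n..real (Suc n)}"
    \<comment> \<open>At its right end, segment n has to be compared with the formula for segment n
      + 1; the values agree because the latter starts with relative time 0.\<close>
    show "Ts n (1 * s + (- real n)) + S n = T s"
    proof (cases "s = real (Suc n)")
      case True
      then show ?thesis using at_nat(1)[of "Suc n"] by (simp add: S_def)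
    next
      case False
      then show ?thesis using fl[of n s] s by (auto simp: T_def)
    qed
    show "\<gamma>s n (1 * s + (- real n)) = \<gamma> s"
    proof (cases "s = real (Suc n)")
      case True
      then show ?thesis using at_nat(2)[of "Suc n"] seg(5)[of n] by simp
    next
      case False
      then show ?thesis using fl[of n s] s by (auto simp: \<gamma>_def)
    qed
  qed
  have neg: "T s = \<tau> - 2 + s \<and> \<gamma> s = y 0" if "s \<le> 0" for s
    using at_nat[of 0] that by (cases "s = 0") (auto simp: T_def \<gamma>_def S_def)
  have past: "piecewise_on (rises T \<gamma>) (- real (Suc n)) 0" for n
    by (rule piecewise_rises_cong[OF piecewise_on_single[where Q = "rises (\<lambda>s. \<tau> - 2 + s) (\<lambda>s. y 0)", OF rises_const]])
       (use neg in auto)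
  have future: "piecewise_on (rises T \<gamma>) 0 (real (Suc n))" for n
  proof (induction n)
    case 0
    then show ?case using piece[of 0] by simp
  next
    case (Suc n)
    then show ?case using piece[of "Suc n"] piecewise_on_join by blast
  qed
  have all: "piecewise_on (rises T \<gamma>) a b" if "a < b" for a b
  proof -
    obtain n where n: "max \<bar>a\<bar> \<bar>b\<bar> \<le> real n" using real_arch_simple by blast
    show ?thesis
      by (rule piecewise_rises_restrict[OF piecewise_on_join[OF past[of n] future[of n]]]) (use n that in auto)
  qed
  have "T s < \<tau>" for s
  proof -
    obtain n where n: "\<bar>s\<bar> < real n" using reals_Archimedean2 by blast
    \<comment> \<open>The strict bound by \<tau> comes from the strict increase of T; for the
      partial sums a weak bound is then enough.\<close>
    have "T s < T (real n)" using piecewise_rises_dist(2)[OF all] n by simp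
    also have "\<dots> \<le> \<tau> - 2 + (\<Sum>j<n. (1 / 2) ^ j)"
      unfolding at_nat S_def using seg(3) by (intro add_left_mono sum_mono less_imp_le)
    also have "(\<Sum>j<n. (1 / 2) ^ j) \<le> (2 :: real)"
      by (simp add: geometric_sum)
    finally show ?thesis by simp
  qed
  moreover have "\<not> (\<exists>q. right_endpoint \<gamma> UNIV q)"
  proof
    assume "\<exists>q. right_endpoint \<gamma> UNIV q"
    then obtain q where q: "right_endpoint \<gamma> UNIV q" by blast
    \<comment> \<open>At integer parameters the curve passes through the subsequence, so an endpoint
      of the curve would be a limit of the subsequence and then of x.\<close>
    have "(x \<circ> r) \<longlonglongrightarrow> q"
    proof (rule topological_tendstoI)
      fix W assume "open W" "q \<in> W"
      then obtain s where s: "\<And>s'. s \<le> s' \<Longrightarrow> \<gamma> s' \<in> W" using q unfolding right_endpoint_def by blast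
      obtain N where "s \<le> real N" using real_arch_simple by blast
      then have "(x \<circ> r) n \<in> W" if "n \<ge> N" for n
        using s[of "real n"] at_nat(2)[of n] that by (simp add: y_def)
      then show "\<forall>\<^sub>F n in sequentially. (x \<circ> r) n \<in> W" unfolding eventually_sequentially by blast
    qed
    then show False using forward_Cauchy_subsequence_limit[OF C r(1)] nc unfolding convergent_def by blast
  qed
  ultimately show ?thesis using that[of T \<gamma>] all neg by blast
qed

end

subsection \<open>The Fermat metric\<close>

lemma inextensible_time_reflection:
  fixes \<Gamma> :: "real \<Rightarrow> real \<times> 's::topological_space"
  assumes "inextensible \<Gamma> I"
  shows "inextensible (\<lambda>s. (- fst (\<Gamma> s), snd (\<Gamma> s))) I"
proof -
  have f: "continuous_on UNIV (\<lambda>z :: real \<times> 's. (- fst z, snd z))" by (intro continuous_intros)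
  show ?thesis
    using assms right_endpoint_continuous_image[OF _ f] left_endpoint_continuous_image[OF _ f]
    unfolding inextensible_def by fastforce
qed

text \<open>A right endpoint would project to a right endpoint of \<gamma>, and a left endpoint
  would bound T from below for all sufficiently early parameters.\<close>

lemma inextensible_vertical_past:
  assumes "\<not> (\<exists>q. right_endpoint \<gamma> UNIV q)" "\<And>s. s \<le> 0 \<Longrightarrow> T s = a + s"
  shows "inextensible (\<lambda>s. (T s :: real, \<gamma> s)) UNIV"
  unfolding inextensible_def
proof
  show "\<not> (\<exists>q. right_endpoint (\<lambda>s. (T s, \<gamma> s)) UNIV q)"
    using assms(1) right_endpoint_continuous_image[of "\<lambda>s. (T s, \<gamma> s)" UNIV _ snd, OF _ continuous_on_snd[OF continuous_on_id]]
    by auto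
  show "\<not> (\<exists>q. left_endpoint (\<lambda>s. (T s, \<gamma> s)) UNIV q)"
  proof
    assume "\<exists>q. left_endpoint (\<lambda>s. (T s, \<gamma> s)) UNIV q"
    then obtain q where q: "left_endpoint (\<lambda>s. (T s, \<gamma> s)) UNIV q" by blast
    have "left_endpoint T UNIV (fst q)"
      using left_endpoint_continuous_image[OF q continuous_on_fst[OF continuous_on_id]] by simp
    moreover have "open {fst q - 1<..}" "fst q \<in> {fst q - 1<..}" by auto
    ultimately obtain s where s: "\<And>r. r \<le> s \<Longrightarrow> T r \<in> {fst q - 1<..}"
      unfolding left_endpoint_def by blast
    define r where "r = min (min s 0) (fst q - 1 - a)"
    have "T r = a + r" using assms(2)[of r] by (simp add: r_def)
    moreover have "r \<le> fst q - 1 - a" by (simp add: r_def)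
    moreover have "fst q - 1 < T r" using s[of r] by (simp add: r_def)
    ultimately show False by linarith
  qed
qed

context finsler_manifold
begin

text \<open>A curve traversed backwards has in F' the length that the original has in F. The
  opposite inequality follows by exchanging the two metrics.\<close>

lemma reverse_dist_le:
  assumes "finsler_manifold A F'"
    and F': "\<And>p \<xi>. \<xi> \<in> tangent_space A p \<Longrightarrow> F' p (\<lambda>c. - \<xi> c) = F p \<xi>"
  shows "finsler_dist A F' q p \<le> d p q"
proof (rule field_le_epsilon)
  interpret R: finsler_manifold A F' by fact
  fix \<epsilon> :: real assume "0 < \<epsilon>"
  then obtain \<gamma> a b where \<gamma>: "a < b" "piecewise_smooth_curve A \<gamma> a b" "\<gamma> a = p" "\<gamma> b = q" "len \<gamma> a b < d p q + \<epsilon>"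
    using curve_of_dist_less[of p q "d p q + \<epsilon>"] unfolding curve_between_def by auto
  let ?\<gamma> = "\<lambda>s. \<gamma> (- 1 * s + 0)"
  have "piecewise_smooth_curve A \<gamma> a b \<and> piecewise_smooth_curve A ?\<gamma> (- b) (- a) \<and>
      R.len ?\<gamma> (- b) (- a) = len \<gamma> a b"
    using \<gamma>(2)[unfolded piecewise_smooth_curve_def] \<gamma>(1)
  proof (induction rule: piecewise_on_induct)
    case (piece u v)
    have vim: "(\<lambda>s. - 1 * s + 0) -` {u..v} = {- v..- u}" by auto
    have lt: "- v < - u" using piece(1) by simp
    have "smooth_curve_on A ?\<gamma> {- v..- u}"
      using smooth_curve_on_compose_affine[OF piece(2), of "- 1" 0] unfolding vim .
    moreover have "((\<lambda>s. F' (\<gamma> (- 1 * s + 0)) (velocity A ?\<gamma> {- v..- u} s)) has_integral len \<gamma> u v) {- v..- u}"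
    proof (rule len_compose_affine_piece[OF piece(2,1) _ vim lt, where F' = F'])
      show "F' p (\<lambda>c. - 1 *\<^sub>R \<xi> c) = \<bar>- 1\<bar> * F p \<xi>" if "\<xi> \<in> tangent_space A p" for p \<xi>
        using F'[OF that] by simp
    qed simp
    then have "R.len ?\<gamma> (- v) (- u) = len \<gamma> u v"
      unfolding curve_length_def[of A F' ?\<gamma>] by (rule integral_unique)
    ultimately show ?case
      using lt piece piecewise_on_single[of "smooth_curve_on A ?\<gamma>"] piecewise_on_single[of "smooth_curve_on A \<gamma>"]
      unfolding piecewise_smooth_curve_def by blast
  next
    case (join u v w)
    then show ?case
      using R.len_join[of ?\<gamma> "- w" "- v" "- u"] len_join[of \<gamma> u v w] by auto
  qed
  then have "R.curve_between q p (len \<gamma> a b)"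
    unfolding R.curve_between_def using \<gamma> by (intro exI[of _ ?\<gamma>] exI[of _ "- b"] exI[of _ "- a"]) auto
  then show "R.d q p \<le> d p q + \<epsilon>" using R.dist_le_curve \<gamma>(5) by fastforce
qed

text \<open>F' stands for the reversed metric, whose forward completeness controls the past end of
  the curve. Exchanging the two metrics gives the case of past-directed curves.\<close>

lemma rises_crossing:
  assumes complete: "forward_complete A F" "forward_complete A F'"
    and F': "finsler_manifold A F'" "\<And>p q. finsler_dist A F' q p = d p q"
    and I: "open I" "is_interval I" "I \<noteq> {}"
    and rise: "\<And>a b. a \<in> I \<Longrightarrow> b \<in> I \<Longrightarrow> a < b \<Longrightarrow> piecewise_on (rises T \<gamma>) a b"
    and inext: "inextensible (\<lambda>s. (T s, \<gamma> s)) I"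
  shows "\<exists>!s. s \<in> I \<and> T s = t"
proof -
  interpret R: finsler_manifold A F' by fact
  have T: "d (\<gamma> s) (\<gamma> s') \<le> T s' - T s \<and> T s < T s'" if "s \<in> I" "s' \<in> I" "s < s'" for s s'
    using piecewise_rises_dist[OF rise[OF that] that(3)] by blast
  obtain s1 where s1: "s1 \<in> I" "t < T s1"
  proof (rule ccontr)
    assume "\<not> thesis"
    then have "T s \<le> t" if "s \<in> I" for s using that \<open>\<And>s1. s1 \<in> I \<Longrightarrow> t < T s1 \<Longrightarrow> thesis\<close> by force
    then have "\<exists>q. right_endpoint (\<lambda>s. (T s, \<gamma> s)) I q"
      by (intro forward_complete_right_endpoint[OF complete(1) I(1,3), where B = t] T)
    then show False using inext unfolding inextensible_def by blast
  qed
  obtain s2 where s2: "s2 \<in> I" "T s2 < t"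
  proof (rule ccontr)
    assume "\<not> thesis"
    then have low: "t \<le> T s" if "s \<in> I" for s using that \<open>\<And>s2. s2 \<in> I \<Longrightarrow> T s2 < t \<Longrightarrow> thesis\<close> by force
    \<comment> \<open>Reflecting parameter and time together keeps the time increasing and reverses
      the direction of travel, which is the direction that F' measures.\<close>
    have "\<exists>q. right_endpoint (\<lambda>s. (- T (- s), \<gamma> (- s))) (uminus ` I) q"
    proof (rule R.forward_complete_right_endpoint[OF complete(2)])
      show "open (uminus ` I)" "uminus ` I \<noteq> {}" using I open_negations by auto
      fix s s' assume ss: "s \<in> uminus ` I" "s' \<in> uminus ` I" "s < s'"
      then have "- s \<in> I" "- s' \<in> I" by auto
      then show "R.d (\<gamma> (- s)) (\<gamma> (- s')) \<le> - T (- s') - - T (- s) \<and> - T (- s) < - T (- s')"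
        using T[of "- s'" "- s"] ss(3) F'(2) by simp
    next
      show "- T (- s) \<le> - t" if "s \<in> uminus ` I" for s using low[of "- s"] that by auto
    qed
    then obtain q where q: "left_endpoint (\<lambda>s. (- T s, \<gamma> s)) I q"
      using left_endpoint_reflect[of "\<lambda>s. (- T s, \<gamma> s)" I] by blast
    have "continuous_on UNIV (\<lambda>z :: real \<times> 's. (- fst z, snd z))" by (intro continuous_intros)
    from left_endpoint_continuous_image[OF q this] show False
      using inext unfolding inextensible_def by auto
  qed
  have "s2 < s1"
    using T[OF s1(1) s2(1)] s1(2) s2(2) by (cases s1 s2 rule: linorder_cases) auto
  then obtain s where s: "s2 \<le> s" "s \<le> s1" "T s = t"
    using IVT'[of T s2 t s1] piecewise_rises_dist(3)[OF rise[OF s2(1) s1(1)]] s1(2) s2(2) by auto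
  then have "s \<in> I" using mem_is_interval_1_I[OF I(2) s2(1) s1(1)] by blast
  then show ?thesis
  proof (intro ex1I[of _ s])
    show "s' = s" if "s' \<in> I \<and> T s' = t" for s'
      using T[of s s'] T[of s' s] \<open>s \<in> I\<close> that s(3) by (cases s s' rule: linorder_cases) auto
  qed (use s in auto)
qed

end

context smooth_manifold
begin

lemma linear_on_tangent_coord:
  assumes "linear_on_tangent A p \<alpha>" "c \<in> A" "p \<in> fst c"
  shows "linear (\<lambda>v. \<alpha> (coord_vector A p c v))"
  using assms coord_vector_in_tangent_space[OF assms(2,3)]
  unfolding linear_on_tangent_def
  by (intro linearI) (simp_all add: coord_vector_add coord_vector_scaleR)

lemma linear_on_tangent_zero:
  assumes "linear_on_tangent A p \<alpha>"
  shows "\<alpha> (\<lambda>c. 0) = 0"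
  using assms[unfolded linear_on_tangent_def, THEN conjunct2, rule_format, OF zero_in_tangent_space, of 0]
  by simp

end

lemma linear_Basis_expansion:
  fixes f :: "'e::euclidean_space \<Rightarrow> real"
  assumes "linear f"
  shows "f v = (\<Sum>i\<in>Basis. (v \<bullet> i) * f i)"
proof -
  have "f v = f (\<Sum>i\<in>Basis. (v \<bullet> i) *\<^sub>R i)" by (simp add: euclidean_representation)
  also have "\<dots> = (\<Sum>i\<in>Basis. (v \<bullet> i) * f i)"
    using assms by (simp add: linear_sum linear_scale)
  finally show ?thesis .
qed

lemma sqrt_less_iff_square_less:
  assumes "0 \<le> r"
  shows "sqrt r < y \<longleftrightarrow> 0 < y \<and> r < y\<^sup>2"
proof (cases "0 < y")
  case True
  then show ?thesis using real_sqrt_less_iff[of r "y\<^sup>2"] by simp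
next
  case False
  have "0 \<le> sqrt r" using assms by simp
  then have "\<not> sqrt r < y" using False by linarith
  then show ?thesis using False by blast
qed

section \<open>Positivity, homogeneity and continuity of the Fermat metric\<close>

context standard_stationary
begin

lemma linear_omega: "linear_on_tangent A p (\<omega> p)"
  using one_form unfolding smooth_one_form_def by blast

lemma linear_g0: "\<xi> \<in> tangent_space A p \<Longrightarrow> linear_on_tangent A p (g0 p \<xi>)"
  using riemannian unfolding riemannian_metric_def by blast

lemma g0_commute:
  "\<xi> \<in> tangent_space A p \<Longrightarrow> \<eta> \<in> tangent_space A p \<Longrightarrow> g0 p \<xi> \<eta> = g0 p \<eta> \<xi>"
  using riemannian unfolding riemannian_metric_def by blast

lemma g0_pos: "\<xi> \<in> tangent_space A p \<Longrightarrow> \<xi> \<noteq> (\<lambda>c. 0) \<Longrightarrow> g0 p \<xi> \<xi> > 0"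
  using riemannian unfolding riemannian_metric_def by blast

lemma g0_nonneg: "\<xi> \<in> tangent_space A p \<Longrightarrow> g0 p \<xi> \<xi> \<ge> 0"
  using g0_pos[of \<xi> p] linear_on_tangent_zero[OF linear_g0[OF zero_in_tangent_space], of p]
  by (cases "\<xi> = (\<lambda>c. 0)") auto

lemma omega_scaleR: "\<xi> \<in> tangent_space A p \<Longrightarrow> \<omega> p (\<lambda>c. r *\<^sub>R \<xi> c) = r * \<omega> p \<xi>"
  using linear_omega[of p] unfolding linear_on_tangent_def by blast

lemma g0_scaleR:
  assumes "\<xi> \<in> tangent_space A p"
  shows "g0 p (\<lambda>c. r *\<^sub>R \<xi> c) (\<lambda>c. r *\<^sub>R \<xi> c) = r\<^sup>2 * g0 p \<xi> \<xi>"
proof -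
  note r = tangent_space_scaleR[OF assms, of r]
  have "g0 p (\<lambda>c. r *\<^sub>R \<xi> c) (\<lambda>c. r *\<^sub>R \<xi> c) = r * g0 p (\<lambda>c. r *\<^sub>R \<xi> c) \<xi>"
    using linear_g0[OF r] assms unfolding linear_on_tangent_def by blast
  also have "g0 p (\<lambda>c. r *\<^sub>R \<xi> c) \<xi> = r * g0 p \<xi> \<xi>"
    using g0_commute[OF r assms] linear_g0[OF assms] assms unfolding linear_on_tangent_def by simp
  finally show ?thesis by (simp add: power2_eq_square)
qed

text \<open>\<open>smooth_one_form\<close> controls the dependence on the base point for a fixed
  coordinate vector. Joint continuity comes from linearity: expanding the vector in the basis leaves
  finitely many continuous coefficient functions.\<close>

lemma continuous_on_omega_chart:
  assumes c: "c \<in> A"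
  shows "continuous_on (snd c ` fst c \<times> UNIV) (\<lambda>z. \<omega> (chart_inv c (fst z)) (coord_vector A (chart_inv c (fst z)) c (snd z)))"
proof (rule continuous_on_cong[THEN iffD1, OF refl])
  let ?w = "\<lambda>i x. \<omega> (chart_inv c x) (coord_vector A (chart_inv c x) c i)"
  have "continuous_on (snd c ` fst c) (?w i)" for i
    using one_form c unfolding smooth_one_form_def by (intro smooth_on_imp_continuous_on) blast
  then have "continuous_on (snd c ` fst c \<times> UNIV) (\<lambda>z. ?w i (fst z))" for i
    by (rule continuous_on_compose2[OF _ continuous_on_fst[OF continuous_on_id]]) auto
  then show "continuous_on (snd c ` fst c \<times> UNIV) (\<lambda>z. \<Sum>i\<in>Basis. (snd z \<bullet> i) * ?w i (fst z))"
    by (intro continuous_intros)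
  show "(\<Sum>i\<in>Basis. (snd z \<bullet> i) * ?w i (fst z)) =
      \<omega> (chart_inv c (fst z)) (coord_vector A (chart_inv c (fst z)) c (snd z))"
    if "z \<in> snd c ` fst c \<times> UNIV" for z
    using linear_Basis_expansion[OF linear_on_tangent_coord[OF linear_omega c chart_inv_in_domain[OF c]], of "fst z" "snd z"]
      that by (simp add: mem_Times_iff)
qed

text \<open>As for \<omega>, with both arguments expanded. Linearity of g0 is given in its second
  argument; symmetry moves the other vector there.\<close>

lemma continuous_on_g0_chart:
  assumes c: "c \<in> A"
  shows "continuous_on (snd c ` fst c \<times> UNIV)
    (\<lambda>z. g0 (chart_inv c (fst z)) (coord_vector A (chart_inv c (fst z)) c (snd z))
            (coord_vector A (chart_inv c (fst z)) c (snd z)))"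
proof (rule continuous_on_cong[THEN iffD1, OF refl])
  let ?g = "\<lambda>x v w. g0 (chart_inv c x) (coord_vector A (chart_inv c x) c v) (coord_vector A (chart_inv c x) c w)"
  have "continuous_on (snd c ` fst c) (\<lambda>x. ?g x i j)" for i j
    using riemannian c unfolding riemannian_metric_def by (intro smooth_on_imp_continuous_on) blast
  then have "continuous_on (snd c ` fst c \<times> UNIV) (\<lambda>z. ?g (fst z) i j)" for i j
    by (rule continuous_on_compose2[OF _ continuous_on_fst[OF continuous_on_id]]) auto
  then show "continuous_on (snd c ` fst c \<times> UNIV)
      (\<lambda>z. \<Sum>i\<in>Basis. (snd z \<bullet> i) * (\<Sum>j\<in>Basis. (snd z \<bullet> j) * ?g (fst z) i j))"
    by (intro continuous_intros)
  show "(\<Sum>i\<in>Basis. (snd z \<bullet> i) * (\<Sum>j\<in>Basis. (snd z \<bullet> j) * ?g (fst z) i j)) = ?g (fst z) (snd z) (snd z)"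
    if z: "z \<in> snd c ` fst c \<times> UNIV" for z
  proof -
    let ?p = "chart_inv c (fst z)"
    have p: "?p \<in> fst c" using chart_inv_in_domain[OF c] z by (simp add: mem_Times_iff)
    note t = coord_vector_in_tangent_space[OF c p]
    have lin: "linear (\<lambda>w. ?g (fst z) v w)" for v
      by (rule linear_on_tangent_coord[OF linear_g0[OF t] c p])
    have "?g (fst z) (snd z) (snd z) = (\<Sum>i\<in>Basis. (snd z \<bullet> i) * ?g (fst z) (snd z) i)"
      by (rule linear_Basis_expansion[OF lin])
    also have "\<dots> = (\<Sum>i\<in>Basis. (snd z \<bullet> i) * ?g (fst z) i (snd z))"
      using g0_commute[OF t t] by simp
    also have "\<dots> = (\<Sum>i\<in>Basis. (snd z \<bullet> i) * (\<Sum>j\<in>Basis. (snd z \<bullet> j) * ?g (fst z) i j))"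
      by (intro sum.cong refl arg_cong[where f = "\<lambda>x. _ * x"] linear_Basis_expansion[OF lin])
    finally show ?thesis by simp
  qed
qed

lemma fermat_finsler: "finsler_manifold A (fermat_metric g0 \<omega> \<beta>)"
proof
  show "connected (UNIV :: 's set)" by (rule connected_base)
  show "0 < fermat_metric g0 \<omega> \<beta> p \<xi>" if \<xi>: "\<xi> \<in> tangent_space A p" "\<xi> \<noteq> (\<lambda>c. 0)" for p \<xi>
  proof -
    let ?w = "1 / \<beta> p * \<omega> p \<xi>"
    \<comment> \<open>Since g0 is positive, the square root strictly exceeds the absolute value of
      \<omega>/\<beta>, so F is positive also where \<omega> is negative.\<close>
    have "?w\<^sup>2 < 1 / \<beta> p * g0 p \<xi> \<xi> + 1 / (\<beta> p)\<^sup>2 * (\<omega> p \<xi>)\<^sup>2"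
      using g0_pos[OF \<xi>] positive_lapse[of p] by (simp add: power_mult_distrib power_divide)
    then have "\<bar>?w\<bar> < sqrt (1 / \<beta> p * g0 p \<xi> \<xi> + 1 / (\<beta> p)\<^sup>2 * (\<omega> p \<xi>)\<^sup>2)"
      by (rule real_less_rsqrt[of "\<bar>?w\<bar>", unfolded power2_abs])
    then show ?thesis unfolding fermat_metric_def by linarith
  qed
  show "fermat_metric g0 \<omega> \<beta> p (\<lambda>c. r *\<^sub>R \<xi> c) = r * fermat_metric g0 \<omega> \<beta> p \<xi>"
    if "\<xi> \<in> tangent_space A p" "0 \<le> r" for p \<xi> r
  proof -
    have "1 / \<beta> p * g0 p (\<lambda>c. r *\<^sub>R \<xi> c) (\<lambda>c. r *\<^sub>R \<xi> c) + 1 / (\<beta> p)\<^sup>2 * (\<omega> p (\<lambda>c. r *\<^sub>R \<xi> c))\<^sup>2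
        = r\<^sup>2 * (1 / \<beta> p * g0 p \<xi> \<xi> + 1 / (\<beta> p)\<^sup>2 * (\<omega> p \<xi>)\<^sup>2)"
      unfolding omega_scaleR[OF that(1)] g0_scaleR[OF that(1)] by (simp add: algebra_simps power_mult_distrib)
    then have "sqrt (1 / \<beta> p * g0 p (\<lambda>c. r *\<^sub>R \<xi> c) (\<lambda>c. r *\<^sub>R \<xi> c) + 1 / (\<beta> p)\<^sup>2 * (\<omega> p (\<lambda>c. r *\<^sub>R \<xi> c))\<^sup>2)
        = r * sqrt (1 / \<beta> p * g0 p \<xi> \<xi> + 1 / (\<beta> p)\<^sup>2 * (\<omega> p \<xi>)\<^sup>2)"
      using that(2) by (simp only: real_sqrt_mult real_sqrt_abs abs_of_nonneg)
    then show ?thesis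
      unfolding fermat_metric_def by (simp only: omega_scaleR[OF that(1)]) (simp add: algebra_simps)
  qed
  show "continuous_on (snd c ` fst c \<times> UNIV)
      (\<lambda>(x, v). fermat_metric g0 \<omega> \<beta> (chart_inv c x) (coord_vector A (chart_inv c x) c v))" if c: "c \<in> A" for c
  proof -
    have "continuous_on (snd c ` fst c) (\<beta> \<circ> chart_inv c)"
      using smooth_lapse c unfolding smooth_function_def by (intro smooth_on_imp_continuous_on) blast
    then have b: "continuous_on (snd c ` fst c \<times> UNIV) (\<lambda>z. \<beta> (chart_inv c (fst z)))"
      unfolding o_def by (rule continuous_on_compose2[OF _ continuous_on_fst[OF continuous_on_id]]) auto
    have "\<beta> p \<noteq> 0" for p using positive_lapse[of p] by simp
    then show ?thesis
      unfolding fermat_metric_def split_beta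
      by (intro continuous_intros b continuous_on_omega_chart[OF c] continuous_on_g0_chart[OF c]) auto
  qed
qed

section \<open>Time reversal and timelike cones\<close>

lemma reversed: "standard_stationary A g0 (\<lambda>p \<xi>. - \<omega> p \<xi>) \<beta>"
proof
  show "smooth_one_form A (\<lambda>p \<xi>. - \<omega> p \<xi>)"
    unfolding smooth_one_form_def
  proof (intro conjI allI ballI)
    show "linear_on_tangent A p (\<lambda>\<xi>. - \<omega> p \<xi>)" for p
      using linear_omega[of p] unfolding linear_on_tangent_def by simp
    show "smooth_on (snd c ` fst c) (\<lambda>x. - \<omega> (chart_inv c x) (coord_vector A (chart_inv c x) c v))"
      if "c \<in> A" for c v
    proof -
      have "smooth_on (snd c ` fst c) (\<lambda>x. \<omega> (chart_inv c x) (coord_vector A (chart_inv c x) c v))"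
        using one_form that unfolding smooth_one_form_def by blast
      from smooth_on_affine_image[OF this, of "- 1" 0] show ?thesis by simp
    qed
  qed
qed (fact connected_base riemannian smooth_lapse positive_lapse)+

lemma fermat_reversed:
  assumes "\<xi> \<in> tangent_space A p"
  shows "fermat_metric g0 (\<lambda>p \<xi>. - \<omega> p \<xi>) \<beta> p (\<lambda>c. - \<xi> c) = fermat_metric g0 \<omega> \<beta> p \<xi>"
  using omega_scaleR[OF assms, of "- 1"] g0_scaleR[OF assms, of "- 1"]
  unfolding fermat_metric_def by simp

text \<open>For X = (\<tau>, \<xi>), w = \<omega>(\<xi>)/\<beta> and k = g0(\<xi>, \<xi>)/\<beta>,
  one has g(X, X) = \<beta> (k + w^2 - (\<tau> - w)^2) and g(X, \<open>partial_t\<close>) = \<beta>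
  (w - \<tau>). The Fermat metric is the larger root w + sqrt(k + w^2) of g(X, X) = 0 in \<tau>, and
  the sign of the second product selects the branch \<tau> > w.\<close>

lemma future_timelike_iff:
  assumes "\<xi> \<in> tangent_space A p"
  shows "future_timelike (stationary_metric g0 \<omega> \<beta>) (t, p) (\<tau>, \<xi>) \<longleftrightarrow> fermat_metric g0 \<omega> \<beta> p \<xi> < \<tau>"
proof -
  define w where "w = \<omega> p \<xi> / \<beta> p"
  define k where "k = g0 p \<xi> \<xi> / \<beta> p"
  have b: "\<beta> p > 0" by (rule positive_lapse)
  have wk: "\<omega> p \<xi> = \<beta> p * w" "g0 p \<xi> \<xi> = \<beta> p * k" using b by (auto simp: w_def k_def)
  have k: "k \<ge> 0" using g0_nonneg[OF assms] b by (simp add: k_def)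
  have F: "fermat_metric g0 \<omega> \<beta> p \<xi> = w + sqrt (k + w\<^sup>2)"
    unfolding fermat_metric_def w_def k_def by (simp add: power_divide)
  have "stationary_metric g0 \<omega> \<beta> (t, p) (\<tau>, \<xi>) (\<tau>, \<xi>) = \<beta> p * (k + w\<^sup>2 - (\<tau> - w)\<^sup>2)"
    unfolding stationary_metric_def by (simp add: wk power2_eq_square algebra_simps)
  moreover have "stationary_metric g0 \<omega> \<beta> (t, p) (\<tau>, \<xi>) partial_t = \<beta> p * (w - \<tau>)"
    unfolding stationary_metric_def partial_t_def
    using linear_on_tangent_zero[OF linear_omega] linear_on_tangent_zero[OF linear_g0[OF assms]]
    by (simp add: wk algebra_simps)
  ultimately have "future_timelike (stationary_metric g0 \<omega> \<beta>) (t, p) (\<tau>, \<xi>) \<longleftrightarrow>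
      0 < \<tau> - w \<and> k + w\<^sup>2 < (\<tau> - w)\<^sup>2"
    unfolding future_timelike_def using b by (auto simp: mult_less_0_iff)
  also have "\<dots> \<longleftrightarrow> sqrt (k + w\<^sup>2) < \<tau> - w"
    using k by (intro sqrt_less_iff_square_less[symmetric]) simp
  finally show ?thesis unfolding F by auto
qed

lemma past_timelike_iff:
  assumes "\<xi> \<in> tangent_space A p"
  shows "past_timelike (stationary_metric g0 \<omega> \<beta>) (t, p) (\<tau>, \<xi>) \<longleftrightarrow>
    fermat_metric g0 (\<lambda>p \<xi>. - \<omega> p \<xi>) \<beta> p \<xi> < - \<tau>"
proof -
  \<comment> \<open>Changing the signs of \<tau> and \<omega> together preserves g(X, X) and changes
    the sign of g(X, \<open>partial_t\<close>).\<close>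
  have "past_timelike (stationary_metric g0 \<omega> \<beta>) (t, p) (\<tau>, \<xi>) \<longleftrightarrow>
      future_timelike (stationary_metric g0 (\<lambda>p \<xi>. - \<omega> p \<xi>) \<beta>) (t, p) (- \<tau>, \<xi>)"
    unfolding past_timelike_def future_timelike_def stationary_metric_def partial_t_def
    using linear_on_tangent_zero[OF linear_omega] linear_on_tangent_zero[OF linear_g0[OF assms]]
    by (auto simp: algebra_simps)
  then show ?thesis using standard_stationary.future_timelike_iff[OF reversed assms] by simp
qed

lemma future_piece_iff:
  assumes "u < v"
  shows "smooth_spacetime_curve_on A \<Gamma> {u..v} \<and>
      (\<forall>s\<in>{u..v}. future_timelike (stationary_metric g0 \<omega> \<beta>) (\<Gamma> s) (spacetime_velocity A \<Gamma> {u..v} s)) \<longleftrightarrow>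
    faster_than A (fermat_metric g0 \<omega> \<beta>) (fst \<circ> \<Gamma>) (snd \<circ> \<Gamma>) {u..v}"
proof (cases "smooth_spacetime_curve_on A \<Gamma> {u..v}")
  case True
  then have sm: "smooth_on {u..v} (fst \<circ> \<Gamma>)" "smooth_curve_on A (snd \<circ> \<Gamma>) {u..v}"
    unfolding smooth_spacetime_curve_on_def by auto
  have "future_timelike (stationary_metric g0 \<omega> \<beta>) (\<Gamma> s) (spacetime_velocity A \<Gamma> {u..v} s) \<longleftrightarrow>
      fermat_metric g0 \<omega> \<beta> ((snd \<circ> \<Gamma>) s) (velocity A (snd \<circ> \<Gamma>) {u..v} s)
        < vector_derivative (fst \<circ> \<Gamma>) (at s within {u..v})" if "s \<in> {u..v}" for s
    using future_timelike_iff[OF velocity_in_tangent_space[OF sm(2) assms that], of "fst (\<Gamma> s)"]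
    unfolding spacetime_velocity_def by simp
  then show ?thesis using True sm unfolding faster_than_def by simp
next
  case False
  then show ?thesis unfolding faster_than_def smooth_spacetime_curve_on_def by blast
qed

lemma past_piece_iff:
  assumes "u < v"
  shows "smooth_spacetime_curve_on A \<Gamma> {u..v} \<and>
      (\<forall>s\<in>{u..v}. past_timelike (stationary_metric g0 \<omega> \<beta>) (\<Gamma> s) (spacetime_velocity A \<Gamma> {u..v} s)) \<longleftrightarrow>
    faster_than A (fermat_metric g0 (\<lambda>p \<xi>. - \<omega> p \<xi>) \<beta>) (\<lambda>s. - fst (\<Gamma> s)) (snd \<circ> \<Gamma>) {u..v}"
proof (cases "smooth_spacetime_curve_on A \<Gamma> {u..v}")
  case True
  then have sm: "smooth_on {u..v} (fst \<circ> \<Gamma>)" "smooth_curve_on A (snd \<circ> \<Gamma>) {u..v}"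
    unfolding smooth_spacetime_curve_on_def by auto
  have "past_timelike (stationary_metric g0 \<omega> \<beta>) (\<Gamma> s) (spacetime_velocity A \<Gamma> {u..v} s) \<longleftrightarrow>
      fermat_metric g0 (\<lambda>p \<xi>. - \<omega> p \<xi>) \<beta> ((snd \<circ> \<Gamma>) s) (velocity A (snd \<circ> \<Gamma>) {u..v} s)
        < vector_derivative (\<lambda>s. - fst (\<Gamma> s)) (at s within {u..v})" if s: "s \<in> {u..v}" for s
  proof -
    have "((\<lambda>s. - (fst \<circ> \<Gamma>) s) has_vector_derivative - vector_derivative (fst \<circ> \<Gamma>) (at s within {u..v})) (at s within {u..v})"
      by (rule has_vector_derivative_minus[OF smooth_on_vector_derivative_within[OF sm(1) assms s]])
    then have "vector_derivative (\<lambda>s. - (fst \<circ> \<Gamma>) s) (at s within {u..v}) = - vector_derivative (fst \<circ> \<Gamma>) (at s within {u..v})"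
      by (rule vector_derivative_within_closed_interval[OF assms s])
    then show ?thesis
      using past_timelike_iff[OF velocity_in_tangent_space[OF sm(2) assms s], of "fst (\<Gamma> s)"]
      unfolding spacetime_velocity_def by simp
  qed
  then show ?thesis
    using True sm smooth_on_affine_image[OF sm(1), of "- 1" 0] unfolding faster_than_def by simp
next
  case False
  have "\<not> smooth_on {u..v} (\<lambda>s. - fst (\<Gamma> s)) \<or> \<not> smooth_curve_on A (snd \<circ> \<Gamma>) {u..v}"
    using False smooth_on_affine_image[of "{u..v}" "\<lambda>s. - fst (\<Gamma> s)" "- 1" 0]
    unfolding smooth_spacetime_curve_on_def by (auto simp: o_def)
  then show ?thesis using False unfolding faster_than_def by blast
qed

lemma timelike_curve_iff:
  fixes \<Gamma> :: "real \<Rightarrow> real \<times> 's"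
  defines "Q \<equiv> faster_than A (fermat_metric g0 \<omega> \<beta>) (fst \<circ> \<Gamma>) (snd \<circ> \<Gamma>)"
    and "Q' \<equiv> faster_than A (fermat_metric g0 (\<lambda>p \<xi>. - \<omega> p \<xi>) \<beta>) (\<lambda>s. - fst (\<Gamma> s)) (snd \<circ> \<Gamma>)"
  shows "timelike_curve A (stationary_metric g0 \<omega> \<beta>) \<Gamma> I \<longleftrightarrow>
    open I \<and> is_interval I \<and> I \<noteq> {} \<and>
    ((\<forall>a\<in>I. \<forall>b\<in>I. a < b \<longrightarrow> piecewise_on Q a b) \<or> (\<forall>a\<in>I. \<forall>b\<in>I. a < b \<longrightarrow> piecewise_on Q' a b))"
proof -
  let ?P = "\<lambda>C K. smooth_spacetime_curve_on A \<Gamma> K \<and> (\<forall>s\<in>K. C (\<Gamma> s) (spacetime_velocity A \<Gamma> K s))"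
  let ?f = "future_timelike (stationary_metric g0 \<omega> \<beta>)" and ?p = "past_timelike (stationary_metric g0 \<omega> \<beta>)"
  have "piecewise_on (?P ?f) a b \<longleftrightarrow> piecewise_on Q a b" for a b
    using piecewise_on_mono[of "?P ?f" a b Q] piecewise_on_mono[of Q a b "?P ?f"] future_piece_iff[of _ _ \<Gamma>]
    unfolding Q_def by blast
  moreover have "piecewise_on (?P ?p) a b \<longleftrightarrow> piecewise_on Q' a b" for a b
    using piecewise_on_mono[of "?P ?p" a b Q'] piecewise_on_mono[of Q' a b "?P ?p"] past_piece_iff[of _ _ \<Gamma>]
    unfolding Q'_def by blast
  ultimately show ?thesis unfolding timelike_curve_def by simp
qed

lemma finsler_dist_reversed:
  "finsler_dist A (fermat_metric g0 (\<lambda>p \<xi>. - \<omega> p \<xi>) \<beta>) q p = finsler_dist A (fermat_metric g0 \<omega> \<beta>) p q"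
proof (rule antisym)
  interpret R: standard_stationary A g0 "\<lambda>p \<xi>. - \<omega> p \<xi>" \<beta> by (rule reversed)
  show "finsler_dist A (fermat_metric g0 (\<lambda>p \<xi>. - \<omega> p \<xi>) \<beta>) q p \<le> finsler_dist A (fermat_metric g0 \<omega> \<beta>) p q"
    by (rule finsler_manifold.reverse_dist_le[OF fermat_finsler R.fermat_finsler fermat_reversed])
  show "finsler_dist A (fermat_metric g0 \<omega> \<beta>) p q \<le> finsler_dist A (fermat_metric g0 (\<lambda>p \<xi>. - \<omega> p \<xi>) \<beta>) q p"
    by (rule finsler_manifold.reverse_dist_le[OF R.fermat_finsler fermat_finsler])
       (use R.fermat_reversed in simp)
qed

lemma backward_complete_iff:
  "backward_complete A (fermat_metric g0 \<omega> \<beta>) \<longleftrightarrow>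
   forward_complete A (fermat_metric g0 (\<lambda>p \<xi>. - \<omega> p \<xi>) \<beta>)"
  unfolding backward_complete_def forward_complete_def backward_Cauchy_def forward_Cauchy_def
    finsler_dist_reversed by meson

section \<open>Completeness and the Cauchy property of slices\<close>

lemma cauchy_imp_forward_complete:
  assumes "cauchy_hypersurface A (stationary_metric g0 \<omega> \<beta>) (slice t0)"
  shows "forward_complete A (fermat_metric g0 \<omega> \<beta>)"
proof (rule ccontr)
  interpret finsler_manifold A "fermat_metric g0 \<omega> \<beta>" by (rule fermat_finsler)
  assume "\<not> forward_complete A (fermat_metric g0 \<omega> \<beta>)"
  then obtain T \<gamma> where T: "\<And>a b. a < b \<Longrightarrow> piecewise_on (rises T \<gamma>) a b" "\<And>s. T s < t0"
    "\<And>s. s \<le> 0 \<Longrightarrow> T s = t0 - 2 + s" "\<not> (\<exists>q. right_endpoint \<gamma> UNIV q)"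
    by (rule not_forward_complete_curve[where \<tau> = t0]) blast
  let ?\<Gamma> = "\<lambda>s. (T s, \<gamma> s)"
  have "timelike_curve A (stationary_metric g0 \<omega> \<beta>) ?\<Gamma> UNIV"
    unfolding timelike_curve_iff using T(1) by (simp add: o_def)
  moreover have "inextensible ?\<Gamma> UNIV" by (rule inextensible_vertical_past[OF T(4,3)])
  ultimately obtain s where "?\<Gamma> s \<in> slice t0" using assms unfolding cauchy_hypersurface_def by blast
  then show False using T(2)[of s] by (simp add: slice_def)
qed

lemma cauchy_imp_backward_complete:
  assumes "cauchy_hypersurface A (stationary_metric g0 \<omega> \<beta>) (slice t0)"
  shows "backward_complete A (fermat_metric g0 \<omega> \<beta>)"
  unfolding backward_complete_iff
proof (rule ccontr)
  interpret R: finsler_manifold A "fermat_metric g0 (\<lambda>p \<xi>. - \<omega> p \<xi>) \<beta>"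
    by (rule standard_stationary.fermat_finsler[OF reversed])
  assume "\<not> forward_complete A (fermat_metric g0 (\<lambda>p \<xi>. - \<omega> p \<xi>) \<beta>)"
  then obtain T \<gamma> where T: "\<And>a b. a < b \<Longrightarrow> piecewise_on (R.rises T \<gamma>) a b" "\<And>s. T s < - t0"
    "\<And>s. s \<le> 0 \<Longrightarrow> T s = - t0 - 2 + s" "\<not> (\<exists>q. right_endpoint \<gamma> UNIV q)"
    by (rule R.not_forward_complete_curve[where \<tau> = "- t0"]) blast
  \<comment> \<open>For the reversed metric the time stays below - t0; the time reflection of the
    curve is past-directed and stays above t0.\<close>
  let ?\<Gamma> = "\<lambda>s. (- T s, \<gamma> s)"
  have "timelike_curve A (stationary_metric g0 \<omega> \<beta>) ?\<Gamma> UNIV"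
    unfolding timelike_curve_iff using T(1) by (simp add: o_def)
  moreover have "inextensible ?\<Gamma> UNIV"
    using inextensible_time_reflection[OF inextensible_vertical_past[OF T(4,3)]] by simp
  ultimately obtain s where "?\<Gamma> s \<in> slice t0" using assms unfolding cauchy_hypersurface_def by blast
  then show False using T(2)[of s] by (simp add: slice_def)
qed

lemma complete_imp_cauchy:
  assumes "forward_complete A (fermat_metric g0 \<omega> \<beta>)" "backward_complete A (fermat_metric g0 \<omega> \<beta>)"
  shows "cauchy_hypersurface A (stationary_metric g0 \<omega> \<beta>) (slice t0)"
  unfolding cauchy_hypersurface_def
proof (intro allI impI)
  interpret R: standard_stationary A g0 "\<lambda>p \<xi>. - \<omega> p \<xi>" \<beta> by (rule reversed)
  note complete = assms(1) assms(2)[unfolded backward_complete_iff]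
  fix \<Gamma> :: "real \<Rightarrow> real \<times> 's" and I
  assume "timelike_curve A (stationary_metric g0 \<omega> \<beta>) \<Gamma> I \<and> inextensible \<Gamma> I"
  then have inext: "inextensible \<Gamma> I" and I: "open I" "is_interval I" "I \<noteq> {}"
    and cases: "(\<forall>a\<in>I. \<forall>b\<in>I. a < b \<longrightarrow>
        piecewise_on (faster_than A (fermat_metric g0 \<omega> \<beta>) (fst \<circ> \<Gamma>) (snd \<circ> \<Gamma>)) a b) \<or>
      (\<forall>a\<in>I. \<forall>b\<in>I. a < b \<longrightarrow>
        piecewise_on (faster_than A (fermat_metric g0 (\<lambda>p \<xi>. - \<omega> p \<xi>) \<beta>) (\<lambda>s. - fst (\<Gamma> s)) (snd \<circ> \<Gamma>)) a b)"
    unfolding timelike_curve_iff by blast+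
  from cases show "\<exists>!s. s \<in> I \<and> \<Gamma> s \<in> slice t0"
  proof
    assume rise: "\<forall>a\<in>I. \<forall>b\<in>I. a < b \<longrightarrow>
        piecewise_on (faster_than A (fermat_metric g0 \<omega> \<beta>) (fst \<circ> \<Gamma>) (snd \<circ> \<Gamma>)) a b"
    have "\<exists>!s. s \<in> I \<and> (fst \<circ> \<Gamma>) s = t0"
      by (rule finsler_manifold.rises_crossing[OF fermat_finsler complete R.fermat_finsler finsler_dist_reversed I,
            where \<gamma> = "snd \<circ> \<Gamma>"]) (use rise inext in \<open>simp_all add: o_def\<close>)
    then show ?thesis by (simp add: slice_def mem_Times_iff)
  next
    assume rise: "\<forall>a\<in>I. \<forall>b\<in>I. a < b \<longrightarrow>
        piecewise_on (faster_than A (fermat_metric g0 (\<lambda>p \<xi>. - \<omega> p \<xi>) \<beta>) (\<lambda>s. - fst (\<Gamma> s)) (snd \<circ> \<Gamma>)) a b"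
    \<comment> \<open>A past-directed curve rises for the reversed metric with the negated time, so
      the two completeness assumptions exchange their roles.\<close>
    have "\<exists>!s. s \<in> I \<and> - fst (\<Gamma> s) = - t0"
      by (rule finsler_manifold.rises_crossing[OF R.fermat_finsler complete(2,1) fermat_finsler
            finsler_dist_reversed[symmetric] I, where \<gamma> = "snd \<circ> \<Gamma>"])
         (use rise inextensible_time_reflection[OF inext] in auto)
    then show ?thesis by (simp add: slice_def mem_Times_iff)
  qed
qed

end

theorem theorem4p4:
  fixes A :: "('s::t2_space, 'e::euclidean_space) chart set"
    and g0 :: "'s \<Rightarrow> ('s, 'e) tangent \<Rightarrow> ('s, 'e) tangent \<Rightarrow> real"
    and \<omega> :: "'s \<Rightarrow> ('s, 'e) tangent \<Rightarrow> real"
    and \<beta> :: "'s \<Rightarrow> real"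
    and t0 :: real
  assumes "standard_stationary A g0 \<omega> \<beta>"
  shows "cauchy_hypersurface A (stationary_metric g0 \<omega> \<beta>) (slice t0) \<longleftrightarrow>
         forward_complete A (fermat_metric g0 \<omega> \<beta>) \<and>
         backward_complete A (fermat_metric g0 \<omega> \<beta>)"
proof -
  interpret standard_stationary A g0 \<omega> \<beta> by fact
  show ?thesis
    using cauchy_imp_forward_complete cauchy_imp_backward_complete complete_imp_cauchy by blast
qed

end
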